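(* Suppose that a finitely generated discrete quantum group $(\Gamma,u)$ with $n^2$ generators satisfies one of the following conditions: 1. $n\ge 4$ and $\mathbb{F}U_n\twoheadrightarrow\Gamma\twoheadrightarrow\mathbb{F}S_n$; 2. $n\ge 2$ and $\mathbb{F}U_n\twoheadrightarrow\Gamma\twoheadrightarrow\mathbb{F}O_n$. If $n(\Gamma)=n(\mathbb{F}U_n)$, then $\Gamma$ is isomorphic to $\mathbb{F}U_n$. Here $n(\cdot)$ denotes the operator norm of the self-adjoint main character, defined in the context.
   Context: An (algebraic) compact quantum group $\mathbb{G}$ is a Hopf $*$-algebra $\mathrm{Pol}(\mathbb{G})$ over $\mathbb{C}$ with comultiplication $\Delta$ which admits a unital positive linear functional $h:\mathrm{Pol}(\mathbb{G})\to\mathbb{C}$ (the Haar state; it is unique and faithful) with $(h\otimes\mathrm{id})\Delta=h(\cdot)1=(\mathrm{id}\otimes h)\Delta$. It is a compact matrix quantum group with fundamental representation $u=(u_{ij})_{i,j=1}^n\in M_n(\mathrm{Pol}(\mathbb{G}))$ if $u$ is unitary, $\Delta(u_{ij})=\sum_{k=1}^n u_{ik}\otimes u_{kj}$ for all $i,j$, the entries $u_{ij}$ generate $\mathrm{Pol}(\mathbb{G})$ as a unital $*$-algebra, and $u^c=(u_{ij}^* )_{i,j=1}^n$ is invertible in $M_n(\mathrm{Pol}(\mathbb{G}))$. A finitely generated discrete quantum group $(\Gamma,u)$ with $n^2$ generators is by definition the Pontryagin dual of a compact matrix quantum group $\mathbb{G}$ with fundamental representation $u\in M_n(\mathrm{Pol}(\mathbb{G}))$;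 all data about $(\Gamma,u)$ are expressed in terms of $(\mathrm{Pol}(\mathbb{G}),\Delta,u)$, and $u$ is often omitted from the notation. For $(\Gamma_1,u)$, $(\Gamma_2,v)$ with duals $\mathbb{G}_1,\mathbb{G}_2$ and fundamental representations of the same size $n$, write $\Gamma_2\twoheadrightarrow\Gamma_1$ if there is a $*$-homomorphism $\phi:\mathrm{Pol}(\mathbb{G}_2)\to\mathrm{Pol}(\mathbb{G}_1)$ with $\phi(v_{ij})=u_{ij}$ for all $i,j$; they are isomorphic if there is such a $\phi$ that is bijective. With $\chi_{\Gamma,u}=\sum_{i=1}^n u_{ii}$, set $m_k(\Gamma,u)=h\big((\chi_{\Gamma,u}+\chi_{\Gamma,u}^* )^k\big)$ and $n(\Gamma)=n(\Gamma,u)=\lim_{k\to\infty}m_{2k}(\Gamma,u)^{\frac1{2k}}$ (the operator norm of $\chi_{\Gamma,u}+\chi_{\Gamma,u}^*$ in the GNS representation of $h$). $\mathbb{F}U_n$, $\mathbb{F}O_n$, $\mathbb{F}S_n$ are the duals of the compact matrix quantum groups $U_n^+$, $O_n^+$, $S_n^+$, whose polynomial algebras are the universal unital $*$-algebras generated by $u_{ij}$ ($1\le i,j\le n$), with $\Delta(u_{ij})=\sum_k u_{ik}\otimes u_{kj}$ and fundamental representation $u=(u_{ij})$, subject respectively to: ($U_n^+$) $u$ and $u^c$ are unitary; ($O_n^+$) $u$ is unitary and $u_{ij}=u_{ij}^*$ for all $i,j$; ($S_n^+$) $u_{ij}=u_{ij}^*=u_{ij}^2$ for all $i,j$ and $\sum_{k}u_{ik}=1=\sum_k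 u_{kj}$ for all $i,j$. *)

theory Defs
  imports Complex_Main "HOL-Library.Cardinality" "HOL-Library.Nonpos_Ints" "HOL-Library.Poly_Mapping"
begin

section \<open>Complex vector spaces and unital *-algebras\<close>

class scaleC =
  fixes scaleC :: "complex \<Rightarrow> 'a \<Rightarrow> 'a"  (infixr \<open>*\<^sub>C\<close> 75)

class complex_vector = ab_group_add + scaleC +
  assumes scaleC_add_right: "c *\<^sub>C (x + y) = c *\<^sub>C x + c *\<^sub>C y"
    and scaleC_add_left: "(c + d) *\<^sub>C x = c *\<^sub>C x + d *\<^sub>C x"
    and scaleC_scaleC [simp]: "c *\<^sub>C (d *\<^sub>C x) = (c * d) *\<^sub>C x"
    and scaleC_one [simp]: "1 *\<^sub>C x = x"

global_interpretation complex_vector: vector_space "scaleC :: complex \<Rightarrow> 'a \<Rightarrow> 'a::complex_vector"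
  defines cspan_raw_def: cspan = complex_vector.span
  by unfold_locales (simp_all add: scaleC_add_right scaleC_add_left)

abbreviation clinear :: "('a::complex_vector \<Rightarrow> 'b::complex_vector) \<Rightarrow> bool" where
  "clinear \<equiv> Vector_Spaces.linear scaleC scaleC"

text \<open>The zero algebra is not excluded (\<open>0 \<noteq> 1\<close> is not assumed), so that algebras given by
  arbitrary generators and relations, and tensor products, are always instances.  A quantum group
  never has the zero algebra, since its Haar state satisfies \<open>h 1 = 1\<close>.\<close>

class complex_algebra_1 = complex_vector + ring + monoid_mult +
  assumes mult_scaleC_left [simp]: "(c *\<^sub>C x) * y = c *\<^sub>C (x * y)"
    and mult_scaleC_right [simp]: "x * (c *\<^sub>C y) = c *\<^sub>C (x * y)"

class complex_star_algebra = complex_algebra_1 +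
  fixes star :: "'a \<Rightarrow> 'a"
  assumes star_add: "star (x + y) = star x + star y"
    and star_scaleC: "star (c *\<^sub>C x) = cnj c *\<^sub>C star x"
    and star_mult: "star (x * y) = star y * star x"
    and star_star [simp]: "star (star x) = x"

instantiation complex :: complex_star_algebra
begin
definition scaleC_complex :: "complex \<Rightarrow> complex \<Rightarrow> complex" where "scaleC_complex c x = c * x"
definition star_complex :: "complex \<Rightarrow> complex" where "star_complex x = cnj x"
instance by standard (simp_all add: scaleC_complex_def star_complex_def algebra_simps)
end

definition algebra_hom :: "('a::complex_algebra_1 \<Rightarrow> 'b::complex_algebra_1) \<Rightarrow> bool" where
  "algebra_hom \<phi> \<longleftrightarrow> clinear \<phi> \<and> \<phi> 1 = 1 \<and> (\<forall>x y. \<phi> (x * y) = \<phi> x * \<phi> y)"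

definition star_hom :: "('a::complex_star_algebra \<Rightarrow> 'b::complex_star_algebra) \<Rightarrow> bool" where
  "star_hom \<phi> \<longleftrightarrow> algebra_hom \<phi> \<and> (\<forall>x. \<phi> (star x) = star (\<phi> x))"

inductive_set star_subalgebra :: "'a::complex_star_algebra set \<Rightarrow> 'a set" for G where
  gen: "g \<in> G \<Longrightarrow> g \<in> star_subalgebra G"
| one: "1 \<in> star_subalgebra G"
| add: "x \<in> star_subalgebra G \<Longrightarrow> y \<in> star_subalgebra G \<Longrightarrow> x + y \<in> star_subalgebra G"
| scale: "x \<in> star_subalgebra G \<Longrightarrow> c *\<^sub>C x \<in> star_subalgebra G"
| mult: "x \<in> star_subalgebra G \<Longrightarrow> y \<in> star_subalgebra G \<Longrightarrow> x * y \<in> star_subalgebra G"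
| star: "x \<in> star_subalgebra G \<Longrightarrow> star x \<in> star_subalgebra G"

inductive_set star_ideal :: "'a::complex_star_algebra set \<Rightarrow> 'a set" for R where
  base: "r \<in> R \<Longrightarrow> r \<in> star_ideal R"
| zero: "0 \<in> star_ideal R"
| add: "x \<in> star_ideal R \<Longrightarrow> y \<in> star_ideal R \<Longrightarrow> x + y \<in> star_ideal R"
| left: "x \<in> star_ideal R \<Longrightarrow> a * x \<in> star_ideal R"
| right: "x \<in> star_ideal R \<Longrightarrow> x * a \<in> star_ideal R"
| star: "x \<in> star_ideal R \<Longrightarrow> star x \<in> star_ideal R"

lemma star_ideal_scaleC: "x \<in> star_ideal R \<Longrightarrow> c *\<^sub>C x \<in> star_ideal R"
  using star_ideal.left[of x R "c *\<^sub>C 1"] by simp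

lemma star_ideal_uminus: "x \<in> star_ideal R \<Longrightarrow> - x \<in> star_ideal R"
  using star_ideal.left[of x R "- 1"] by simp

lemma star_ideal_diff: "x \<in> star_ideal R \<Longrightarrow> y \<in> star_ideal R \<Longrightarrow> x - y \<in> star_ideal R"
  using star_ideal.add[of x R "- y"] star_ideal_uminus[of y R] by simp

lemma star_zero [simp]: "star (0::'a::complex_star_algebra) = 0"
  using star_add[of 0 "0::'a"] by simp

lemma star_uminus: "star (- x) = - star (x::'a::complex_star_algebra)"
  using star_add[of x "- x"] by (simp add: eq_neg_iff_add_eq_0 add.commute)

lemma star_diff: "star (x - y) = star x - star (y::'a::complex_star_algebra)"
  using star_add[of x "- y"] by (simp add: star_uminus)

section \<open>Finitely supported functions\<close>

instantiation poly_mapping :: (type, complex_vector) complex_vector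
begin
lift_definition scaleC_poly_mapping :: "complex \<Rightarrow> ('a \<Rightarrow>\<^sub>0 'b) \<Rightarrow> ('a \<Rightarrow>\<^sub>0 'b)"
  is "\<lambda>c f k. c *\<^sub>C f k"
  by (erule finite_subset[rotated]) auto
instance
  by standard (transfer; simp add: fun_eq_iff scaleC_add_right scaleC_add_left)+
end

lemma scaleC_single: "c *\<^sub>C Poly_Mapping.single k a = Poly_Mapping.single k (c *\<^sub>C a)"
  by transfer (auto simp: fun_eq_iff when_def)

lemma poly_mapping_additive_ext:
  fixes F G :: "('a \<Rightarrow>\<^sub>0 'b::ab_group_add) \<Rightarrow> 'c::ab_group_add"
  assumes "\<And>x y. F (x + y) = F x + F y" "\<And>x y. G (x + y) = G x + G y"
    and "\<And>k c. F (Poly_Mapping.single k c) = G (Poly_Mapping.single k c)"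
  shows "F f = G f"
proof (induction f rule: update_induct)
  case const
  show ?case using assms(1)[of 0 0] assms(2)[of 0 0] by simp
next
  case (update f a b)
  have "Poly_Mapping.update a b f = f + Poly_Mapping.single a b"
    using update(1)
    by (intro poly_mapping_eqI) (auto simp: lookup_add lookup_single lookup_update when_def in_keys_iff)
  then show ?case using assms update by simp
qed

section \<open>Free unital *-algebras, and *-algebras given by generators and relations\<close>

datatype 'g letter = Gen 'g | Gen_star 'g

primrec letter_star :: "'g letter \<Rightarrow> 'g letter" where
  "letter_star (Gen g) = Gen_star g"
| "letter_star (Gen_star g) = Gen g"

lemma letter_star_star [simp]: "letter_star (letter_star l) = l"
  by (cases l) simp_all

datatype 'g star_word = Word (letters: "'g letter list")

instantiation star_word :: (type) monoid_add
begin
definition zero_star_word :: "'a star_word" where "0 = Word []"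
definition plus_star_word :: "'a star_word \<Rightarrow> 'a star_word \<Rightarrow> 'a star_word" where
  "v + w = Word (letters v @ letters w)"
instance by standard (simp_all add: zero_star_word_def plus_star_word_def)
end

definition word_star :: "'g star_word \<Rightarrow> 'g star_word" where
  "word_star w = Word (rev (map letter_star (letters w)))"

lemma word_star_star [simp]: "word_star (word_star w) = w"
  by (simp add: word_star_def rev_map comp_def)

lemma word_star_plus: "word_star (v + w) = word_star w + word_star v"
  by (simp add: word_star_def plus_star_word_def)

text \<open>Noncommutative *-polynomials: the complex monoid algebra over words in the generators and
  their formal adjoints.\<close>

typedef 'g free_star = "UNIV :: ('g star_word \<Rightarrow>\<^sub>0 complex) set" by simp

setup_lifting type_definition_free_star

lift_definition free_gen :: "'g \<Rightarrow> 'g free_star"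
  is "\<lambda>g. Poly_Mapping.single (Word [Gen g]) 1" .

lift_definition poly_star :: "('g star_word \<Rightarrow>\<^sub>0 complex) \<Rightarrow> ('g star_word \<Rightarrow>\<^sub>0 complex)"
  is "\<lambda>f w. cnj (f (word_star w))"
proof -
  fix f :: "'g star_word \<Rightarrow> complex" assume "finite {w. f w \<noteq> 0}"
  then have "finite (word_star ` {w. f w \<noteq> 0})" by simp
  moreover have "{w. cnj (f (word_star w)) \<noteq> 0} \<subseteq> word_star ` {w. f w \<noteq> 0}"
    by (auto intro!: image_eqI[of _ _ "word_star _"])
  ultimately show "finite {w. cnj (f (word_star w)) \<noteq> 0}" by (rule finite_subset[rotated])
qed

lemma poly_star_add: "poly_star (f + g) = poly_star f + poly_star g"
  by transfer simp

lemma poly_star_star: "poly_star (poly_star f) = f"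
  by transfer simp

lemma poly_star_scaleC: "poly_star (c *\<^sub>C f) = cnj c *\<^sub>C poly_star f"
  by transfer (simp add: scaleC_complex_def)

lemma poly_star_single: "poly_star (Poly_Mapping.single w c) = Poly_Mapping.single (word_star w) (cnj c)"
  by transfer (auto simp: fun_eq_iff when_def)

lemma poly_star_mult: "poly_star (f * g) = poly_star g * poly_star f"
proof (rule poly_mapping_additive_ext[where f = f])
  fix k :: "'a star_word" and c
  show "poly_star (Poly_Mapping.single k c * g) = poly_star g * poly_star (Poly_Mapping.single k c)"
    by (rule poly_mapping_additive_ext[where f = g])
      (simp_all add: algebra_simps poly_star_add poly_star_single mult_single word_star_plus)
qed (simp_all add: algebra_simps poly_star_add)

lemma poly_mult_scaleC_left:
  fixes f g :: "'k::monoid_add \<Rightarrow>\<^sub>0 complex"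
  shows "(c *\<^sub>C f) * g = c *\<^sub>C (f * g)"
proof (rule poly_mapping_additive_ext[where f = f])
  fix k :: 'k and d
  show "(c *\<^sub>C Poly_Mapping.single k d) * g = c *\<^sub>C (Poly_Mapping.single k d * g)"
    by (rule poly_mapping_additive_ext[where f = g])
      (simp_all add: algebra_simps scaleC_add_right scaleC_single mult_single scaleC_complex_def)
qed (simp_all add: algebra_simps scaleC_add_right)

lemma poly_mult_scaleC_right:
  fixes f g :: "'k::monoid_add \<Rightarrow>\<^sub>0 complex"
  shows "f * (c *\<^sub>C g) = c *\<^sub>C (f * g)"
proof (rule poly_mapping_additive_ext[where f = f])
  fix k :: 'k and d
  show "Poly_Mapping.single k d * (c *\<^sub>C g) = c *\<^sub>C (Poly_Mapping.single k d * g)"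
    by (rule poly_mapping_additive_ext[where f = g])
      (simp_all add: algebra_simps scaleC_add_right scaleC_single mult_single scaleC_complex_def)
qed (simp_all add: algebra_simps scaleC_add_right)

instantiation free_star :: (type) complex_star_algebra
begin
lift_definition zero_free_star :: "'a free_star" is 0 .
lift_definition one_free_star :: "'a free_star" is 1 .
lift_definition plus_free_star :: "'a free_star \<Rightarrow> 'a free_star \<Rightarrow> 'a free_star" is "(+)" .
lift_definition minus_free_star :: "'a free_star \<Rightarrow> 'a free_star \<Rightarrow> 'a free_star" is "(-)" .
lift_definition uminus_free_star :: "'a free_star \<Rightarrow> 'a free_star" is uminus .
lift_definition times_free_star :: "'a free_star \<Rightarrow> 'a free_star \<Rightarrow> 'a free_star" is "(*)" .
lift_definition scaleC_free_star :: "complex \<Rightarrow> 'a free_star \<Rightarrow> 'a free_star" is scaleC .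
lift_definition star_free_star :: "'a free_star \<Rightarrow> 'a free_star" is poly_star .
instance
  by standard
    (transfer; simp add: algebra_simps scaleC_add_right scaleC_add_left poly_mult_scaleC_left
      poly_mult_scaleC_right poly_star_add poly_star_scaleC poly_star_mult poly_star_star)+
end

text \<open>A presentation is attached to the type of its generators; \<open>'g univ_star\<close> is then the
  universal unital *-algebra generated by \<open>'g\<close> subject to \<open>r = 0\<close> for every relator \<open>r\<close>.\<close>

class presentation =
  fixes relators :: "'a free_star set"

quotient_type (overloaded) 'g univ_star =
  "'g::presentation free_star" / "\<lambda>x y. x - y \<in> star_ideal relators"
proof (rule equivpI)
  show "reflp (\<lambda>x y. x - y \<in> star_ideal (relators :: 'g free_star set))"
    by (rule reflpI) (simp add: star_ideal.zero)
  show "symp (\<lambda>x y. x - y \<in> star_ideal (relators :: 'g free_star set))"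
    by (rule sympI) (metis star_ideal_uminus minus_diff_eq)
  show "transp (\<lambda>x y. x - y \<in> star_ideal (relators :: 'g free_star set))"
    by (rule transpI) (drule (1) star_ideal.add, simp)
qed

lift_definition univ_gen :: "'g::presentation \<Rightarrow> 'g univ_star" is free_gen .

instantiation univ_star :: (presentation) complex_star_algebra
begin
lift_definition zero_univ_star :: "'a univ_star" is 0 .
lift_definition one_univ_star :: "'a univ_star" is 1 .
lift_definition plus_univ_star :: "'a univ_star \<Rightarrow> 'a univ_star \<Rightarrow> 'a univ_star" is "(+)"
  by (metis star_ideal.add add_diff_add)
lift_definition minus_univ_star :: "'a univ_star \<Rightarrow> 'a univ_star \<Rightarrow> 'a univ_star" is "(-)"
  by (drule (1) star_ideal_diff) (simp add: algebra_simps)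
lift_definition uminus_univ_star :: "'a univ_star \<Rightarrow> 'a univ_star" is uminus
  by (drule star_ideal_uminus) (simp add: algebra_simps)
lift_definition times_univ_star :: "'a univ_star \<Rightarrow> 'a univ_star \<Rightarrow> 'a univ_star" is "(*)"
proof -
  fix x x' y y' :: "'a free_star"
  assume "x - x' \<in> star_ideal relators" "y - y' \<in> star_ideal relators"
  then have "(x - x') * y + x' * (y - y') \<in> star_ideal relators"
    by (intro star_ideal.add star_ideal.left star_ideal.right)
  then show "x * y - x' * y' \<in> star_ideal relators" by (simp add: algebra_simps)
qed
lift_definition scaleC_univ_star :: "complex \<Rightarrow> 'a univ_star \<Rightarrow> 'a univ_star" is scaleC
  by (metis star_ideal_scaleC complex_vector.scale_right_diff_distrib)
lift_definition star_univ_star :: "'a univ_star \<Rightarrow> 'a univ_star" is star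
  by (metis star_ideal.star star_diff)
instance
  by standard
    (transfer; simp add: algebra_simps scaleC_add_right scaleC_add_left star_add star_scaleC
      star_mult star_ideal.zero)+
end

section \<open>Tensor products\<close>

definition tensor_relators :: "('a::complex_vector \<times> 'b::complex_vector \<Rightarrow>\<^sub>0 complex) set" where
  "tensor_relators =
     {Poly_Mapping.single (a + a', b) 1 - Poly_Mapping.single (a, b) 1 - Poly_Mapping.single (a', b) 1 |a a' b. True} \<union>
     {Poly_Mapping.single (a, b + b') 1 - Poly_Mapping.single (a, b) 1 - Poly_Mapping.single (a, b') 1 |a b b'. True} \<union>
     {Poly_Mapping.single (c *\<^sub>C a, b) 1 - c *\<^sub>C Poly_Mapping.single (a, b) 1 |a b c. True} \<union>
     {Poly_Mapping.single (a, c *\<^sub>C b) 1 - c *\<^sub>C Poly_Mapping.single (a, b) 1 |a b c. True}"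

quotient_type (overloaded) ('a, 'b) tensor =
  "'a::complex_vector \<times> 'b::complex_vector \<Rightarrow>\<^sub>0 complex" / "\<lambda>f g. f - g \<in> cspan tensor_relators"
proof (rule equivpI)
  show "reflp (\<lambda>f g. f - g \<in> cspan (tensor_relators :: ('a \<times> 'b \<Rightarrow>\<^sub>0 complex) set))"
    by (rule reflpI) (simp add: complex_vector.span_zero)
  show "symp (\<lambda>f g. f - g \<in> cspan (tensor_relators :: ('a \<times> 'b \<Rightarrow>\<^sub>0 complex) set))"
    by (rule sympI) (metis complex_vector.span_neg minus_diff_eq)
  show "transp (\<lambda>f g. f - g \<in> cspan (tensor_relators :: ('a \<times> 'b \<Rightarrow>\<^sub>0 complex) set))"
    by (rule transpI) (drule (1) complex_vector.span_add, simp)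
qed

lift_definition tensor :: "'a::complex_vector \<Rightarrow> 'b::complex_vector \<Rightarrow> ('a, 'b) tensor"
  (infixr \<open>\<otimes>\<^sub>C\<close> 72)
  is "\<lambda>a b. Poly_Mapping.single (a, b) 1" .

instantiation tensor :: (complex_vector, complex_vector) complex_vector
begin
lift_definition zero_tensor :: "('a, 'b) tensor" is 0 .
lift_definition plus_tensor :: "('a, 'b) tensor \<Rightarrow> ('a, 'b) tensor \<Rightarrow> ('a, 'b) tensor" is "(+)"
  by (metis complex_vector.span_add add_diff_add)
lift_definition minus_tensor :: "('a, 'b) tensor \<Rightarrow> ('a, 'b) tensor \<Rightarrow> ('a, 'b) tensor" is "(-)"
  by (drule (1) complex_vector.span_diff) (simp add: algebra_simps)
lift_definition uminus_tensor :: "('a, 'b) tensor \<Rightarrow> ('a, 'b) tensor" is uminus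
  by (drule complex_vector.span_neg) (simp add: algebra_simps)
lift_definition scaleC_tensor :: "complex \<Rightarrow> ('a, 'b) tensor \<Rightarrow> ('a, 'b) tensor" is scaleC
  by (metis complex_vector.span_scale complex_vector.scale_right_diff_distrib)
instance
  by standard
    (transfer; simp add: algebra_simps scaleC_add_right scaleC_add_left complex_vector.span_zero)+
end

lemma tensor_add_left: "(a + a') \<otimes>\<^sub>C b = a \<otimes>\<^sub>C b + a' \<otimes>\<^sub>C b"
  by transfer (rule complex_vector.span_base, simp only: tensor_relators_def diff_diff_eq[symmetric], blast)

lemma tensor_add_right: "a \<otimes>\<^sub>C (b + b') = a \<otimes>\<^sub>C b + a \<otimes>\<^sub>C b'"
  by transfer (rule complex_vector.span_base, simp only: tensor_relators_def diff_diff_eq[symmetric], blast)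

lemma tensor_scaleC_left: "(c *\<^sub>C a) \<otimes>\<^sub>C b = c *\<^sub>C (a \<otimes>\<^sub>C b)"
  by transfer (rule complex_vector.span_base, simp only: tensor_relators_def diff_diff_eq[symmetric], blast)

lemma tensor_scaleC_right: "a \<otimes>\<^sub>C (c *\<^sub>C b) = c *\<^sub>C (a \<otimes>\<^sub>C b)"
  by transfer (rule complex_vector.span_base, simp only: tensor_relators_def diff_diff_eq[symmetric], blast)

text \<open>The additive map \<open>a \<otimes> b \<mapsto> \<beta> a b\<close> induced by a balanced biadditive map \<open>\<beta>\<close>.  Besides the
  linear maps induced by bilinear \<open>\<beta>\<close> this also covers the conjugate-linear involution.\<close>

definition balanced :: "('a::complex_vector \<Rightarrow> 'b::complex_vector \<Rightarrow> 'c::ab_group_add) \<Rightarrow> bool" where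
  "balanced \<beta> \<longleftrightarrow> (\<forall>a a' b. \<beta> (a + a') b = \<beta> a b + \<beta> a' b) \<and>
     (\<forall>a b b'. \<beta> a (b + b') = \<beta> a b + \<beta> a b') \<and> (\<forall>c a b. \<beta> (c *\<^sub>C a) b = \<beta> a (c *\<^sub>C b))"

definition formal_lift :: "('a::complex_vector \<Rightarrow> 'b \<Rightarrow> 'c::ab_group_add) \<Rightarrow> ('a \<times> 'b \<Rightarrow>\<^sub>0 complex) \<Rightarrow> 'c" where
  "formal_lift \<beta> f = (\<Sum>p\<in>Poly_Mapping.keys f. \<beta> (Poly_Mapping.lookup f p *\<^sub>C fst p) (snd p))"

definition tensor_lift ::
  "('a::complex_vector \<Rightarrow> 'b::complex_vector \<Rightarrow> 'c::ab_group_add) \<Rightarrow> ('a, 'b) tensor \<Rightarrow> 'c" where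
  "tensor_lift \<beta> t = formal_lift \<beta> (rep_tensor t)"

lemma balancedD:
  assumes "balanced \<beta>"
  shows "\<beta> (a + a') b = \<beta> a b + \<beta> a' b" "\<beta> a (b + b') = \<beta> a b + \<beta> a b'"
    "\<beta> a (c *\<^sub>C b) = \<beta> (c *\<^sub>C a) b" "\<beta> 0 b = 0" "\<beta> a 0 = 0"
    "\<beta> (a - a') b = \<beta> a b - \<beta> a' b"
proof -
  show add: "\<beta> (a + a') b = \<beta> a b + \<beta> a' b" "\<beta> a (b + b') = \<beta> a b + \<beta> a b'"
    and "\<beta> a (c *\<^sub>C b) = \<beta> (c *\<^sub>C a) b" for a a' b b' c
    using assms by (auto simp: balanced_def)
  show "\<beta> 0 b = 0" "\<beta> a 0 = 0" using add(1)[of 0 0] add(2)[of _ 0 0] by auto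
  show "\<beta> (a - a') b = \<beta> a b - \<beta> a' b"
    using add(1)[of "a - a'" a' b] by (simp add: algebra_simps)
qed

lemma formal_lift_add:
  assumes "balanced \<beta>"
  shows "formal_lift \<beta> (f + g) = formal_lift \<beta> f + formal_lift \<beta> g"
  unfolding formal_lift_def
  by (rule setsum_keys_plus_distrib) (simp_all add: balancedD[OF assms] scaleC_add_left)

lemma formal_lift_zero [simp]: "formal_lift \<beta> 0 = 0"
  by (simp add: formal_lift_def)

lemma formal_lift_diff:
  assumes "balanced \<beta>"
  shows "formal_lift \<beta> (f - g) = formal_lift \<beta> f - formal_lift \<beta> g"
  using formal_lift_add[OF assms, of "f - g" g] by simp

lemma formal_lift_single:
  assumes "balanced \<beta>"
  shows "formal_lift \<beta> (Poly_Mapping.single (a, b) c) = \<beta> (c *\<^sub>C a) b"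
  by (cases "c = 0") (simp_all add: formal_lift_def balancedD[OF assms])

lemma balanced_scaleC:
  assumes "balanced \<beta>"
  shows "balanced (\<lambda>a b. \<beta> (c *\<^sub>C a) b)"
  unfolding balanced_def
proof (intro conjI allI)
  fix a a' b b' d
  show "\<beta> (c *\<^sub>C (a + a')) b = \<beta> (c *\<^sub>C a) b + \<beta> (c *\<^sub>C a') b"
    and "\<beta> (c *\<^sub>C a) (b + b') = \<beta> (c *\<^sub>C a) b + \<beta> (c *\<^sub>C a) b'"
    by (simp_all only: scaleC_add_right balancedD(1,2)[OF assms])
  show "\<beta> (c *\<^sub>C (d *\<^sub>C a)) b = \<beta> (c *\<^sub>C a) (d *\<^sub>C b)"
    by (simp add: balancedD(3)[OF assms] mult.commute)
qed

lemma formal_lift_scaleC: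
  assumes "balanced \<beta>"
  shows "formal_lift \<beta> (c *\<^sub>C f) = formal_lift (\<lambda>a b. \<beta> (c *\<^sub>C a) b) f"
proof (rule poly_mapping_additive_ext[where f = f])
  have b: "balanced (\<lambda>a b. \<beta> (c *\<^sub>C a) b)"
    by (rule balanced_scaleC[OF assms])
  show "formal_lift (\<lambda>a b. \<beta> (c *\<^sub>C a) b) (x + y)
      = formal_lift (\<lambda>a b. \<beta> (c *\<^sub>C a) b) x + formal_lift (\<lambda>a b. \<beta> (c *\<^sub>C a) b) y" for x y
    by (rule formal_lift_add[OF b])
  show "formal_lift \<beta> (c *\<^sub>C Poly_Mapping.single k d)
      = formal_lift (\<lambda>a b. \<beta> (c *\<^sub>C a) b) (Poly_Mapping.single k d)" for k d
    by (cases k) (simp add: scaleC_single scaleC_complex_def formal_lift_single[OF assms] formal_lift_single[OF b])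
qed (simp_all add: scaleC_add_right formal_lift_add[OF assms])

lemma formal_lift_relator:
  assumes "balanced \<beta>" "r \<in> tensor_relators"
  shows "formal_lift \<beta> r = 0"
  using assms(2) unfolding tensor_relators_def
  by (auto simp: formal_lift_diff[OF assms(1)] formal_lift_single[OF assms(1)] balancedD[OF assms(1)]
      scaleC_single scaleC_complex_def)

lemma formal_lift_span:
  assumes "balanced \<beta>" "f \<in> cspan tensor_relators"
  shows "formal_lift \<beta> f = 0"
proof -
  have "\<forall>\<beta>::'a \<Rightarrow> 'b \<Rightarrow> 'c. balanced \<beta> \<longrightarrow> formal_lift \<beta> f = 0"
    using assms(2)
  proof (induction rule: complex_vector.span_induct_alt)
    case base
    show ?case by simp
  next
    case (step c x y)
    then show ?case
      by (auto simp: formal_lift_add formal_lift_scaleC formal_lift_relator balanced_scaleC)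
  qed
  with assms(1) show ?thesis by blast
qed

lemma tensor_lift_abs:
  assumes "balanced \<beta>"
  shows "tensor_lift \<beta> (abs_tensor f) = formal_lift \<beta> f"
proof -
  have "rep_tensor (abs_tensor f) - f \<in> cspan tensor_relators"
    using Quotient3_rep_abs[OF Quotient3_tensor, where r = f] by (simp add: complex_vector.span_zero)
  from formal_lift_span[OF assms this] show ?thesis
    by (simp add: tensor_lift_def formal_lift_diff[OF assms])
qed

lemma tensor_lift_tensor:
  assumes "balanced \<beta>"
  shows "tensor_lift \<beta> (a \<otimes>\<^sub>C b) = \<beta> a b"
  by (simp add: tensor.abs_eq tensor_lift_abs[OF assms] formal_lift_single[OF assms])

lemma tensor_lift_add:
  assumes "balanced \<beta>"
  shows "tensor_lift \<beta> (s + t) = tensor_lift \<beta> s + tensor_lift \<beta> t"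
  by (induction s rule: tensor.abs_induct, induction t rule: tensor.abs_induct)
    (simp add: plus_tensor.abs_eq tensor_lift_abs[OF assms] formal_lift_add[OF assms])

lemma tensor_additive_ext:
  fixes F G :: "('a::complex_vector, 'b::complex_vector) tensor \<Rightarrow> 'c::ab_group_add"
  assumes "\<And>x y. F (x + y) = F x + F y" "\<And>x y. G (x + y) = G x + G y"
    and "\<And>a b. F (a \<otimes>\<^sub>C b) = G (a \<otimes>\<^sub>C b)"
  shows "F t = G t"
proof (induction t rule: tensor.abs_induct)
  case (1 f)
  have "abs_tensor (Poly_Mapping.single (a, b) c) = c *\<^sub>C (a \<otimes>\<^sub>C b)" for a :: 'a and b :: 'b and c
    by (simp add: tensor.abs_eq scaleC_tensor.abs_eq scaleC_single scaleC_complex_def)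
  then have single: "abs_tensor (Poly_Mapping.single k c) = (c *\<^sub>C fst k) \<otimes>\<^sub>C snd k" for k :: "'a \<times> 'b" and c
    by (cases k) (simp add: tensor_scaleC_left)
  show ?case
    by (rule poly_mapping_additive_ext[where F = "\<lambda>f. F (abs_tensor f)" and G = "\<lambda>f. G (abs_tensor f)"])
      (simp_all add: plus_tensor.abs_eq[symmetric] assms single)
qed

lemma tensor_lift_scaleC:
  assumes "balanced \<beta>"
  shows "tensor_lift \<beta> (c *\<^sub>C t) = tensor_lift (\<lambda>a b. \<beta> (c *\<^sub>C a) b) t"
  by (rule tensor_additive_ext[where t = t])
    (simp_all add: scaleC_add_right tensor_lift_add balanced_scaleC assms
      tensor_scaleC_left[symmetric] tensor_lift_tensor)

definition elementary_times ::
  "'a::complex_algebra_1 \<Rightarrow> 'b::complex_algebra_1 \<Rightarrow> ('a, 'b) tensor \<Rightarrow> ('a, 'b) tensor" where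
  "elementary_times a b = tensor_lift (\<lambda>a' b'. (a * a') \<otimes>\<^sub>C (b * b'))"

lemma balanced_elementary_times: "balanced (\<lambda>a' b'. (a * a') \<otimes>\<^sub>C (b * b'))"
  for a :: "'a::complex_algebra_1" and b :: "'b::complex_algebra_1"
  by (simp add: balanced_def distrib_left tensor_add_left tensor_add_right tensor_scaleC_left tensor_scaleC_right)

lemma elementary_times_add: "elementary_times a b (s + t) = elementary_times a b s + elementary_times a b t"
  unfolding elementary_times_def by (rule tensor_lift_add[OF balanced_elementary_times])

lemma elementary_times_tensor: "elementary_times a b (a' \<otimes>\<^sub>C b') = (a * a') \<otimes>\<^sub>C (b * b')"
  unfolding elementary_times_def by (rule tensor_lift_tensor[OF balanced_elementary_times])

lemma balanced_times: "balanced (\<lambda>a b. elementary_times a b t)"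
  unfolding balanced_def
proof (intro conjI allI)
  fix a a' :: 'a and b b' :: 'b and c
  note simps = elementary_times_add elementary_times_tensor
    distrib_right tensor_add_left tensor_add_right tensor_scaleC_left tensor_scaleC_right
  show "elementary_times (a + a') b t = elementary_times a b t + elementary_times a' b t"
    by (rule tensor_additive_ext[where t = t]) (simp_all add: simps)
  show "elementary_times a (b + b') t = elementary_times a b t + elementary_times a b' t"
    by (rule tensor_additive_ext[where t = t]) (simp_all add: simps)
  show "elementary_times (c *\<^sub>C a) b t = elementary_times a (c *\<^sub>C b) t"
    by (rule tensor_additive_ext[where t = t]) (simp_all add: simps)
qed

instantiation tensor :: (complex_algebra_1, complex_algebra_1) complex_algebra_1
begin

definition one_tensor :: "('a, 'b) tensor" where "1 = 1 \<otimes>\<^sub>C 1"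

definition times_tensor :: "('a, 'b) tensor \<Rightarrow> ('a, 'b) tensor \<Rightarrow> ('a, 'b) tensor" where
  "s * t = tensor_lift (\<lambda>a b. elementary_times a b t) s"

lemma tensor_times_elementary: "(a \<otimes>\<^sub>C b) * t = elementary_times a b t" for a :: 'a and b :: 'b
  unfolding times_tensor_def by (rule tensor_lift_tensor[OF balanced_times])

lemma tensor_times_tensor: "(a \<otimes>\<^sub>C b) * (a' \<otimes>\<^sub>C b') = (a * a') \<otimes>\<^sub>C (b * b')"
  for a a' :: 'a and b b' :: 'b
  by (simp only: tensor_times_elementary elementary_times_tensor)

lemma tensor_distrib_right: "(r + s) * t = r * t + s * t" for r s t :: "('a, 'b) tensor"
  unfolding times_tensor_def by (rule tensor_lift_add[OF balanced_times])

lemma tensor_distrib_left: "r * (s + t) = r * s + r * t" for r s t :: "('a, 'b) tensor"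
  by (rule tensor_additive_ext[where t = r])
    (simp_all add: tensor_distrib_right tensor_times_elementary elementary_times_add algebra_simps)

instance
proof
  fix r s t :: "('a, 'b) tensor" and c
  note simps = tensor_distrib_left tensor_distrib_right tensor_times_tensor scaleC_add_right mult.assoc
    tensor_scaleC_left[symmetric]
  show "(r + s) * t = r * t + s * t" "r * (s + t) = r * s + r * t"
    by (rule tensor_distrib_right tensor_distrib_left)+
  show "r * s * t = r * (s * t)"
  proof (rule tensor_additive_ext[where t = r])
    fix a b
    show "(a \<otimes>\<^sub>C b) * s * t = (a \<otimes>\<^sub>C b) * (s * t)"
    proof (rule tensor_additive_ext[where t = s])
      fix a' b'
      show "(a \<otimes>\<^sub>C b) * (a' \<otimes>\<^sub>C b') * t = (a \<otimes>\<^sub>C b) * ((a' \<otimes>\<^sub>C b') * t)"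
        by (rule tensor_additive_ext[where t = t]) (simp_all add: simps)
    qed (simp_all add: simps)
  qed (simp_all add: simps)
  show "1 * t = t"
    by (rule tensor_additive_ext[where t = t]) (simp_all add: simps one_tensor_def)
  show "t * 1 = t"
    by (rule tensor_additive_ext[where t = t]) (simp_all add: simps one_tensor_def)
  show "(c *\<^sub>C s) * t = c *\<^sub>C (s * t)"
  proof (rule tensor_additive_ext[where t = s])
    fix a b
    show "(c *\<^sub>C (a \<otimes>\<^sub>C b)) * t = c *\<^sub>C ((a \<otimes>\<^sub>C b) * t)"
      by (rule tensor_additive_ext[where t = t]) (simp_all add: simps)
  qed (simp_all add: simps)
  show "s * (c *\<^sub>C t) = c *\<^sub>C (s * t)"
  proof (rule tensor_additive_ext[where t = s])
    fix a b
    show "(a \<otimes>\<^sub>C b) * (c *\<^sub>C t) = c *\<^sub>C ((a \<otimes>\<^sub>C b) * t)"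
      by (rule tensor_additive_ext[where t = t]) (simp_all add: simps)
  qed (simp_all add: simps)
qed

end

instantiation tensor :: (complex_star_algebra, complex_star_algebra) complex_star_algebra
begin

definition star_tensor :: "('a, 'b) tensor \<Rightarrow> ('a, 'b) tensor" where
  "star = tensor_lift (\<lambda>a b. star a \<otimes>\<^sub>C star b)"

lemma balanced_star:
  "balanced (\<lambda>a b. star (a :: 'a::complex_star_algebra) \<otimes>\<^sub>C star (b :: 'b::complex_star_algebra))"
  by (simp add: balanced_def star_add star_scaleC tensor_add_left tensor_add_right tensor_scaleC_left tensor_scaleC_right)

lemma star_tensor_tensor: "star (a \<otimes>\<^sub>C b) = star a \<otimes>\<^sub>C star b" for a :: 'a and b :: 'b
  by (simp add: star_tensor_def tensor_lift_tensor[OF balanced_star])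

instance
proof
  fix s t :: "('a, 'b) tensor" and c
  show add: "star (s + t) = star s + star t" for s t :: "('a, 'b) tensor"
    by (simp add: star_tensor_def tensor_lift_add[OF balanced_star])
  note simps = add star_tensor_tensor tensor_times_tensor scaleC_add_right algebra_simps
    tensor_scaleC_left[symmetric] star_scaleC star_mult
  show "star (c *\<^sub>C t) = cnj c *\<^sub>C star t"
    by (rule tensor_additive_ext[where t = t]) (simp_all add: simps)
  show "star (s * t) = star t * star s"
  proof (rule tensor_additive_ext[where t = s])
    fix a b
    show "star ((a \<otimes>\<^sub>C b) * t) = star t * star (a \<otimes>\<^sub>C b)"
      by (rule tensor_additive_ext[where t = t]) (simp_all add: simps)
  qed (simp_all add: simps)
  show "star (star t) = t"
    by (rule tensor_additive_ext[where t = t]) (simp_all add: simps)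
qed

end

definition tensor_map :: "('a::complex_vector \<Rightarrow> 'c::complex_vector) \<Rightarrow> ('b::complex_vector \<Rightarrow> 'd::complex_vector)
    \<Rightarrow> ('a, 'b) tensor \<Rightarrow> ('c, 'd) tensor" where
  "tensor_map f g = tensor_lift (\<lambda>a b. f a \<otimes>\<^sub>C g b)"

definition tensor_assoc ::
  "(('a::complex_vector, 'b::complex_vector) tensor, 'c::complex_vector) tensor \<Rightarrow> ('a, ('b, 'c) tensor) tensor" where
  "tensor_assoc = tensor_lift (\<lambda>t c. tensor_lift (\<lambda>a b. a \<otimes>\<^sub>C (b \<otimes>\<^sub>C c)) t)"

section \<open>Compact quantum groups\<close>

text \<open>\<open>tensor_lift (\<lambda>a b. \<epsilon> a *\<^sub>C b)\<close> is \<open>\<epsilon> \<otimes> id\<close> followed by the identification \<open>\<complex> \<otimes> A = A\<close>, and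
  \<open>tensor_lift (\<lambda>a b. S a * b)\<close> is \<open>S \<otimes> id\<close> followed by the multiplication map.\<close>

definition hopf_star_algebra :: "('a::complex_star_algebra \<Rightarrow> ('a, 'a) tensor) \<Rightarrow> bool" where
  "hopf_star_algebra \<Delta> \<longleftrightarrow>
     star_hom \<Delta> \<and>
     (\<forall>x. tensor_assoc (tensor_map \<Delta> id (\<Delta> x)) = tensor_map id \<Delta> (\<Delta> x)) \<and>
     (\<exists>\<epsilon> S. algebra_hom (\<epsilon> :: 'a \<Rightarrow> complex) \<and> clinear (S :: 'a \<Rightarrow> 'a) \<and>
       (\<forall>x. tensor_lift (\<lambda>a b. \<epsilon> a *\<^sub>C b) (\<Delta> x) = x \<and> tensor_lift (\<lambda>a b. \<epsilon> b *\<^sub>C a) (\<Delta> x) = x) \<and>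
       (\<forall>x. tensor_lift (\<lambda>a b. S a * b) (\<Delta> x) = \<epsilon> x *\<^sub>C 1 \<and>
            tensor_lift (\<lambda>a b. a * S b) (\<Delta> x) = \<epsilon> x *\<^sub>C 1))"

definition haar_state :: "('a::complex_star_algebra \<Rightarrow> ('a, 'a) tensor) \<Rightarrow> ('a \<Rightarrow> complex) \<Rightarrow> bool" where
  "haar_state \<Delta> h \<longleftrightarrow>
     clinear h \<and> h 1 = 1 \<and> (\<forall>x. h (star x * x) \<in> \<real>\<^sub>\<ge>\<^sub>0) \<and>
     (\<forall>x. tensor_lift (\<lambda>a b. h a *\<^sub>C b) (\<Delta> x) = h x *\<^sub>C 1 \<and>
          tensor_lift (\<lambda>a b. h b *\<^sub>C a) (\<Delta> x) = h x *\<^sub>C 1)"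

definition compact_quantum_group :: "('a::complex_star_algebra \<Rightarrow> ('a, 'a) tensor) \<Rightarrow> bool" where
  "compact_quantum_group \<Delta> \<longleftrightarrow> hopf_star_algebra \<Delta> \<and> (\<exists>h. haar_state \<Delta> h)"

definition haar :: "('a::complex_star_algebra \<Rightarrow> ('a, 'a) tensor) \<Rightarrow> 'a \<Rightarrow> complex" where
  "haar \<Delta> = (THE h. haar_state \<Delta> h)"

text \<open>The library's matrix type needs \<open>0 \<noteq> 1\<close> in the entry ring, so matrices are plain functions.\<close>

type_synonym ('a, 'n) sqmatrix = "'n \<Rightarrow> 'n \<Rightarrow> 'a"

definition mat_one :: "('a::complex_star_algebra, 'n) sqmatrix" where
  "mat_one i j = (if i = j then 1 else 0)"

definition mat_mult :: "('a::complex_star_algebra, 'n::finite) sqmatrix \<Rightarrow> ('a, 'n) sqmatrix \<Rightarrow> ('a, 'n) sqmatrix" where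
  "mat_mult v w i j = (\<Sum>k\<in>UNIV. v i k * w k j)"

definition mat_adjoint :: "('a::complex_star_algebra, 'n) sqmatrix \<Rightarrow> ('a, 'n) sqmatrix" where
  "mat_adjoint v i j = star (v j i)"

definition mat_conj :: "('a::complex_star_algebra, 'n) sqmatrix \<Rightarrow> ('a, 'n) sqmatrix" where
  "mat_conj v i j = star (v i j)"

definition mat_unitary :: "('a::complex_star_algebra, 'n::finite) sqmatrix \<Rightarrow> bool" where
  "mat_unitary v \<longleftrightarrow> mat_mult v (mat_adjoint v) = mat_one \<and> mat_mult (mat_adjoint v) v = mat_one"

definition mat_invertible :: "('a::complex_star_algebra, 'n::finite) sqmatrix \<Rightarrow> bool" where
  "mat_invertible v \<longleftrightarrow> (\<exists>w. mat_mult v w = mat_one \<and> mat_mult w v = mat_one)"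

definition matrix_comult :: "('a::complex_star_algebra \<Rightarrow> ('a, 'a) tensor) \<Rightarrow> ('a, 'n::finite) sqmatrix \<Rightarrow> bool" where
  "matrix_comult \<Delta> u \<longleftrightarrow> (\<forall>i j. \<Delta> (u i j) = (\<Sum>k\<in>UNIV. u i k \<otimes>\<^sub>C u k j))"

section \<open>Finitely generated discrete quantum groups\<close>

text \<open>A discrete quantum group \<open>\<Gamma>\<close> is given by the comultiplication and the fundamental
  representation of its dual; the algebra of the dual is the type \<open>'a\<close>, and the fundamental
  representation has size \<open>CARD('n)\<close>.\<close>

record (overloaded) ('a::complex_star_algebra, 'n) dqg =
  comult :: "'a \<Rightarrow> ('a, 'a) tensor"
  fund :: "'n \<Rightarrow> 'n \<Rightarrow> 'a"

definition discrete_quantum_group :: "('a::complex_star_algebra, 'n::finite) dqg \<Rightarrow> bool" where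
  "discrete_quantum_group \<Gamma> \<longleftrightarrow>
     compact_quantum_group (comult \<Gamma>) \<and>
     mat_unitary (fund \<Gamma>) \<and>
     matrix_comult (comult \<Gamma>) (fund \<Gamma>) \<and>
     star_subalgebra {fund \<Gamma> i j |i j. True} = UNIV \<and>
     mat_invertible (mat_conj (fund \<Gamma>))"

definition surjects :: "('a::complex_star_algebra, 'n) dqg \<Rightarrow> ('b::complex_star_algebra, 'n) dqg \<Rightarrow> bool"
  (infix \<open>\<twoheadrightarrow>\<close> 50) where
  "\<Gamma>\<^sub>2 \<twoheadrightarrow> \<Gamma>\<^sub>1 \<longleftrightarrow> (\<exists>\<phi>. star_hom \<phi> \<and> (\<forall>i j. \<phi> (fund \<Gamma>\<^sub>2 i j) = fund \<Gamma>\<^sub>1 i j))"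

definition dqg_isomorphic :: "('a::complex_star_algebra, 'n) dqg \<Rightarrow> ('b::complex_star_algebra, 'n) dqg \<Rightarrow> bool" where
  "dqg_isomorphic \<Gamma>\<^sub>2 \<Gamma>\<^sub>1 \<longleftrightarrow> (\<exists>\<phi>. star_hom \<phi> \<and> bij \<phi> \<and> (\<forall>i j. \<phi> (fund \<Gamma>\<^sub>2 i j) = fund \<Gamma>\<^sub>1 i j))"

definition main_char :: "('a::complex_star_algebra, 'n::finite) dqg \<Rightarrow> 'a" where
  "main_char \<Gamma> = (\<Sum>i\<in>UNIV. fund \<Gamma> i i)"

definition char_moment :: "nat \<Rightarrow> ('a::complex_star_algebra, 'n::finite) dqg \<Rightarrow> complex" where
  "char_moment k \<Gamma> = haar (comult \<Gamma>) ((main_char \<Gamma> + star (main_char \<Gamma>)) ^ k)"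

text \<open>The even moments are nonnegative reals, so nothing is lost in taking real parts.\<close>

definition char_norm :: "('a::complex_star_algebra, 'n::finite) dqg \<Rightarrow> real" where
  "char_norm \<Gamma> = lim (\<lambda>k. root (2 * k) (Re (char_moment (2 * k) \<Gamma>)))"

section \<open>The free quantum groups\<close>

definition unitary_relators :: "('a::complex_star_algebra, 'n::finite) sqmatrix \<Rightarrow> 'a set" where
  "unitary_relators v =
     {mat_mult v (mat_adjoint v) i j - mat_one i j |i j. True} \<union>
     {mat_mult (mat_adjoint v) v i j - mat_one i j |i j. True}"

datatype 'n gen_U = Gen_U 'n 'n
datatype 'n gen_O = Gen_O 'n 'n
datatype 'n gen_S = Gen_S 'n 'n

instantiation gen_U :: (finite) presentation
begin
definition relators_gen_U :: "'a gen_U free_star set" where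
  "relators_gen_U = (let u = (\<lambda>i j. free_gen (Gen_U i j)) in
     unitary_relators u \<union> unitary_relators (mat_conj u))"
instance ..
end

instantiation gen_O :: (finite) presentation
begin
definition relators_gen_O :: "'a gen_O free_star set" where
  "relators_gen_O = (let u = (\<lambda>i j. free_gen (Gen_O i j)) in
     unitary_relators u \<union> {u i j - star (u i j) |i j. True})"
instance ..
end

instantiation gen_S :: (finite) presentation
begin
definition relators_gen_S :: "'a gen_S free_star set" where
  "relators_gen_S = (let u = (\<lambda>i j. free_gen (Gen_S i j)) in
     {u i j - star (u i j) |i j. True} \<union> {u i j - (u i j)\<^sup>2 |i j. True} \<union>
     {(\<Sum>k\<in>UNIV. u i k) - 1 |i. True} \<union> {(\<Sum>k\<in>UNIV. u k j) - 1 |j. True})"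
instance ..
end

text \<open>The comultiplication of a universal algebra is determined by its values on the generators.\<close>

definition universal_dqg :: "('n \<Rightarrow> 'n \<Rightarrow> 'g) \<Rightarrow> ('g::presentation univ_star, 'n::finite) dqg" where
  "universal_dqg g = (let u = (\<lambda>i j. univ_gen (g i j)) in
     \<lparr>comult = (THE \<Delta>. star_hom \<Delta> \<and> matrix_comult \<Delta> u), fund = u\<rparr>)"

definition FU :: "('n::finite gen_U univ_star, 'n) dqg" where "FU = universal_dqg Gen_U"
definition FO :: "('n::finite gen_O univ_star, 'n) dqg" where "FO = universal_dqg Gen_O"
definition FS :: "('n::finite gen_S univ_star, 'n) dqg" where "FS = universal_dqg Gen_S"

end

theory Submission
  imports Defs
begin

text \<open>For a word \<open>w\<close> in two colours let \<open>H w\<close> be the space of tensors killed by all caps between adjacent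
  letters of opposite colour; it carries the irreducible corepresentation of \<open>U\<^sub>n\<^sup>+\<close> labelled by \<open>w\<close>,
  whose character \<open>\<chi>\<^sub>w\<close> is a noncommutative polynomial in \<open>\<chi>\<close> and \<open>\<chi>\<^sup>*\<close>.  For a quotient \<open>\<Gamma>\<close> of \<open>FU\<^sub>n\<close>
  the number \<open>h(\<chi>\<^sub>w)\<close> is the dimension of the space of invariant vectors in \<open>H w\<close>, and \<open>\<Gamma>\<close> is \<open>FU\<^sub>n\<close> as soon
  as this vanishes for every \<open>w \<noteq> []\<close>.  The sum \<open>\<sigma>\<^sub>d\<close> of the \<open>\<chi>\<^sub>w\<close> with \<open>|w| = d\<close> is a rescaled Chebyshev
  polynomial in \<open>\<chi> + \<chi>\<^sup>*\<close>, because \<open>\<chi> + \<chi>\<^sup>*\<close> acts on the \<open>\<chi>\<^sub>w\<close> as the adjacency operator of the binary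
  tree; hence \<open>\<parallel>\<chi> + \<chi>\<^sup>*\<parallel> \<le> 2\<surd>2\<close>, the value for \<open>FU\<^sub>n\<close>, forces \<open>h(\<sigma>\<^sub>d) \<le> (d + 2) 2\<^bsup>d/2\<^esup>\<close>.  On the other
  hand, one word \<open>w \<noteq> []\<close> with an invariant vector produces, by Schur's lemma and conjugation, invariant
  vectors for all words \<open>g g\<^bsup>-\<^esup>\<close> with \<open>g\<close> ending in a fixed word.  Most of these form a prefix code, and
  products of three of them already give more than \<open>(d + 2) 2\<^bsup>d/2\<^esup>\<close> words of some length \<open>d\<close>.  Only the
  Haar state of \<open>U\<^sub>n\<^sup>+\<close> has to be constructed; it is given by the projections onto the spans of the
  noncrossing pairings.\<close>

section \<open>Multi-indices and coloured words\<close>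

text \<open>Exponential rates alone give no contradiction: the words \<open>g @ bar g\<close> of
  length \<open>2 * e\<close> number \<open>2 ^ e\<close> up to a constant, precisely the rate that
  the norm bound allows, so polynomial factors have to decide. The bound carries a linear factor
  because a Chebyshev polynomial of the second kind is a sum of linearly many polynomials of the
  first kind, whose rescaled size is bounded. A product of m words from a prefix code factors
  uniquely and leaves m - 1 lengths free, a gain of order e^(m-1); three is the first m that beats a
  linear factor. Coordinates over an arbitrary *-algebra let the same statements serve \<Gamma> and
  \<open>FU\<close>. The quotient map sends a combination of irreducible coefficients to the
  combination with the same scalars, and orthogonality under the Haar state of \<Gamma> recovers
  these scalars up to compression by \<open>jw\<close>; this is how its kernel is seen to be zero.
  Positivity of the Haar functional of \<open>FU\<close> cannot be read off from noncrossing
  pairings; it follows from the same orthogonality relations.\<close>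

definition idx :: "nat \<Rightarrow> 'b list set" where
  "idx k = {l. length l = k}"

lemma mem_idx [simp]: "l \<in> idx k \<longleftrightarrow> length l = k"
  by (simp add: idx_def)

lemma idx_0 [simp]: "idx 0 = {[]}"
  by (auto simp: idx_def)

lemma idx_Suc: "idx (Suc k) = (\<lambda>(a, l). a # l) ` (UNIV \<times> idx k)"
  by (auto simp: idx_def image_iff length_Suc_conv)

abbreviation ix :: "'c list \<Rightarrow> 'b list set" where
  "ix w \<equiv> idx (length w)"

lemma finite_idx [simp]: "finite (idx k :: 'b::finite list set)"
  by (induction k) (simp_all add: idx_Suc)

lemma sum_idx_Suc:
  "(\<Sum>l\<in>idx (Suc k). f l) = (\<Sum>a\<in>(UNIV :: 'b::finite set). \<Sum>l\<in>idx k. f (a # l))"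
proof -
  have "(\<Sum>l\<in>idx (Suc k). f l) = (\<Sum>p\<in>UNIV \<times> idx k. f (fst p # snd p))"
    unfolding idx_Suc by (subst sum.reindex) (auto simp: inj_on_def case_prod_beta)
  then show ?thesis by (simp add: sum.cartesian_product case_prod_beta)
qed

lemma sum_idx_add:
  "(\<Sum>l\<in>idx (m + k). f l) = (\<Sum>i\<in>idx m. \<Sum>j\<in>(idx k :: 'b::finite list set). f (i @ j))"
  by (induction m arbitrary: f) (simp_all add: sum_idx_Suc)

lemma sum_idx_rev: "(\<Sum>l\<in>idx k. f (rev l)) = sum f (idx k)"
  by (rule sum.reindex_bij_witness[where i = rev and j = rev]) auto

lemma card_idx: "card (idx k :: 'b::finite list set) = CARD('b) ^ k"
  using card_lists_length_eq[of "UNIV :: 'b set" k] by (simp add: idx_def)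

section \<open>Conjugate words and cap-free tensors\<close>

definition bar :: "bool list \<Rightarrow> bool list" where
  "bar w = rev (map Not w)"

lemma bar_simps [simp]:
  "bar [] = []" "bar (c # w) = bar w @ [\<not> c]" "bar (v @ w) = bar w @ bar v"
  "length (bar w) = length w" "bar (bar w) = w" "bar w = [] \<longleftrightarrow> w = []"
  by (simp_all add: bar_def rev_map comp_def)

lemma hd_bar: "w \<noteq> [] \<Longrightarrow> hd (bar w) = (\<not> last w)"
  by (simp add: bar_def hd_rev last_map)

lemma last_bar: "w \<noteq> [] \<Longrightarrow> last (bar w) = (\<not> hd w)"
  by (simp add: bar_def last_rev hd_map)

text \<open>Colours \<open>True\<close> and \<open>False\<close> stand for the fundamental representation and its conjugate.  A cap joins
  two adjacent letters of opposite colour.\<close>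

definition capfree :: "bool list \<Rightarrow> ('n::finite list \<Rightarrow> complex) \<Rightarrow> bool" where
  "capfree w \<xi> \<longleftrightarrow> (\<forall>w1 c w2 i j. w = w1 @ c # (\<not> c) # w2 \<longrightarrow> length i = length w1 \<longrightarrow>
     length j = length w2 \<longrightarrow> (\<Sum>a\<in>UNIV. \<xi> (i @ a # a # j)) = 0)"

lemma capfreeD:
  "capfree (w1 @ c # (\<not> c) # w2) \<xi> \<Longrightarrow> length i = length w1 \<Longrightarrow> length j = length w2 \<Longrightarrow>
    (\<Sum>a\<in>UNIV. \<xi> (i @ a # a # j)) = 0"
  by (auto simp: capfree_def)

lemma capfree_hdD:
  "capfree (c # (\<not> c) # w2) \<xi> \<Longrightarrow> length j = length w2 \<Longrightarrow> (\<Sum>a\<in>UNIV. \<xi> (a # a # j)) = 0"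
  using capfreeD[of "[]" c w2 \<xi> "[]" j] by simp

lemma capfree_Nil [simp]: "capfree [] \<xi>"
  by (simp add: capfree_def)

lemma capfree_tail:
  assumes "capfree (c # w) \<xi>"
  shows "capfree w (\<lambda>i. \<xi> (a # i))"
  unfolding capfree_def
proof (intro allI impI)
  fix w1 d w2 and i j :: "'a list"
  assume "w = w1 @ d # (\<not> d) # w2" "length i = length w1" "length j = length w2"
  then show "(\<Sum>e\<in>UNIV. \<xi> (a # i @ e # e # j)) = 0"
    using capfreeD[of "c # w1" d w2 \<xi> "a # i" j] assms by simp
qed

lemma capfree_Cons:
  assumes "w \<noteq> [] \<Longrightarrow> hd w \<noteq> c \<Longrightarrow> \<forall>j. length j = length w - 1 \<longrightarrow> (\<Sum>a\<in>UNIV. \<xi> (a # a # j)) = 0"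
    and "\<And>a. capfree w (\<lambda>i. \<xi> (a # i))"
  shows "capfree (c # w) \<xi>"
  unfolding capfree_def
proof (intro allI impI)
  fix w1 d w2 and i j :: "'a list"
  assume *: "c # w = w1 @ d # (\<not> d) # w2" "length i = length w1" "length j = length w2"
  show "(\<Sum>e\<in>UNIV. \<xi> (i @ e # e # j)) = 0"
  proof (cases w1)
    case Nil
    then show ?thesis using * assms(1) by auto
  next
    case (Cons d' w1')
    then obtain a i' where i: "i = a # i'" using * by (cases i) auto
    have "capfree (w1' @ d # (\<not> d) # w2) (\<lambda>i. \<xi> (a # i))" using assms(2)[of a] * Cons by simp
    from capfreeD[OF this, of i' j] show ?thesis using * i Cons by simp
  qed
qed

text \<open>Index functions are total on lists, but only the values on lists of the length of
  \<open>w\<close> carry meaning.\<close>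

lemma capfree_cong:
  assumes "capfree w \<xi>" "\<And>i. length i = length w \<Longrightarrow> \<xi> i = \<eta> i"
  shows "capfree w \<eta>"
  unfolding capfree_def
proof (intro allI impI)
  fix w1 d w2 and i j :: "'a list"
  assume *: "w = w1 @ d # (\<not> d) # w2" "length i = length w1" "length j = length w2"
  have "(\<Sum>a\<in>UNIV. \<eta> (i @ a # a # j)) = (\<Sum>a\<in>UNIV. \<xi> (i @ a # a # j))"
    using assms(2) * by (intro sum.cong) (auto simp: *)
  then show "(\<Sum>a\<in>UNIV. \<eta> (i @ a # a # j)) = 0"
    using capfreeD[of w1 d w2 \<xi> i j] assms(1) * by simp
qed

text \<open>An adjacent pair in \<open>x @ y\<close> lies in \<open>x\<close>, lies in
  \<open>y\<close>, or straddles the junction. The third premise concerns the straddling cap and is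
  vacuous when the two colours there agree. Invariant vectors on concatenated words are checked
  through this case split.\<close>

lemma capfree_append:
  assumes "\<And>j. length j = length y \<Longrightarrow> capfree x (\<lambda>i. \<xi> (i @ j))"
    and "\<And>i. length i = length x \<Longrightarrow> capfree y (\<lambda>j. \<xi> (i @ j))"
    and "\<And>i j. x \<noteq> [] \<Longrightarrow> y \<noteq> [] \<Longrightarrow> last x \<noteq> hd y \<Longrightarrow> Suc (length i) = length x \<Longrightarrow>
      Suc (length j) = length y \<Longrightarrow> (\<Sum>a\<in>UNIV. \<xi> (i @ a # a # j)) = 0"
  shows "capfree (x @ y) \<xi>"
  using assms
proof (induction x arbitrary: \<xi>)
  case Nil
  then show ?case by simp
next
  case (Cons c x)
  show ?case unfolding append_Cons
  proof (rule capfree_Cons)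
    fix a
    show "capfree (x @ y) (\<lambda>i. \<xi> (a # i))"
    proof (rule Cons.IH)
      show "capfree x (\<lambda>i. \<xi> (a # i @ j))" if "length j = length y" for j
        using capfree_tail[OF Cons.prems(1)[OF that]] by simp
      show "capfree y (\<lambda>j. \<xi> (a # i @ j))" if "length i = length x" for i
        using Cons.prems(2)[of "a # i"] that by simp
      show "(\<Sum>e\<in>UNIV. \<xi> (a # i @ e # e # j)) = 0"
        if "x \<noteq> []" "y \<noteq> []" "last x \<noteq> hd y" "Suc (length i) = length x" "Suc (length j) = length y" for i j
        using Cons.prems(3)[of "a # i" j] that by simp
    qed
  next
    assume ne: "x @ y \<noteq> []" and hd: "hd (x @ y) \<noteq> c"
    show "\<forall>j. length j = length (x @ y) - 1 \<longrightarrow> (\<Sum>a\<in>UNIV. \<xi> (a # a # j)) = 0"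
    proof (intro allI impI)
      fix j :: "'a list" assume j: "length j = length (x @ y) - 1"
      show "(\<Sum>a\<in>UNIV. \<xi> (a # a # j)) = 0"
      proof (cases x)
        case Nil
        then show ?thesis using Cons.prems(3)[of "[]" j] ne hd j by auto
      next
        case (Cons d x')
        then have d: "d = (\<not> c)" using hd by auto
        obtain j1 j2 where "j = j1 @ j2" "length j1 = length x'" "length j2 = length y"
          using j Cons by (intro that[of "take (length x') j" "drop (length x') j"]) auto
        then show ?thesis
          using capfree_hdD[of c x' "\<lambda>i. \<xi> (i @ j2)" j1] Cons.prems(1)[of j2] Cons d by simp
      qed
    qed
  qed
qed

section \<open>Jones--Wenzl projections for coloured words\<close>

text \<open>For nonempty \<open>w\<close> this is the quotient of the dimensions belonging to
  \<open>w\<close> and \<open>tl w\<close>, see \<open>jw_dim_Cons\<close>. Along an alternating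
  word it runs through quotients of consecutive Chebyshev values at n; two equal adjacent colours
  restart it at n.\<close>

fun kap :: "'n itself \<Rightarrow> bool list \<Rightarrow> real" where
  "kap n [] = 1"
| "kap n (c # w) = real CARD('n) - (if w \<noteq> [] \<and> hd w \<noteq> c then 1 / kap n w else 0)"

text \<open>Coefficient of the cup-cap term in Wenzl's recursion. The value 0 for equal colours
  encodes that no cap joins the new letter, so \<open>jw (c # w)\<close> is then the identity on one
  letter tensored with \<open>jw w\<close>; it also neutralises the truncated
  \<open>length w - 1\<close> at the empty word.\<close>

definition theta :: "'n itself \<Rightarrow> bool \<Rightarrow> bool list \<Rightarrow> real" where
  "theta n c w = (if w \<noteq> [] \<and> hd w \<noteq> c then 1 / kap n w else 0)"

text \<open>Wenzl's recursion.  \<open>jw w\<close> is the matrix of the orthogonal projection onto the vectors that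
  are annihilated by all caps.\<close>

primrec jw :: "bool list \<Rightarrow> 'n::finite list \<Rightarrow> 'n list \<Rightarrow> complex" where
  "jw [] i j = 1"
| "jw (c # w) i j = (if hd i = hd j then jw w (tl i) (tl j) else 0) -
     of_real (theta TYPE('n) c w) *
     (\<Sum>k\<in>idx (length w - 1). jw w (tl i) (hd i # k) * jw w (hd j # k) (tl j))"

lemma jw_Cons:
  "jw (c # w) (a # i) (b # j) = (if a = b then jw w i j else 0) -
     of_real (theta TYPE('n) c w) * (\<Sum>k\<in>idx (length w - 1). jw w i (a # k) * jw w (b # k) j)"
  for i :: "'n::finite list"
  by simp

lemma jw_sym: "jw w i j = jw w j i"
proof (induction w arbitrary: i j)
  case (Cons c w)
  have "(\<Sum>k\<in>idx (length w - 1). jw w (tl i) (hd i # k) * jw w (hd j # k) (tl j)) =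
        (\<Sum>k\<in>idx (length w - 1). jw w (tl j) (hd j # k) * jw w (hd i # k) (tl i))"
    by (intro sum.cong refl) (metis Cons.IH mult.commute)
  then show ?case using Cons.IH[of "tl i" "tl j"] by simp
qed simp

lemma cnj_jw [simp]: "cnj (jw w i j) = jw w i j"
  by (induction w arbitrary: i j) simp_all

declare jw.simps(2) [simp del] kap.simps [simp del]

lemma kap_Cons: "kap TYPE('n) (c # w) = real CARD('n) - theta TYPE('n) c w"
  by (simp add: theta_def kap.simps)

text \<open>The denominators in \<open>theta\<close> stay away from zero: if the tail has
  \<open>kap\<close> at least 1, then \<open>theta\<close> is at most 1, and at least n - 1 is
  left.\<close>

lemma kap_ge_1:
  assumes "CARD('n::finite) \<ge> 2"
  shows "kap TYPE('n) w \<ge> 1"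
proof (induction w)
  case (Cons c w)
  then have "theta TYPE('n) c w \<le> 1" by (simp add: theta_def)
  then show ?case using assms by (simp add: kap_Cons)
qed (simp add: kap.simps)

lemma theta_cases:
  obtains "theta n c w = 0" "w = [] \<or> hd w = c"
  | w' where "w = (\<not> c) # w'" "theta n c w = 1 / kap n w"
  by (cases w) (auto simp: theta_def)

text \<open>Closing the first strand turns the identity term into a loop of value n and the cup-cap
  term into \<open>jw w\<close> composed with itself. Idempotence is a premise because
  \<open>jw_idem\<close> uses this lemma for shorter words during its own induction.\<close>

lemma jw_partial_trace_aux:
  fixes i j :: "'n::finite list"
  assumes idem: "\<And>i j :: 'n list. length i = length w \<Longrightarrow> length j = length w \<Longrightarrow>
      (\<Sum>k\<in>ix w. jw w i k * jw w k j) = jw w i j"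
    and "length i = length w" "length j = length w"
  shows "(\<Sum>a\<in>UNIV. jw (c # w) (a # i) (a # j)) = of_real (kap TYPE('n) (c # w)) * jw w i j"
proof (cases w)
  case Nil
  then show ?thesis by (simp add: jw_Cons kap_Cons theta_def)
next
  case (Cons d w')
  have "(\<Sum>a\<in>UNIV. \<Sum>k\<in>idx (length w - 1). jw w i (a # k) * jw w (a # k) j) =
      (\<Sum>k\<in>ix w. jw w i k * jw w k j)"
    by (simp add: Cons sum_idx_Suc)
  then show ?thesis
    using idem[OF assms(2,3)]
    by (simp add: jw_Cons kap_Cons sum_subtractf left_diff_distrib flip: sum_distrib_left)
qed

lemma jw_absorb_aux:
  fixes i j :: "'n::finite list"
  assumes idem: "\<And>i j :: 'n list. length i = length w \<Longrightarrow> length j = length w \<Longrightarrow>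
      (\<Sum>k\<in>ix w. jw w i k * jw w k j) = jw w i j"
    and len: "length i = length w" "length j = length w"
  shows "(\<Sum>k\<in>ix w. jw w i k * jw (c # w) (a # k) (b # j)) = jw (c # w) (a # i) (b # j)"
proof -
  have M: "theta TYPE('n) c w = 0 \<or> (\<Sum>k\<in>ix w. jw w i k * (\<Sum>m\<in>idx (length w - 1). jw w k (a # m) * jw w (b # m) j)) =
      (\<Sum>m\<in>idx (length w - 1). jw w i (a # m) * jw w (b # m) j)"
  proof (cases "w = []")
    case False
    have "(\<Sum>k\<in>ix w. jw w i k * (\<Sum>m\<in>idx (length w - 1). jw w k (a # m) * jw w (b # m) j)) =
        (\<Sum>m\<in>idx (length w - 1). (\<Sum>k\<in>ix w. jw w i k * jw w k (a # m)) * jw w (b # m) j)"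
      unfolding sum_distrib_left sum_distrib_right by (subst sum.swap) (simp add: mult.assoc)
    also have "\<dots> = (\<Sum>m\<in>idx (length w - 1). jw w i (a # m) * jw w (b # m) j)"
      using False len by (intro sum.cong refl) (simp add: idem)
    finally show ?thesis ..
  qed (simp add: theta_def)
  have "(\<Sum>k\<in>ix w. jw w i k * jw (c # w) (a # k) (b # j)) =
      (\<Sum>k\<in>ix w. if a = b then jw w i k * jw w k j else 0) - of_real (theta TYPE('n) c w) *
      (\<Sum>k\<in>ix w. jw w i k * (\<Sum>m\<in>idx (length w - 1). jw w k (a # m) * jw w (b # m) j))"
    unfolding sum_distrib_left[of "of_real (theta TYPE('n) c w)"] sum_subtractf[symmetric] jw_Cons
    by (intro sum.cong refl) (simp add: right_diff_distrib sum_distrib_left mult_ac)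
  also have "\<dots> = jw (c # w) (a # i) (b # j)"
    unfolding jw_Cons using M idem[OF len] by auto
  finally show ?thesis .
qed

text \<open>With \<open>p\<close> for \<open>jw w0\<close> on the last letters and \<open>M\<close>
  for the cup-cap term, the square of \<open>p - t M\<close> collapses once
  \<open>p M = M p = M\<close> and \<open>t M M = M\<close>. The last identity closes a strand of
  \<open>jw w0\<close> and so refers to the word two letters shorter, which is why the induction is
  over the length.\<close>

lemma jw_idem:
  fixes i j :: "'n::finite list"
  assumes "CARD('n) \<ge> 2" "length i = length w" "length j = length w"
  shows "(\<Sum>k\<in>ix w. jw w i k * jw w k j) = jw w i j"
  using assms(2,3)
proof (induction w arbitrary: i j rule: length_induct)
  case (1 w)
  show ?case
  proof (cases w)
    case Nil
    then show ?thesis by simp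
  next
    case w: (Cons c w0)
    obtain a i0 b j0 where ij: "i = a # i0" "j = b # j0"
      and len: "length i0 = length w0" "length j0 = length w0"
      using 1 w by (metis length_Suc_conv)
    define t :: complex where "t = of_real (theta TYPE('n) c w0)"
    define M where "M = (\<lambda>(a::'n) i b j. \<Sum>k\<in>idx (length w0 - 1). jw w0 i (a # k) * jw w0 (b # k) j)"
    have idem0: "(\<Sum>k\<in>ix w0. jw w0 i k * jw w0 k j) = jw w0 i j"
      if "length i = length w0" "length j = length w0" for i j :: "'n list"
      using 1(1) that w by simp
    have M1: "(\<Sum>k\<in>ix w0. jw w0 i0 k * M a k b j0) = M a i0 b j0" if "w0 \<noteq> []"
    proof -
      have "(\<Sum>k\<in>ix w0. jw w0 i0 k * M a k b j0) =
          (\<Sum>m\<in>idx (length w0 - 1). (\<Sum>k\<in>ix w0. jw w0 i0 k * jw w0 k (a # m)) * jw w0 (b # m) j0)"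
        unfolding M_def sum_distrib_left sum_distrib_right
        by (subst sum.swap) (simp add: mult.assoc)
      also have "\<dots> = M a i0 b j0"
        unfolding M_def using that by (intro sum.cong refl) (simp add: idem0 len)
      finally show ?thesis .
    qed
    have M2: "(\<Sum>k\<in>ix w0. M a i0 b k * jw w0 k j0) = M a i0 b j0" if "w0 \<noteq> []"
    proof -
      have "(\<Sum>k\<in>ix w0. M a i0 b k * jw w0 k j0) =
          (\<Sum>m\<in>idx (length w0 - 1). jw w0 i0 (a # m) * (\<Sum>k\<in>ix w0. jw w0 (b # m) k * jw w0 k j0))"
        unfolding M_def sum_distrib_left sum_distrib_right
        by (subst sum.swap) (simp add: mult.assoc)
      also have "\<dots> = M a i0 b j0"
        unfolding M_def using that by (intro sum.cong refl) (simp add: idem0 len)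
      finally show ?thesis .
    qed
    \<comment> \<open>The inner strand closes to a loop worth \<open>kap w0\<close>, which
      \<open>t = 1 / kap w0\<close> cancels; the leftover \<open>jw w1\<close> is absorbed by the
      neighbouring \<open>jw w0\<close>.\<close>
    have M3: "t * (\<Sum>e\<in>UNIV. \<Sum>k\<in>ix w0. M a i0 e k * M e k b j0) = M a i0 b j0" if tn: "t \<noteq> 0"
    proof -
      obtain w1 where w1: "w0 = (\<not> c) # w1" and th: "theta TYPE('n) c w0 = 1 / kap TYPE('n) w0"
        using tn unfolding t_def by (metis theta_cases of_real_0)
      have "(\<Sum>e\<in>UNIV. \<Sum>k\<in>ix w0. M a i0 e k * M e k b j0) =
          (\<Sum>e\<in>UNIV. \<Sum>k\<in>ix w0. \<Sum>m\<in>ix w1. \<Sum>m'\<in>ix w1.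
             jw w0 i0 (a # m) * (jw w0 (e # m) k * jw w0 k (e # m')) * jw w0 (b # m') j0)"
        unfolding M_def by (simp add: w1 sum_product mult.assoc)
      also have "\<dots> = (\<Sum>m\<in>ix w1. \<Sum>m'\<in>ix w1. \<Sum>e\<in>UNIV. \<Sum>k\<in>ix w0.
             jw w0 i0 (a # m) * (jw w0 (e # m) k * jw w0 k (e # m')) * jw w0 (b # m') j0)"
        apply (subst (2) sum.swap)
        apply (subst sum.swap)
        apply (subst (3) sum.swap)
        apply (subst (2) sum.swap)
        apply (rule refl)
        done
      also have "\<dots> = (\<Sum>m\<in>ix w1. \<Sum>m'\<in>ix w1.
             jw w0 i0 (a # m) * (\<Sum>e\<in>UNIV. \<Sum>k\<in>ix w0. jw w0 (e # m) k * jw w0 k (e # m')) * jw w0 (b # m') j0)"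
        by (simp add: sum_distrib_left sum_distrib_right)
      also have "\<dots> = (\<Sum>m\<in>ix w1. \<Sum>m'\<in>ix w1.
             jw w0 i0 (a # m) * (of_real (kap TYPE('n) w0) * jw w1 m m') * jw w0 (b # m') j0)"
      proof (intro sum.cong refl)
        fix m m' :: "'n list" assume m: "m \<in> ix w1" "m' \<in> ix w1"
        have "(\<Sum>e\<in>UNIV. \<Sum>k\<in>ix w0. jw w0 (e # m) k * jw w0 k (e # m')) = (\<Sum>e\<in>UNIV. jw w0 (e # m) (e # m'))"
          using m by (intro sum.cong refl idem0) (simp_all add: w1)
        also have "\<dots> = of_real (kap TYPE('n) w0) * jw w1 m m'"
          unfolding w1 using m 1(1) w w1 by (intro jw_partial_trace_aux) auto
        finally show "jw w0 i0 (a # m) * (\<Sum>e\<in>UNIV. \<Sum>k\<in>ix w0. jw w0 (e # m) k * jw w0 k (e # m')) * jw w0 (b # m') j0 =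
          jw w0 i0 (a # m) * (of_real (kap TYPE('n) w0) * jw w1 m m') * jw w0 (b # m') j0" by simp
      qed
      also have "\<dots> = of_real (kap TYPE('n) w0) * (\<Sum>m\<in>ix w1. jw w0 i0 (a # m) * (\<Sum>m'\<in>ix w1.
             jw w1 m m' * jw w0 (b # m') j0))"
        by (simp add: sum_distrib_left mult_ac)
      also have "\<dots> = of_real (kap TYPE('n) w0) * M a i0 b j0"
      proof -
        have "(\<Sum>m'\<in>ix w1. jw w1 m m' * jw w0 (b # m') j0) = jw w0 (b # m) j0"
          if m: "length m = length w1" for m
        proof -
          obtain e j1 where j0: "j0 = e # j1" "length j1 = length w1"
            using len w1 by (cases j0) auto
          have id1: "(\<Sum>k\<in>ix w1. jw w1 i k * jw w1 k j) = jw w1 i j"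
            if "length i = length w1" "length j = length w1" for i j :: "'n list"
            using 1(1) that w w1 by simp
          show ?thesis
            unfolding w1 j0(1) using id1 m j0(2) by (intro jw_absorb_aux)
        qed
        then show ?thesis
          unfolding M_def by (simp add: w1)
      qed
      finally show ?thesis using th tn by (simp add: t_def)
    qed
    have z: "t = 0 \<or> w0 \<noteq> []" by (auto simp: t_def theta_def)
    have "(\<Sum>k\<in>ix w. jw w i k * jw w k j) =
       (\<Sum>e\<in>UNIV. \<Sum>k\<in>ix w0. ((if a = e then jw w0 i0 k else 0) - t * M a i0 e k) *
          ((if e = b then jw w0 k j0 else 0) - t * M e k b j0))"
      by (simp add: w ij sum_idx_Suc jw_Cons t_def M_def)
    also have "\<dots> = (\<Sum>e\<in>UNIV. \<Sum>k\<in>ix w0. (if a = e then if e = b then jw w0 i0 k * jw w0 k j0 else 0 else 0)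
        - (if a = e then t * (jw w0 i0 k * M e k b j0) else 0) - (if e = b then t * (M a i0 e k * jw w0 k j0) else 0)
        + t * (t * (M a i0 e k * M e k b j0)))"
      by (intro sum.cong refl) (auto simp: algebra_simps)
    also have "\<dots> = (if a = b then jw w0 i0 j0 else 0) - t * M a i0 b j0 - t * M a i0 b j0 + t * M a i0 b j0"
    proof -
      have 1: "(\<Sum>e\<in>UNIV. \<Sum>k\<in>ix w0. (if a = e then if e = b then jw w0 i0 k * jw w0 k j0 else 0 else 0)) =
          (if a = b then jw w0 i0 j0 else 0)"
        by (subst sum.swap) (simp add: idem0 len)
      have 2: "(\<Sum>e\<in>UNIV. \<Sum>k\<in>ix w0. (if a = e then t * (jw w0 i0 k * M e k b j0) else 0)) = t * M a i0 b j0"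
        apply (subst sum.swap)
        using z M1 by (auto simp flip: sum_distrib_left)
      have 3: "(\<Sum>e\<in>UNIV. \<Sum>k\<in>ix w0. (if e = b then t * (M a i0 e k * jw w0 k j0) else 0)) = t * M a i0 b j0"
        apply (subst sum.swap)
        using z M2 by (auto simp flip: sum_distrib_left)
      have 4: "(\<Sum>e\<in>UNIV. \<Sum>k\<in>ix w0. t * (t * (M a i0 e k * M e k b j0))) = t * M a i0 b j0"
        using M3 by (cases "t = 0") (auto simp flip: sum_distrib_left)
      show ?thesis by (simp add: sum.distrib sum_subtractf 1 2 3 4)
    qed
    also have "\<dots> = jw w i j" by (simp add: w ij jw_Cons t_def M_def)
    finally show ?thesis .
  qed
qed

lemma jw_partial_trace:
  fixes i j :: "'n::finite list"
  assumes "CARD('n) \<ge> 2" "length i = length w" "length j = length w"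
  shows "(\<Sum>a\<in>UNIV. jw (c # w) (a # i) (a # j)) = of_real (kap TYPE('n) (c # w)) * jw w i j"
  using assms by (intro jw_partial_trace_aux jw_idem)

lemma jw_absorb:
  fixes i j :: "'n::finite list"
  assumes "CARD('n) \<ge> 2" "length i = length w" "length j = length w"
  shows "(\<Sum>k\<in>ix w. jw w i k * jw (c # w) (a # k) (b # j)) = jw (c # w) (a # i) (b # j)"
  using assms by (intro jw_absorb_aux jw_idem)

text \<open>A cap on the first two letters straightens the identity term and closes a strand of
  \<open>jw w\<close> in the cup-cap term; since \<open>theta * kap = 1\<close> the two
  contributions cancel. A cap further inside is killed by \<open>jw w\<close> in both terms.\<close>

lemma capfree_jw:
  fixes j :: "'n::finite list"
  assumes N: "CARD('n) \<ge> 2" and "length j = length w"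
  shows "capfree w (\<lambda>i. jw w i j)"
  using assms(2)
proof (induction w arbitrary: j)
  case (Cons c w)
  then obtain b j0 where j: "j = b # j0" "length j0 = length w" by (cases j) auto
  show ?case
  proof (rule capfree_Cons)
    assume "w \<noteq> []" "hd w \<noteq> c"
    then obtain w1 where w: "w = (\<not> c) # w1" by (cases w) auto
    have th: "theta TYPE('n) c w = 1 / kap TYPE('n) w" by (simp add: theta_def w)
    have k0: "kap TYPE('n) w \<noteq> 0" using kap_ge_1[OF N, of w] by simp
    show "\<forall>i. length i = length w - 1 \<longrightarrow> (\<Sum>a\<in>UNIV. jw (c # w) (a # a # i) j) = 0"
    proof (intro allI impI)
      fix i :: "'n list" assume i: "length i = length w - 1"
      then have i: "length i = length w1" by (simp add: w)
      obtain e j1 where j0: "j0 = e # j1" "length j1 = length w1" using j w by (cases j0) auto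
      have pt: "(\<Sum>a\<in>UNIV. jw w (a # i) (a # k)) = of_real (kap TYPE('n) w) * jw w1 i k" if "length k = length w1" for k
        unfolding w using i that by (rule jw_partial_trace[OF N])
      have "(\<Sum>a\<in>UNIV. \<Sum>k\<in>ix w1. jw w (a # i) (a # k) * jw w (b # k) j0)
          = (\<Sum>k\<in>ix w1. (\<Sum>a\<in>UNIV. jw w (a # i) (a # k)) * jw w (b # k) j0)"
        by (subst sum.swap) (simp add: sum_distrib_right)
      also have "\<dots> = (\<Sum>k\<in>ix w1. of_real (kap TYPE('n) w) * (jw w1 i k * jw w (b # k) j0))"
        by (intro sum.cong refl) (simp add: pt)
      also have "\<dots> = of_real (kap TYPE('n) w) * jw w (b # i) j0"
        using jw_absorb[OF N i, of j1 "\<not> c" b e] by (simp add: w j0 flip: sum_distrib_left)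
      finally have *: "(\<Sum>a\<in>UNIV. \<Sum>k\<in>ix w1. jw w (a # i) (a # k) * jw w (b # k) j0) =
          of_real (kap TYPE('n) w) * jw w (b # i) j0" .
      have tk: "complex_of_real (theta TYPE('n) c w) * of_real (kap TYPE('n) w) = 1"
        using k0 by (simp add: th flip: of_real_mult)
      have len: "length w - 1 = length w1" by (simp add: w)
      have "of_real (theta TYPE('n) c w) * (\<Sum>a\<in>UNIV. \<Sum>k\<in>idx (length w - 1). jw w (a # i) (a # k) * jw w (b # k) j0)
          = jw w (b # i) j0"
        unfolding len * mult.assoc[symmetric] tk by simp
      then show "(\<Sum>a\<in>UNIV. jw (c # w) (a # a # i) j) = 0"
        by (simp add: j jw_Cons[of c w] sum_subtractf flip: sum_distrib_left)
    qed
  next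
    fix a
    have cf: "capfree w (\<lambda>i. jw w i j)" if "length j = length w" for j :: "'n list" using Cons.IH that by simp
    show "capfree w (\<lambda>i. jw (c # w) (a # i) j)"
      unfolding capfree_def
    proof (intro allI impI)
      fix w1 d w2 and i k :: "'n list"
      assume *: "w = w1 @ d # (\<not> d) # w2" "length i = length w1" "length k = length w2"
      have z: "(\<Sum>e\<in>UNIV. jw w (i @ e # e # k) l) = 0" if "length l = length w" for l
        using cf[OF that] * by (auto dest: capfreeD)
      have "(\<Sum>e\<in>UNIV. \<Sum>l\<in>idx (length w - 1). jw w (i @ e # e # k) (a # l) * jw w (b # l) j0) =
          (\<Sum>l\<in>idx (length w - 1). (\<Sum>e\<in>UNIV. jw w (i @ e # e # k) (a # l)) * jw w (b # l) j0)"
        by (subst sum.swap) (simp add: sum_distrib_right)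
      also have "\<dots> = 0"
      proof (intro sum.neutral ballI)
        fix l :: "'n list" assume "l \<in> idx (length w - 1)"
        moreover have "w \<noteq> []" using * by simp
        ultimately have "length (a # l) = length w" by (cases w) auto
        then show "(\<Sum>e\<in>UNIV. jw w (i @ e # e # k) (a # l)) * jw w (b # l) j0 = 0" by (simp only: z mult_zero_left)
      qed
      finally show "(\<Sum>e\<in>UNIV. jw (c # w) (a # i @ e # e # k) j) = 0"
        using z[OF j(2)]
        by (cases "a = b") (simp_all add: j jw_Cons sum_subtractf sum_negf flip: sum_distrib_left)
    qed
  qed
qed simp

text \<open>Applied to a cap-free vector, the cup-cap term contains a cap of that vector and
  vanishes. Together with \<open>capfree_jw\<close> this identifies the range of \<open>jw w\<close>
  with the cap-free tensors.\<close>

lemma jw_capfree: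
  fixes i :: "'n::finite list"
  assumes "capfree w \<xi>" "length i = length w"
  shows "(\<Sum>j\<in>ix w. jw w i j * \<xi> j) = \<xi> i"
  using assms
proof (induction w arbitrary: \<xi> i)
  case (Cons c w)
  obtain a i0 where i: "i = a # i0" "length i0 = length w" using Cons by (cases i) auto
  have IH: "(\<Sum>j\<in>ix w. jw w i j * \<xi> (b # j)) = \<xi> (b # i)" if "length i = length w" for b i
    using Cons.IH[OF capfree_tail[OF Cons.prems(1)] that] .
  have M: "theta TYPE('n) c w = 0 \<or> (\<Sum>b\<in>UNIV. \<Sum>j\<in>ix w. (\<Sum>k\<in>idx (length w - 1). jw w i0 (a # k) * jw w (b # k) j) * \<xi> (b # j)) = 0"
  proof (rule theta_cases[of "TYPE('n)" c w])
    fix w1 assume w: "w = (\<not> c) # w1"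
    have "(\<Sum>b\<in>UNIV. \<Sum>j\<in>ix w. (\<Sum>k\<in>idx (length w - 1). jw w i0 (a # k) * jw w (b # k) j) * \<xi> (b # j)) =
       (\<Sum>b\<in>UNIV. \<Sum>k\<in>ix w1. jw w i0 (a # k) * (\<Sum>j\<in>ix w. jw w (b # k) j * \<xi> (b # j)))"
      unfolding sum_distrib_left sum_distrib_right by (subst (2) sum.swap) (simp add: w mult.assoc)
    also have "\<dots> = (\<Sum>b\<in>UNIV. \<Sum>k\<in>ix w1. jw w i0 (a # k) * \<xi> (b # b # k))"
      using w by (intro sum.cong refl arg_cong2[where f = "(*)"] IH) simp
    also have "\<dots> = (\<Sum>k\<in>ix w1. jw w i0 (a # k) * (\<Sum>b\<in>UNIV. \<xi> (b # b # k)))"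
      unfolding sum_distrib_left by (rule sum.swap)
    also have "\<dots> = 0"
      using Cons.prems(1) w by (intro sum.neutral ballI) (simp add: capfree_hdD)
    finally show ?thesis ..
  qed simp
  have "(\<Sum>j\<in>ix (c # w). jw (c # w) i j * \<xi> j) =
    (\<Sum>b\<in>UNIV. \<Sum>j\<in>ix w. (if a = b then jw w i0 j * \<xi> (b # j) else 0)) - of_real (theta TYPE('n) c w) *
    (\<Sum>b\<in>UNIV. \<Sum>j\<in>ix w. (\<Sum>k\<in>idx (length w - 1). jw w i0 (a # k) * jw w (b # k) j) * \<xi> (b # j))"
  proof -
    have "jw (c # w) i (b # j) * \<xi> (b # j) = (if a = b then jw w i0 j * \<xi> (b # j) else 0) -
        of_real (theta TYPE('n) c w) * ((\<Sum>k\<in>idx (length w - 1). jw w i0 (a # k) * jw w (b # k) j) * \<xi> (b # j))" for b j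
      by (simp add: i jw_Cons algebra_simps)
    then show ?thesis
      by (simp add: sum_idx_Suc sum_subtractf flip: sum_distrib_left)
  qed
  also have "\<dots> = (\<Sum>j\<in>ix w. jw w i0 j * \<xi> (a # j))"
    using M by (subst sum.swap) auto
  also have "\<dots> = \<xi> i" using IH i by simp
  finally show ?case .
qed simp

section \<open>Dimensions of the cap-free spaces\<close>

definition jw_dim :: "'n::finite itself \<Rightarrow> bool list \<Rightarrow> complex" where
  "jw_dim n w = (\<Sum>i\<in>ix w. jw w i (i :: 'n list))"

lemma jw_dim_Cons:
  assumes "CARD('n::finite) \<ge> 2"
  shows "jw_dim TYPE('n) (c # w) = of_real (kap TYPE('n) (c # w)) * jw_dim TYPE('n) w"
  unfolding jw_dim_def length_Cons sum_idx_Suc sum_distrib_left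
  by (subst sum.swap) (simp add: jw_partial_trace assms)

text \<open>The last letter contributes the factor n, at least 2, and every further letter a factor
  \<open>kap\<close> of at least 1. That only the empty word is one-dimensional is the fact behind
  the contradiction in \<open>inv_words_suffix\<close>.\<close>

lemma jw_dim_ge:
  assumes "CARD('n::finite) \<ge> 2"
  shows "\<exists>r\<ge>(if w = [] then 1 else 2). jw_dim TYPE('n) w = of_real r"
proof (induction w)
  case Nil
  show ?case by (auto simp: jw_dim_def)
next
  case (Cons c w)
  then obtain r where r: "r \<ge> (if w = [] then 1 else 2)" "jw_dim TYPE('n) w = of_real r" by blast
  have "kap TYPE('n) (c # w) * r \<ge> 2"
  proof (cases "w = []")
    case True
    then have "real CARD('n) * r \<ge> 2 * 1" using r assms by (intro mult_mono) auto
    then show ?thesis using True by (simp add: kap_Cons theta_def)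
  next
    case False
    then have "kap TYPE('n) (c # w) * r \<ge> 1 * 2"
      using r kap_ge_1[OF assms, of "c # w"] by (intro mult_mono) auto
    then show ?thesis by simp
  qed
  moreover have "jw_dim TYPE('n) (c # w) = of_real (kap TYPE('n) (c # w) * r)"
    by (simp only: jw_dim_Cons[OF assms] r of_real_mult)
  ultimately show ?case by (intro exI[of _ "kap TYPE('n) (c # w) * r"]) simp
qed

section \<open>Tensor powers of a unitary matrix with unitary conjugate\<close>

lemma star_one [simp]: "star (1 :: 'a::complex_star_algebra) = 1"
  by (metis mult.left_neutral mult.right_neutral star_mult star_star)

lemma star_sum: "star (sum f A) = (\<Sum>x\<in>A. star (f x :: 'a::complex_star_algebra))"
  by (induction A rule: infinite_finite_induct) (simp_all add: star_add)

lemma star_power: "star (x ^ k) = star (x :: 'a::complex_star_algebra) ^ k"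
  by (induction k) (simp_all add: star_mult power_commutes)

lemmas scaleC_sum_right = complex_vector.scale_sum_right
lemmas scaleC_sum_left = complex_vector.scale_sum_left

lemma scaleC_if: "(if b then c else 0) *\<^sub>C x = (if b then c *\<^sub>C x else 0)" for x :: "'a::complex_vector"
  by simp

lemma sum_delta_outer:
  "(\<Sum>e\<in>(UNIV :: 'b::finite set). \<Sum>j\<in>J. if e = a then f e j else 0) = (\<Sum>j\<in>J. f a j)"
  "(\<Sum>e\<in>(UNIV :: 'b::finite set). \<Sum>j\<in>J. if a = e then f e j else 0) = (\<Sum>j\<in>J. f a j)"
  by (subst sum.swap, simp)+

lemma sum_rot3: "(\<Sum>a\<in>A. \<Sum>b\<in>B. \<Sum>c\<in>C. f a b c) = (\<Sum>b\<in>B. \<Sum>c\<in>C. \<Sum>a\<in>A. f a b c)"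
  by (subst sum.swap) (intro sum.cong refl sum.swap)

definition uc :: "('n \<Rightarrow> 'n \<Rightarrow> 'a::complex_star_algebra) \<Rightarrow> bool \<Rightarrow> 'n \<Rightarrow> 'n \<Rightarrow> 'a" where
  "uc u c i j = (if c then u i j else star (u i j))"

lemma star_uc [simp]: "star (uc u c i j) = uc u (\<not> c) i j"
  by (simp add: uc_def)

primrec um :: "('n \<Rightarrow> 'n \<Rightarrow> 'a::complex_star_algebra) \<Rightarrow> bool list \<Rightarrow> 'n list \<Rightarrow> 'n list \<Rightarrow> 'a" where
  "um u [] i j = 1"
| "um u (c # w) i j = uc u c (hd i) (hd j) * um u w (tl i) (tl j)"

lemma um_Cons [simp]: "um u (c # w) (a # i) (b # j) = uc u c a b * um u w i j"
  by simp

declare um.simps(2) [simp del]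

lemma um_append:
  "length i = length v \<Longrightarrow> length i' = length v \<Longrightarrow> um u (v @ w) (i @ j) (i' @ j') = um u v i i' * um u w j j'"
proof (induction v arbitrary: i i')
  case (Cons c v)
  then obtain a i0 a' i0' where "i = a # i0" "i' = a' # i0'" "length i0 = length v" "length i0' = length v"
    by (metis length_Suc_conv)
  then show ?case using Cons.IH by (simp add: mult.assoc)
qed simp

text \<open>The star reverses products and flips colours, so the index lists have to be read
  backwards along \<open>bar w\<close>.\<close>

lemma star_um:
  "length i = length w \<Longrightarrow> length j = length w \<Longrightarrow> star (um u w i j) = um u (bar w) (rev i) (rev j)"
proof (induction w arbitrary: i j)
  case (Cons c w)
  then obtain a i0 b j0 where "i = a # i0" "j = b # j0" "length i0 = length w" "length j0 = length w"
    by (metis length_Suc_conv)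
  then show ?case using Cons.IH by (simp add: star_mult um_append)
qed simp

lemma um_bar:
  "length i = length w \<Longrightarrow> length j = length w \<Longrightarrow> um u (bar w) i j = star (um u w (rev i) (rev j))"
  by (simp add: star_um)

text \<open>Taken for both colours, \<open>row\<close> and \<open>col\<close> are the four unitarity
  relations of \<open>u\<close> and of its entrywise conjugate. In this form they say that cups and
  caps joining opposite colours, in either order, are intertwiners.\<close>

locale biunitary =
  fixes u :: "'n::finite \<Rightarrow> 'n \<Rightarrow> 'a::complex_star_algebra"
  assumes row: "(\<Sum>k\<in>UNIV. uc u c i k * uc u (\<not> c) j k) = (if i = j then 1 else 0)"
    and col: "(\<Sum>k\<in>UNIV. uc u c k i * uc u (\<not> c) k j) = (if i = j then 1 else 0)"
    and N2: "CARD('n) \<ge> 2"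
begin

abbreviation "V \<equiv> uc u"
abbreviation "U \<equiv> um u"

lemma row_mult: "(\<Sum>k\<in>UNIV. V c i k * (V (\<not> c) j k * x)) = (if i = j then x else 0)"
  using arg_cong[OF row[of c i j], of "\<lambda>y. y * x"] by (simp add: sum_distrib_right mult.assoc)

lemma col_mult: "(\<Sum>k\<in>UNIV. V c k i * (V (\<not> c) k j * x)) = (if i = j then x else 0)"
  using arg_cong[OF col[of c i j], of "\<lambda>y. y * x"] by (simp add: sum_distrib_right mult.assoc)

lemma U_row:
  "length i = length w \<Longrightarrow> length j = length w \<Longrightarrow>
    (\<Sum>k\<in>ix w. U w i k * star (U w j k)) = (if i = j then 1 else 0)"
proof (induction w arbitrary: i j)
  case (Cons c w)
  then obtain a i0 b j0 where ij: "i = a # i0" "j = b # j0" "length i0 = length w" "length j0 = length w"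
    by (metis length_Suc_conv)
  have "(\<Sum>k\<in>ix (c # w). U (c # w) i k * star (U (c # w) j k)) =
      (\<Sum>e\<in>UNIV. V c a e * (\<Sum>k\<in>ix w. U w i0 k * star (U w j0 k)) * V (\<not> c) b e)"
    unfolding length_Cons sum_idx_Suc
    by (simp add: ij star_mult sum_distrib_left sum_distrib_right mult.assoc)
  also have "\<dots> = (if i = j then 1 else 0)"
    using Cons.IH[OF ij(3,4)] row[of c a b] ij by auto
  finally show ?case .
qed simp

lemma U_row':
  assumes "length i = length w" "length j = length w"
  shows "(\<Sum>k\<in>ix w. star (U w i k) * U w j k) = (if i = j then 1 else 0)"
proof -
  have "(\<Sum>k\<in>ix w. star (U w i k) * U w j k) =
      (\<Sum>k\<in>ix w. U (bar w) (rev i) (rev k) * star (U (bar w) (rev j) (rev k)))"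
    using assms by (intro sum.cong refl) (simp add: um_bar)
  also have "\<dots> = (\<Sum>k\<in>ix w. U (bar w) (rev i) k * star (U (bar w) (rev j) k))"
    by (rule sum_idx_rev)
  finally show ?thesis using U_row[of "rev i" "bar w" "rev j"] assms by simp
qed

text \<open>Commutation moves \<open>jw\<close> out of the way, so that \<open>V c\<close> meets the
  entry \<open>V (\<not> c)\<close> of the first letter and \<open>row\<close> contracts the pair.
  The commutation is a premise since \<open>jw_U_comm\<close> calls this lemma within its
  induction.\<close>

lemma jw_cap_aux:
  assumes comm: "\<And>i j. length i = Suc (length w) \<Longrightarrow> length j = Suc (length w) \<Longrightarrow>
      (\<Sum>k\<in>idx (Suc (length w)). jw ((\<not> c) # w) k j *\<^sub>C U ((\<not> c) # w) i k) =
      (\<Sum>k\<in>idx (Suc (length w)). jw ((\<not> c) # w) i k *\<^sub>C U ((\<not> c) # w) k j)"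
    and "length i = Suc (length w)" "length k = length w"
  shows "(\<Sum>e\<in>UNIV. V c a e * (\<Sum>j\<in>idx (Suc (length w)). jw ((\<not> c) # w) j (e # k) *\<^sub>C U ((\<not> c) # w) i j))
      = (\<Sum>j\<in>ix w. jw ((\<not> c) # w) i (a # j) *\<^sub>C U w j k)"
proof -
  have "(\<Sum>e\<in>UNIV. V c a e * (\<Sum>j\<in>idx (Suc (length w)). jw ((\<not> c) # w) j (e # k) *\<^sub>C U ((\<not> c) # w) i j))
     = (\<Sum>e\<in>UNIV. V c a e * (\<Sum>j\<in>idx (Suc (length w)). jw ((\<not> c) # w) i j *\<^sub>C U ((\<not> c) # w) j (e # k)))"
    using assms(2,3) by (simp add: comm)
  also have "\<dots> = (\<Sum>e\<in>UNIV. \<Sum>f\<in>UNIV. \<Sum>j\<in>ix w. jw ((\<not> c) # w) i (f # j) *\<^sub>C (V c a e * (V (\<not> c) f e * U w j k)))"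
    by (simp add: sum_idx_Suc sum_distrib_left)
  also have "\<dots> = (\<Sum>f\<in>UNIV. \<Sum>j\<in>ix w. jw ((\<not> c) # w) i (f # j) *\<^sub>C (\<Sum>e\<in>UNIV. V c a e * (V (\<not> c) f e * U w j k)))"
    unfolding scaleC_sum_right by (rule sum_rot3)
  also have "\<dots> = (\<Sum>j\<in>ix w. \<Sum>f\<in>UNIV. if a = f then jw ((\<not> c) # w) i (f # j) *\<^sub>C U w j k else 0)"
    by (subst sum.swap) (intro sum.cong refl, simp add: row_mult)
  finally show ?thesis by simp
qed

lemma jw_cap_aux':
  assumes comm: "\<And>i j. length i = Suc (length w) \<Longrightarrow> length j = Suc (length w) \<Longrightarrow>
      (\<Sum>k\<in>idx (Suc (length w)). jw ((\<not> c) # w) k j *\<^sub>C U ((\<not> c) # w) i k) =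
      (\<Sum>k\<in>idx (Suc (length w)). jw ((\<not> c) # w) i k *\<^sub>C U ((\<not> c) # w) k j)"
    and "length j = Suc (length w)" "length m = length w"
  shows "(\<Sum>e\<in>UNIV. V c e b * (\<Sum>k\<in>idx (Suc (length w)). jw ((\<not> c) # w) (e # m) k *\<^sub>C U ((\<not> c) # w) k j))
      = (\<Sum>k\<in>ix w. jw ((\<not> c) # w) (b # k) j *\<^sub>C U w m k)"
proof -
  have "(\<Sum>e\<in>UNIV. V c e b * (\<Sum>k\<in>idx (Suc (length w)). jw ((\<not> c) # w) (e # m) k *\<^sub>C U ((\<not> c) # w) k j))
     = (\<Sum>e\<in>UNIV. V c e b * (\<Sum>k\<in>idx (Suc (length w)). jw ((\<not> c) # w) k j *\<^sub>C U ((\<not> c) # w) (e # m) k))"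
    using assms(2,3) by (simp add: comm)
  also have "\<dots> = (\<Sum>e\<in>UNIV. \<Sum>f\<in>UNIV. \<Sum>k\<in>ix w. jw ((\<not> c) # w) (f # k) j *\<^sub>C (V c e b * (V (\<not> c) e f * U w m k)))"
    by (simp add: sum_idx_Suc sum_distrib_left)
  also have "\<dots> = (\<Sum>f\<in>UNIV. \<Sum>k\<in>ix w. jw ((\<not> c) # w) (f # k) j *\<^sub>C (\<Sum>e\<in>UNIV. V c e b * (V (\<not> c) e f * U w m k)))"
    unfolding scaleC_sum_right by (rule sum_rot3)
  also have "\<dots> = (\<Sum>k\<in>ix w. \<Sum>f\<in>UNIV. if b = f then jw ((\<not> c) # w) (f # k) j *\<^sub>C U w m k else 0)"
    by (subst sum.swap) (intro sum.cong refl, simp add: col_mult)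
  finally show ?thesis by simp
qed

text \<open>Wenzl's recursion builds \<open>jw\<close> from identities, cups and caps, each
  compatible with the coefficients. Only the cup-cap term needs work: \<open>jw_cap_aux\<close> and
  \<open>jw_cap_aux'\<close> bring its left and right versions to one expression in the coefficients
  of the word two letters shorter.\<close>

lemma jw_U_comm:
  "length i = length w \<Longrightarrow> length j = length w \<Longrightarrow>
    (\<Sum>k\<in>ix w. jw w k j *\<^sub>C U w i k) = (\<Sum>k\<in>ix w. jw w i k *\<^sub>C U w k j)"
proof (induction w arbitrary: i j)
  case (Cons c w)
  then obtain a i0 b j0 where ij: "i = a # i0" "j = b # j0" "length i0 = length w" "length j0 = length w"
    by (metis length_Suc_conv)
  let ?t = "of_real (theta TYPE('n) c w) :: complex"
  have main: "?t = 0 \<or>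
      (\<Sum>e\<in>UNIV. \<Sum>k\<in>ix w. (\<Sum>m\<in>idx (length w - 1). jw w k (e # m) * jw w (b # m) j0) *\<^sub>C (V c a e * U w i0 k)) =
      (\<Sum>e\<in>UNIV. \<Sum>k\<in>ix w. (\<Sum>m\<in>idx (length w - 1). jw w i0 (a # m) * jw w (e # m) k) *\<^sub>C (V c e b * U w k j0))"
    (is "_ \<or> ?L = ?R")
  proof (rule theta_cases[of "TYPE('n)" c w])
    fix w1 assume w: "w = (\<not> c) # w1"
    note comm = Cons.IH[unfolded w length_Cons]
    have "?L = (\<Sum>e\<in>UNIV. \<Sum>m\<in>ix w1. \<Sum>k\<in>ix w. jw w (b # m) j0 *\<^sub>C (V c a e * jw w k (e # m) *\<^sub>C U w i0 k))"
      by (subst (2) sum.swap) (simp add: w scaleC_sum_left mult.commute)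
    also have "\<dots> = (\<Sum>m\<in>ix w1. jw w (b # m) j0 *\<^sub>C (\<Sum>e\<in>UNIV. V c a e * (\<Sum>k\<in>ix w. jw w k (e # m) *\<^sub>C U w i0 k)))"
      by (subst sum.swap) (simp only: scaleC_sum_right sum_distrib_left)
    also have "\<dots> = (\<Sum>m\<in>ix w1. jw w (b # m) j0 *\<^sub>C (\<Sum>k\<in>ix w1. jw w i0 (a # k) *\<^sub>C U w1 k m))"
      using ij unfolding w by (intro sum.cong refl arg_cong2[where f = scaleC]) (simp add: jw_cap_aux[OF comm])
    also have "\<dots> = (\<Sum>m\<in>ix w1. jw w i0 (a # m) *\<^sub>C (\<Sum>k\<in>ix w1. jw w (b # k) j0 *\<^sub>C U w1 m k))"
      unfolding scaleC_sum_right by (subst sum.swap) (simp add: mult.commute)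
    also have "\<dots> = (\<Sum>m\<in>ix w1. jw w i0 (a # m) *\<^sub>C (\<Sum>e\<in>UNIV. V c e b * (\<Sum>k\<in>ix w. jw w (e # m) k *\<^sub>C U w k j0)))"
      using ij unfolding w by (intro sum.cong refl arg_cong2[where f = scaleC]) (simp add: jw_cap_aux'[OF comm])
    also have "\<dots> = (\<Sum>e\<in>UNIV. \<Sum>m\<in>ix w1. \<Sum>k\<in>ix w. jw w i0 (a # m) *\<^sub>C (V c e b * jw w (e # m) k *\<^sub>C U w k j0))"
      by (subst (2) sum.swap) (simp only: scaleC_sum_right sum_distrib_left)
    also have "\<dots> = ?R"
      by (rule sum.cong[OF refl], subst sum.swap) (simp add: w scaleC_sum_left)
    finally show ?thesis ..
  qed simp
  have "(\<Sum>k\<in>ix (c # w). jw (c # w) k j *\<^sub>C U (c # w) i k) =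
     (\<Sum>e\<in>UNIV. \<Sum>k\<in>ix w. if e = b then jw w k j0 *\<^sub>C (V c a e * U w i0 k) else 0) - ?t *\<^sub>C ?L"
    unfolding length_Cons sum_idx_Suc scaleC_sum_right ij jw_Cons
    by (simp add: complex_vector.scale_left_diff_distrib scaleC_if sum_subtractf scaleC_sum_right)
  also have "\<dots> = V c a b * (\<Sum>k\<in>ix w. jw w k j0 *\<^sub>C U w i0 k) - ?t *\<^sub>C ?L"
    unfolding sum_delta_outer by (simp add: sum_distrib_left)
  also have "\<dots> = V c a b * (\<Sum>k\<in>ix w. jw w i0 k *\<^sub>C U w k j0) - ?t *\<^sub>C ?R"
    using main Cons.IH ij by auto
  also have "\<dots> = (\<Sum>e\<in>UNIV. \<Sum>k\<in>ix w. if a = e then jw w i0 k *\<^sub>C (V c e b * U w k j0) else 0) - ?t *\<^sub>C ?R"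
    unfolding sum_delta_outer by (simp add: sum_distrib_left)
  also have "\<dots> = (\<Sum>k\<in>ix (c # w). jw (c # w) i k *\<^sub>C U (c # w) k j)"
    unfolding length_Cons sum_idx_Suc scaleC_sum_right ij jw_Cons
    by (simp add: complex_vector.scale_left_diff_distrib scaleC_if sum_subtractf scaleC_sum_right)
  finally show ?case .
qed simp

section \<open>Irreducible characters and their fusion with one letter\<close>

definition chr :: "bool list \<Rightarrow> 'a" where
  "chr w = (\<Sum>i\<in>ix w. \<Sum>j\<in>ix w. jw w j i *\<^sub>C U w i j)"

lemma chr_Nil [simp]: "chr [] = 1"
  by (simp add: chr_def)

lemma jw_cap:
  assumes "length i = Suc (length w)" "length k = length w"
  shows "(\<Sum>e\<in>UNIV. V c a e * (\<Sum>j\<in>idx (Suc (length w)). jw ((\<not> c) # w) j (e # k) *\<^sub>C U ((\<not> c) # w) i j))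
      = (\<Sum>j\<in>ix w. jw ((\<not> c) # w) i (a # j) *\<^sub>C U w j k)"
  using assms jw_U_comm[of _ "(\<not> c) # w"] by (intro jw_cap_aux) auto

text \<open>After \<open>jw_cap\<close> removes the letter \<open>c\<close>, the two copies of
  \<open>jw\<close> merge by idempotence, and closing their first strand yields \<open>kap\<close>.
  In \<open>chr_Cons\<close> this factor cancels against \<open>theta\<close>.\<close>

lemma chr_Cons_cap:
  "(\<Sum>a\<in>UNIV. \<Sum>i\<in>idx (Suc (length w)). \<Sum>k\<in>ix w. jw ((\<not> c) # w) (a # k) i *\<^sub>C
     (\<Sum>e\<in>UNIV. V c a e * (\<Sum>j\<in>idx (Suc (length w)). jw ((\<not> c) # w) j (e # k) *\<^sub>C U ((\<not> c) # w) i j))) =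
   of_real (kap TYPE('n) ((\<not> c) # w)) *\<^sub>C chr w"
proof -
  let ?w = "(\<not> c) # w"
  have "(\<Sum>a\<in>UNIV. \<Sum>i\<in>idx (Suc (length w)). \<Sum>k\<in>ix w. jw ?w (a # k) i *\<^sub>C
     (\<Sum>e\<in>UNIV. V c a e * (\<Sum>j\<in>idx (Suc (length w)). jw ?w j (e # k) *\<^sub>C U ?w i j))) =
     (\<Sum>a\<in>UNIV. \<Sum>i\<in>idx (Suc (length w)). \<Sum>k\<in>ix w. \<Sum>j\<in>ix w. (jw ?w (a # k) i * jw ?w i (a # j)) *\<^sub>C U w j k)"
    by (simp add: jw_cap scaleC_sum_right)
  also have "\<dots> = (\<Sum>a\<in>UNIV. \<Sum>k\<in>ix w. \<Sum>j\<in>ix w. \<Sum>i\<in>idx (Suc (length w)). (jw ?w (a # k) i * jw ?w i (a # j)) *\<^sub>C U w j k)"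
    by (intro sum.cong refl sum_rot3)
  also have "\<dots> = (\<Sum>a\<in>UNIV. \<Sum>k\<in>ix w. \<Sum>j\<in>ix w. jw ?w (a # k) (a # j) *\<^sub>C U w j k)"
  proof (intro sum.cong refl)
    fix a and k j :: "'n list" assume "k \<in> ix w" "j \<in> ix w"
    then show "(\<Sum>i\<in>idx (Suc (length w)). (jw ?w (a # k) i * jw ?w i (a # j)) *\<^sub>C U w j k) = jw ?w (a # k) (a # j) *\<^sub>C U w j k"
      using jw_idem[OF N2, of "a # k" ?w "a # j"] by (simp flip: scaleC_sum_left)
  qed
  also have "\<dots> = (\<Sum>k\<in>ix w. \<Sum>j\<in>ix w. (\<Sum>a\<in>UNIV. jw ?w (a # k) (a # j)) *\<^sub>C U w j k)"
    unfolding scaleC_sum_left by (rule sum_rot3)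
  also have "\<dots> = (\<Sum>k\<in>ix w. \<Sum>j\<in>ix w. of_real (kap TYPE('n) ?w) *\<^sub>C (jw w k j *\<^sub>C U w j k))"
    by (intro sum.cong refl) (simp add: jw_partial_trace[OF N2])
  also have "\<dots> = of_real (kap TYPE('n) ?w) *\<^sub>C chr w"
    unfolding chr_def by (subst sum.swap) (simp add: scaleC_sum_right)
  finally show ?thesis .
qed

text \<open>The trace of Wenzl's recursion: the identity term gives the product of characters, the
  cup-cap term the character of the tail. This is the fusion rule of the free unitary quantum group
  with one letter, valid for every \<open>biunitary\<close> matrix.\<close>

lemma chr_Cons:
  "(\<Sum>a\<in>UNIV. V c a a) * chr w = chr (c # w) + (if w \<noteq> [] \<and> hd w \<noteq> c then chr (tl w) else 0)"
proof -
  let ?t = "of_real (theta TYPE('n) c w) :: complex"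
  let ?X = "\<Sum>a\<in>UNIV. \<Sum>i\<in>ix w. \<Sum>e\<in>UNIV. \<Sum>j\<in>ix w.
     (\<Sum>k\<in>idx (length w - 1). jw w j (e # k) * jw w (a # k) i) *\<^sub>C (V c a e * U w i j)"
  have X: "?t *\<^sub>C ?X = (if w \<noteq> [] \<and> hd w \<noteq> c then chr (tl w) else 0)"
  proof (rule theta_cases[of "TYPE('n)" c w])
    fix w1 assume w: "w = (\<not> c) # w1" and th: "theta TYPE('n) c w = 1 / kap TYPE('n) w"
    have "?X = (\<Sum>a\<in>UNIV. \<Sum>i\<in>ix w. \<Sum>e\<in>UNIV. \<Sum>j\<in>ix w.
     \<Sum>k\<in>ix w1. jw w (a # k) i *\<^sub>C (V c a e * (jw w j (e # k) *\<^sub>C U w i j)))"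
      by (simp add: w scaleC_sum_left mult.commute)
    also have "\<dots> = (\<Sum>a\<in>UNIV. \<Sum>i\<in>ix w. \<Sum>k\<in>ix w1. \<Sum>e\<in>UNIV. \<Sum>j\<in>ix w.
     jw w (a # k) i *\<^sub>C (V c a e * (jw w j (e # k) *\<^sub>C U w i j)))"
      by (intro sum.cong refl sum_rot3[symmetric])
    also have "\<dots> = (\<Sum>a\<in>UNIV. \<Sum>i\<in>ix w. \<Sum>k\<in>ix w1. jw w (a # k) i *\<^sub>C
        (\<Sum>e\<in>UNIV. V c a e * (\<Sum>j\<in>ix w. jw w j (e # k) *\<^sub>C U w i j)))"
      by (simp only: scaleC_sum_right sum_distrib_left)
    also have "\<dots> = of_real (kap TYPE('n) w) *\<^sub>C chr w1"
      unfolding w length_Cons by (rule chr_Cons_cap)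
    finally show ?thesis
      using th kap_ge_1[OF N2, of w] by (simp add: w flip: of_real_mult)
  qed auto
  have "chr (c # w) = (\<Sum>a\<in>UNIV. \<Sum>i\<in>ix w. \<Sum>e\<in>UNIV. \<Sum>j\<in>ix w. if e = a then jw w j i *\<^sub>C (V c a e * U w i j) else 0) - ?t *\<^sub>C ?X"
    unfolding chr_def length_Cons sum_idx_Suc scaleC_sum_right jw_Cons
    by (simp add: complex_vector.scale_left_diff_distrib scaleC_if sum_subtractf scaleC_sum_right)
  also have "\<dots> = (\<Sum>a\<in>UNIV. V c a a) * chr w - ?t *\<^sub>C ?X"
    unfolding sum_delta_outer chr_def sum_distrib_right unfolding sum_distrib_left mult_scaleC_right ..
  finally show ?thesis using X by simp
qed

definition main_sum :: 'a ("T") where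
  "T = (\<Sum>c\<in>UNIV. \<Sum>a\<in>UNIV. V c a a)"

definition sig :: "nat \<Rightarrow> 'a" where
  "sig d = (\<Sum>w\<in>idx d. chr w)"

lemma sig_0 [simp]: "sig 0 = 1"
  by (simp add: sig_def)

text \<open>Each of the two letters \<open>c\<close> cancels against the single opposite first
  letter, so every word of length \<open>d\<close> arises as a tail exactly twice. This 2 is the
  source of the norm \<open>2 * sqrt 2\<close>.\<close>

lemma T_sig: "T * sig (Suc d) = sig (Suc (Suc d)) + 2 *\<^sub>C sig d"
proof -
  have "T * sig (Suc d) = (\<Sum>c\<in>UNIV. \<Sum>w\<in>idx (Suc d). chr (c # w) + (if w \<noteq> [] \<and> hd w \<noteq> c then chr (tl w) else 0))"
    by (simp only: main_sum_def sig_def sum_product chr_Cons)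
  also have "\<dots> = sig (Suc (Suc d)) + (\<Sum>c\<in>(UNIV :: bool set). \<Sum>e\<in>UNIV. if e \<noteq> c then sum chr (idx d) else 0)"
    by (simp add: sum.distrib sig_def sum_idx_Suc[of _ "Suc d"]) (simp add: sum_idx_Suc UNIV_bool)
  also have "\<dots> = sig (Suc (Suc d)) + 2 *\<^sub>C sig d"
    using scaleC_add_left[of 1 1 "sig d"] by (simp add: UNIV_bool sig_def)
  finally show ?thesis .
qed

lemma T_sig_0: "T = sig 1"
proof -
  have "chr [c] = (\<Sum>a\<in>UNIV. V c a a)" for c using chr_Cons[of c "[]"] by simp
  then show ?thesis by (simp add: main_sum_def sig_def sum_idx_Suc)
qed

end

section \<open>Invariant vectors\<close>

lemma clinear_iff:
  "clinear f \<longleftrightarrow> (\<forall>x y. f (x + y) = f x + f y) \<and> (\<forall>c x. f (c *\<^sub>C x) = c *\<^sub>C f x)"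
  for f :: "'a::complex_vector \<Rightarrow> 'b::complex_vector"
  by (auto simp: Vector_Spaces.linear_def module_hom_def module_hom_axioms_def
      complex_vector.module_axioms complex_vector.vector_space_axioms)

text \<open>By Lagrange's identity the difference of the two sides is half of a sum of
  squares.\<close>

lemma Cauchy_Schwarz_sum:
  fixes a b :: "'i \<Rightarrow> real"
  shows "(\<Sum>i\<in>I. a i * b i)\<^sup>2 \<le> (\<Sum>i\<in>I. (a i)\<^sup>2) * (\<Sum>i\<in>I. (b i)\<^sup>2)"
proof -
  have "0 \<le> (\<Sum>i\<in>I. \<Sum>j\<in>I. (a i * b j - a j * b i)\<^sup>2)"
    by (intro sum_nonneg) simp
  also have "\<dots> = (\<Sum>i\<in>I. \<Sum>j\<in>I. (a i)\<^sup>2 * (b j)\<^sup>2) + (\<Sum>i\<in>I. \<Sum>j\<in>I. (b i)\<^sup>2 * (a j)\<^sup>2)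
      - 2 * (\<Sum>i\<in>I. \<Sum>j\<in>I. (a i * b i) * (a j * b j))"
    by (simp add: power2_eq_square sum_distrib_left algebra_simps flip: sum.distrib sum_subtractf)
  also have "\<dots> = 2 * ((\<Sum>i\<in>I. (a i)\<^sup>2) * (\<Sum>i\<in>I. (b i)\<^sup>2)) - 2 * (\<Sum>i\<in>I. a i * b i)\<^sup>2"
    by (simp add: sum_product[symmetric] power2_eq_square[of "sum _ _"])
  finally show ?thesis by simp
qed

lemma capfree_sum:
  assumes "\<And>x. x \<in> A \<Longrightarrow> capfree w (\<xi> x)"
  shows "capfree w (\<lambda>i. \<Sum>x\<in>A. \<xi> x i)"
  unfolding capfree_def
proof (intro allI impI)
  fix w1 c w2 and i j :: "'b list"
  assume "w = w1 @ c # (\<not> c) # w2" "length i = length w1" "length j = length w2"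
  then have "(\<Sum>a\<in>UNIV. \<xi> x (i @ a # a # j)) = 0" if "x \<in> A" for x
    using capfreeD[of w1 c w2 "\<xi> x" i j] assms[OF that] by simp
  then show "(\<Sum>a\<in>UNIV. \<Sum>x\<in>A. \<xi> x (i @ a # a # j)) = 0"
    by (subst sum.swap) simp
qed

lemma capfree_scale: "capfree w \<xi> \<Longrightarrow> capfree w (\<lambda>i. c * \<xi> i)"
  unfolding capfree_def by (simp flip: sum_distrib_left)

lemma capfree_diff: "capfree w \<xi> \<Longrightarrow> capfree w \<eta> \<Longrightarrow> capfree w (\<lambda>i. \<xi> i - \<eta> i)"
  unfolding capfree_def by (simp add: sum_subtractf)

lemma capfree_cnj: "capfree w \<xi> \<Longrightarrow> capfree w (\<lambda>i. cnj (\<xi> i))"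
  unfolding capfree_def by (simp flip: cnj_sum)

lemma capfree_bar:
  assumes "capfree w \<xi>"
  shows "capfree (bar w) (\<lambda>l. \<xi> (rev l))"
  unfolding capfree_def
proof (intro allI impI)
  fix w1 c w2 and i j :: "'a list"
  assume *: "bar w = w1 @ c # (\<not> c) # w2" "length i = length w1" "length j = length w2"
  have "w = bar w2 @ c # (\<not> c) # bar w1"
    using arg_cong[OF *(1), of bar] by simp
  then show "(\<Sum>a\<in>UNIV. \<xi> (rev (i @ a # a # j))) = 0"
    using capfreeD[of "bar w2" c "bar w1" \<xi> "rev j" "rev i"] assms * by simp
qed

context biunitary
begin

lemma U_col':
  "length i = length w \<Longrightarrow> length j = length w \<Longrightarrow>
    (\<Sum>k\<in>ix w. U w k i * star (U w k j)) = (if i = j then 1 else 0)"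
proof (induction w arbitrary: i j)
  case (Cons c w)
  then obtain a i0 b j0 where ij: "i = a # i0" "j = b # j0" "length i0 = length w" "length j0 = length w"
    by (metis length_Suc_conv)
  have "(\<Sum>k\<in>ix (c # w). U (c # w) k i * star (U (c # w) k j)) =
      (\<Sum>e\<in>UNIV. V c e a * (\<Sum>k\<in>ix w. U w k i0 * star (U w k j0)) * V (\<not> c) e b)"
    unfolding length_Cons sum_idx_Suc
    by (simp add: ij star_mult sum_distrib_left sum_distrib_right mult.assoc)
  also have "\<dots> = (if i = j then 1 else 0)"
    using Cons.IH[OF ij(3,4)] col[of c a b] ij by auto
  finally show ?case .
qed simp

lemma U_col:
  assumes "length i = length w" "length j = length w"
  shows "(\<Sum>k\<in>ix w. star (U w k i) * U w k j) = (if i = j then 1 else 0)"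
proof -
  have "(\<Sum>k\<in>ix w. star (U w k i) * U w k j) =
      (\<Sum>k\<in>ix w. U (bar w) (rev k) (rev i) * star (U (bar w) (rev k) (rev j)))"
    using assms by (intro sum.cong refl) (simp add: um_bar)
  also have "\<dots> = (\<Sum>k\<in>ix w. U (bar w) k (rev i) * star (U (bar w) k (rev j)))"
    by (rule sum_idx_rev)
  finally show ?thesis using U_col'[of "rev i" "bar w" "rev j"] assms by simp
qed

definition fixed :: "bool list \<Rightarrow> ('n list \<Rightarrow> complex) \<Rightarrow> bool" where
  "fixed w \<xi> \<longleftrightarrow> (\<forall>i. length i = length w \<longrightarrow> (\<Sum>j\<in>ix w. \<xi> j *\<^sub>C U w i j) = \<xi> i *\<^sub>C 1)"

lemma fixedD: "fixed w \<xi> \<Longrightarrow> length i = length w \<Longrightarrow> (\<Sum>j\<in>ix w. \<xi> j *\<^sub>C U w i j) = \<xi> i *\<^sub>C 1"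
  by (simp add: fixed_def)

text \<open>The words whose irreducible corepresentation of the free unitary quantum group acquires an
  invariant vector.\<close>

definition inv_words :: "bool list set" where
  "inv_words = {w. \<exists>\<xi> i. fixed w \<xi> \<and> capfree w \<xi> \<and> length i = length w \<and> \<xi> i \<noteq> 0}"

text \<open>For a unitary matrix, a column vector fixed by it has a fixed conjugate row vector: take
  adjoints and multiply by the coefficients.\<close>

lemma fixed_cnj:
  assumes "fixed w \<xi>" "length l = length w"
  shows "(\<Sum>i\<in>ix w. cnj (\<xi> i) *\<^sub>C U w i l) = cnj (\<xi> l) *\<^sub>C 1"
proof -
  have "(\<Sum>j\<in>ix w. cnj (\<xi> j) *\<^sub>C star (U w i j)) = cnj (\<xi> i) *\<^sub>C 1" if "length i = length w" for i
    using arg_cong[OF fixedD[OF assms(1) that], of star] by (simp add: star_sum star_scaleC)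
  then have "(\<Sum>i\<in>ix w. cnj (\<xi> i) *\<^sub>C U w i l) =
      (\<Sum>i\<in>ix w. (\<Sum>j\<in>ix w. cnj (\<xi> j) *\<^sub>C star (U w i j)) * U w i l)"
    by simp
  also have "\<dots> = (\<Sum>j\<in>ix w. cnj (\<xi> j) *\<^sub>C (\<Sum>i\<in>ix w. star (U w i j) * U w i l))"
    unfolding sum_distrib_right scaleC_sum_right by (subst sum.swap) simp
  also have "\<dots> = (\<Sum>j\<in>ix w. if j = l then cnj (\<xi> j) *\<^sub>C 1 else 0)"
    using assms(2) by (intro sum.cong refl) (simp add: U_col)
  also have "\<dots> = cnj (\<xi> l) *\<^sub>C 1"
    using assms(2) by simp
  finally show ?thesis .
qed

section \<open>Intertwiners, Frobenius reciprocity and Schur's lemma\<close>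

definition hom :: "bool list \<Rightarrow> bool list \<Rightarrow> ('n list \<Rightarrow> 'n list \<Rightarrow> complex) \<Rightarrow> bool" where
  "hom y z A \<longleftrightarrow> (\<forall>k i. length k = length z \<longrightarrow> length i = length y \<longrightarrow>
     (\<Sum>k'\<in>ix z. A k' i *\<^sub>C U z k k') = (\<Sum>i'\<in>ix y. A k i' *\<^sub>C U y i' i))"

lemma homD:
  "hom y z A \<Longrightarrow> length k = length z \<Longrightarrow> length i = length y \<Longrightarrow>
     (\<Sum>k'\<in>ix z. A k' i *\<^sub>C U z k k') = (\<Sum>i'\<in>ix y. A k i' *\<^sub>C U y i' i)"
  by (simp add: hom_def)

lemma hom_jw: "hom w w (jw w)"
  by (simp add: hom_def jw_U_comm)

lemma hom_scale: "hom y z A \<Longrightarrow> hom y z (\<lambda>k i. c * A k i)"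
  unfolding hom_def by (simp flip: complex_vector.scale_scale add: scaleC_sum_right[symmetric] del: scaleC_scaleC)

lemma hom_diff: "hom y z A \<Longrightarrow> hom y z B \<Longrightarrow> hom y z (\<lambda>k i. A k i - B k i)"
  unfolding hom_def by (simp add: complex_vector.scale_left_diff_distrib sum_subtractf)

lemma hom_comp:
  assumes A: "hom x y A" and B: "hom y z B"
  shows "hom x z (\<lambda>k i. \<Sum>j\<in>ix y. B k j * A j i)"
  unfolding hom_def
proof (intro allI impI)
  fix k i :: "'n list" assume k: "length k = length z" and i: "length i = length x"
  have "(\<Sum>k'\<in>ix z. (\<Sum>j\<in>ix y. B k' j * A j i) *\<^sub>C U z k k') =
      (\<Sum>j\<in>ix y. A j i *\<^sub>C (\<Sum>k'\<in>ix z. B k' j *\<^sub>C U z k k'))"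
    unfolding scaleC_sum_left scaleC_sum_right
    by (subst sum.swap) (simp add: mult.commute)
  also have "\<dots> = (\<Sum>j\<in>ix y. A j i *\<^sub>C (\<Sum>j'\<in>ix y. B k j' *\<^sub>C U y j' j))"
    using k by (intro sum.cong refl) (simp add: homD[OF B])
  also have "\<dots> = (\<Sum>j\<in>ix y. B k j *\<^sub>C (\<Sum>j'\<in>ix y. A j' i *\<^sub>C U y j j'))"
    unfolding scaleC_sum_right by (subst sum.swap) (simp add: mult.commute)
  also have "\<dots> = (\<Sum>j\<in>ix y. B k j *\<^sub>C (\<Sum>i'\<in>ix x. A j i' *\<^sub>C U x i' i))"
    using i by (intro sum.cong refl) (simp add: homD[OF A])
  also have "\<dots> = (\<Sum>i'\<in>ix x. (\<Sum>j\<in>ix y. B k j * A j i') *\<^sub>C U x i' i)"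
    unfolding scaleC_sum_left scaleC_sum_right by (subst sum.swap) simp
  finally show "(\<Sum>k'\<in>ix z. (\<Sum>j\<in>ix y. B k' j * A j i) *\<^sub>C U z k k') =
      (\<Sum>i'\<in>ix x. (\<Sum>j\<in>ix y. B k j * A j i') *\<^sub>C U x i' i)" .
qed

text \<open>Frobenius reciprocity: the source of an operator is bent over to become the front part
  of a vector. Its index is reversed since \<open>bar\<close> reverses the word.\<close>

definition bend :: "bool list \<Rightarrow> ('n list \<Rightarrow> 'n list \<Rightarrow> complex) \<Rightarrow> 'n list \<Rightarrow> complex" where
  "bend y A l = A (drop (length y) l) (rev (take (length y) l))"

lemma bend_append [simp]: "length i = length y \<Longrightarrow> bend y A (i @ k) = A k (rev i)"
  by (simp add: bend_def)

lemma fixed_bend: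
  assumes A: "hom y z A"
  shows "fixed (bar y @ z) (bend y A)"
  unfolding fixed_def
proof (intro allI impI)
  fix l :: "'n list" assume l: "length l = length (bar y @ z)"
  define i k where "i = rev (take (length y) l)" and "k = drop (length y) l"
  have ik: "l = rev i @ k" "length i = length y" "length k = length z"
    using l by (simp_all add: i_def k_def)
  have "(\<Sum>j\<in>ix (bar y @ z). bend y A j *\<^sub>C U (bar y @ z) l j) =
      (\<Sum>i'\<in>ix y. \<Sum>k'\<in>ix z. A k' (rev i') *\<^sub>C (star (U y i (rev i')) * U z k k'))"
    using ik by (simp add: sum_idx_add um_append um_bar)
  also have "\<dots> = (\<Sum>i'\<in>ix y. star (U y i i') * (\<Sum>k'\<in>ix z. A k' i' *\<^sub>C U z k k'))"
    by (subst sum_idx_rev[where f = "\<lambda>i'. \<Sum>k'\<in>ix z. A k' i' *\<^sub>C (star (U y i i') * U z k k')"])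
      (simp add: sum_distrib_left)
  also have "\<dots> = (\<Sum>i'\<in>ix y. star (U y i i') * (\<Sum>i''\<in>ix y. A k i'' *\<^sub>C U y i'' i'))"
    using ik by (intro sum.cong refl) (simp add: homD[OF A])
  also have "\<dots> = (\<Sum>i''\<in>ix y. A k i'' *\<^sub>C (\<Sum>i'\<in>ix y. star (U y i i') * U y i'' i'))"
    unfolding sum_distrib_left scaleC_sum_right by (subst sum.swap) simp
  also have "\<dots> = (\<Sum>i''\<in>ix y. if i = i'' then A k i'' *\<^sub>C 1 else 0)"
    using ik by (intro sum.cong refl) (simp add: U_row')
  also have "\<dots> = bend y A l *\<^sub>C 1"
    using ik by simp
  finally show "(\<Sum>j\<in>ix (bar y @ z). bend y A j *\<^sub>C U (bar y @ z) l j) = bend y A l *\<^sub>C 1" .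
qed

text \<open>The strand is closed by a cup and a cap, both invariant. In coordinates
  \<open>col_mult\<close> inserts the conjugate letter, the intertwiner relation carries the letter
  across, and \<open>row_mult\<close> removes the pair. Because \<open>u\<close> and its conjugate
  are both unitary, the trace is the plain sum over the letter.\<close>

lemma hom_partial_trace:
  assumes A: "hom (c # y) (c # z) A"
  shows "hom y z (\<lambda>k i. \<Sum>a\<in>UNIV. A (a # k) (a # i))"
  unfolding hom_def
proof (intro allI impI)
  fix k i :: "'n list" assume k: "length k = length z" and i: "length i = length y"
  have eq: "(\<Sum>e\<in>UNIV. V c a e * (\<Sum>k'\<in>ix z. A (e # k') (b # i) *\<^sub>C U z k k')) =
      (\<Sum>e\<in>UNIV. V c e b * (\<Sum>i'\<in>ix y. A (a # k) (e # i') *\<^sub>C U y i' i))" for a b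
    using homD[OF A, of "a # k" "b # i"] k i by (simp add: sum_idx_Suc sum_distrib_left)
  have *: "(\<Sum>k'\<in>ix z. A (b # k') (b # i) *\<^sub>C U z k k') =
      (\<Sum>a\<in>UNIV. \<Sum>e\<in>UNIV. V (\<not> c) a b * (V c e b * (\<Sum>i'\<in>ix y. A (a # k) (e # i') *\<^sub>C U y i' i)))" for b
  proof -
    have "(\<Sum>k'\<in>ix z. A (b # k') (b # i) *\<^sub>C U z k k') =
      (\<Sum>e\<in>UNIV. if b = e then (\<Sum>k'\<in>ix z. A (e # k') (b # i) *\<^sub>C U z k k') else 0)" by simp
    also have "\<dots> = (\<Sum>e\<in>UNIV. \<Sum>a\<in>UNIV. V (\<not> c) a b * (V (\<not> \<not> c) a e * (\<Sum>k'\<in>ix z. A (e # k') (b # i) *\<^sub>C U z k k')))"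
      unfolding col_mult ..
    also have "\<dots> = (\<Sum>a\<in>UNIV. V (\<not> c) a b * (\<Sum>e\<in>UNIV. V c a e * (\<Sum>k'\<in>ix z. A (e # k') (b # i) *\<^sub>C U z k k')))"
      by (subst sum.swap) (simp only: sum_distrib_left not_not)
    finally show ?thesis unfolding eq unfolding sum_distrib_left[of "V (\<not> c) _ b"] .
  qed
  have "(\<Sum>k'\<in>ix z. (\<Sum>a\<in>UNIV. A (a # k') (a # i)) *\<^sub>C U z k k') =
      (\<Sum>b\<in>UNIV. \<Sum>k'\<in>ix z. A (b # k') (b # i) *\<^sub>C U z k k')"
    unfolding scaleC_sum_left by (rule sum.swap)
  also have "\<dots> = (\<Sum>a\<in>UNIV. \<Sum>e\<in>UNIV. \<Sum>b\<in>UNIV. V (\<not> c) a b * (V c e b * (\<Sum>i'\<in>ix y. A (a # k) (e # i') *\<^sub>C U y i' i)))"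
    unfolding * by (rule sum_rot3)
  also have "\<dots> = (\<Sum>a\<in>UNIV. \<Sum>e\<in>UNIV. if a = e then (\<Sum>i'\<in>ix y. A (a # k) (e # i') *\<^sub>C U y i' i) else 0)"
    using row_mult[of "\<not> c"] by simp
  also have "\<dots> = (\<Sum>i'\<in>ix y. (\<Sum>a\<in>UNIV. A (a # k) (a # i')) *\<^sub>C U y i' i)"
    unfolding scaleC_sum_left by (subst (2) sum.swap) simp
  finally show "(\<Sum>k'\<in>ix z. (\<Sum>a\<in>UNIV. A (a # k') (a # i)) *\<^sub>C U z k k') =
      (\<Sum>i'\<in>ix y. (\<Sum>a\<in>UNIV. A (a # k) (a # i')) *\<^sub>C U y i' i)" .
qed

text \<open>Partial traces over the first letters are again intertwiners, and an intertwiner with vanishing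
  partial trace bends to a cap-free invariant vector.  Where no such vectors exist, an intertwiner
  between the cap-free parts is therefore determined by its iterated partial trace.\<close>

lemma schur:
  assumes "hom y z A"
    and "\<And>i. length i = length y \<Longrightarrow> capfree z (\<lambda>k. A k i)"
    and "\<And>k. length k = length z \<Longrightarrow> capfree y (\<lambda>i. A k i)"
    and "\<And>p s t. y = p @ s \<Longrightarrow> z = p @ t \<Longrightarrow> (s, t) \<noteq> ([], []) \<Longrightarrow> bar s @ t \<notin> inv_words"
  shows "\<exists>\<mu>. \<forall>k i. length k = length z \<longrightarrow> length i = length y \<longrightarrow>
    A k i = (if y = z then \<mu> * jw y k i else 0)"
  using assms
proof (induction y arbitrary: z A)
  case Nil
  show ?case
  proof (cases z)
    case Nil
    then show ?thesis by (intro exI[of _ "A [] []"]) simp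
  next
    case (Cons d z')
    have "A k [] = 0" if k: "length k = length z" for k
    proof (rule ccontr)
      assume "A k [] \<noteq> 0"
      moreover have "capfree z (bend [] A)" "fixed z (bend [] A)"
        using Nil(2)[of "[]"] fixed_bend[OF Nil(1)] by (simp_all add: bend_def[abs_def])
      ultimately have "z \<in> inv_words" unfolding inv_words_def using k by (auto simp: bend_def intro!: exI[of _ "bend [] A"] exI[of _ k])
      then show False using Nil(4)[of "[]" "[]" z] Cons by simp
    qed
    then show ?thesis using Cons by auto
  qed
next
  case (Cons c y z A)
  \<comment> \<open>The vector bent from \<open>B\<close> lives on \<open>bar (c # y) @ z\<close>,
    and \<open>cap\<close> controls the one cap across the fold, which exists only when
    \<open>z\<close> starts with \<open>c\<close>. A nonzero entry would put this word into
    \<open>inv_words\<close>, against the case \<open>p = []\<close> of the last premise.\<close>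
  have zero: "B k i = 0"
    if B: "hom (c # y) z B" "\<And>i. length i = Suc (length y) \<Longrightarrow> capfree z (\<lambda>k. B k i)"
        "\<And>k. length k = length z \<Longrightarrow> capfree (c # y) (\<lambda>i. B k i)"
      and cap: "\<And>j k. z \<noteq> [] \<Longrightarrow> hd z = c \<Longrightarrow> length j = length y \<Longrightarrow> Suc (length k) = length z \<Longrightarrow>
        (\<Sum>a\<in>UNIV. B (a # k) (a # j)) = 0"
      and k: "length k = length z" and i: "length i = Suc (length y)" for B k i
  proof (rule ccontr)
    assume nz: "B k i \<noteq> 0"
    have "capfree (bar (c # y) @ z) (bend (c # y) B)"
    proof (rule capfree_append)
      fix j :: "'n list" assume "length j = length z"
      then have "capfree (bar (c # y)) (\<lambda>l. B j (rev l))" by (intro capfree_bar B(3))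
      then show "capfree (bar (c # y)) (\<lambda>i. bend (c # y) B (i @ j))"
        by (rule capfree_cong) simp
    next
      fix i :: "'n list" assume i: "length i = length (bar (c # y))"
      then have "capfree z (\<lambda>k. B k (rev i))" by (intro B(2)) simp
      then show "capfree z (\<lambda>j. bend (c # y) B (i @ j))"
        by (rule capfree_cong) (use i in simp)
    next
      fix i j :: "'n list"
      assume "bar (c # y) \<noteq> []" "z \<noteq> []" "last (bar (c # y)) \<noteq> hd z"
        and ij: "Suc (length i) = length (bar (c # y))" "Suc (length j) = length z"
      then have "(\<Sum>a\<in>UNIV. B (a # j) (a # rev i)) = 0"
        by (intro cap) auto
      moreover have "bend (c # y) B (i @ a # a # j) = B (a # j) (a # rev i)" for a
        using bend_append[of "i @ [a]" "c # y" B "a # j"] ij by simp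
      ultimately show "(\<Sum>a\<in>UNIV. bend (c # y) B (i @ a # a # j)) = 0" by simp
    qed
    then have "bar (c # y) @ z \<in> inv_words"
      unfolding inv_words_def using fixed_bend[OF B(1)] nz k i
      by (auto intro!: exI[of _ "bend (c # y) B"] exI[of _ "rev i @ k"])
    then show False using Cons.prems(4)[of "[]" "c # y" z] by simp
  qed
  show ?case
  proof (cases "z \<noteq> [] \<and> hd z = c")
    case False
    then have "A k i = 0" if "length k = length z" "length i = Suc (length y)" for k i
      using zero[OF Cons.prems(1) _ _ _ that] Cons.prems(2,3) by auto
    then show ?thesis using False by (intro exI[of _ 0]) auto
  next
    case True
    then obtain z' where z: "z = c # z'" by (cases z) auto
    define B where "B = (\<lambda>k i. \<Sum>a\<in>UNIV. A (a # k) (a # i))"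
    have B: "hom y z' B"
      unfolding B_def using Cons.prems(1) by (intro hom_partial_trace) (simp add: z)
    have "\<exists>\<mu>. \<forall>k i. length k = length z' \<longrightarrow> length i = length y \<longrightarrow> B k i = (if y = z' then \<mu> * jw y k i else 0)"
    proof (rule Cons.IH[OF B])
      show "capfree z' (\<lambda>k. B k i)" if "length i = length y" for i
        unfolding B_def using that Cons.prems(2) z by (intro capfree_sum capfree_tail[of c]) auto
      show "capfree y (\<lambda>i. B k i)" if "length k = length z'" for k
        unfolding B_def using that Cons.prems(3) z by (intro capfree_sum capfree_tail[of c]) auto
      show "bar s @ t \<notin> inv_words" if "y = p @ s" "z' = p @ t" "(s, t) \<noteq> ([], [])" for p s t
        using Cons.prems(4)[of "c # p" s t] that z by simp
    qed
    then obtain \<mu> where \<mu>: "\<And>k i. length k = length z' \<Longrightarrow> length i = length y \<Longrightarrow>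
        B k i = (if y = z' then \<mu> * jw y k i else 0)" by blast
    show ?thesis
    proof (cases "y = z'")
      case False
      then have "A k i = 0" if "length k = length z" "length i = Suc (length y)" for k i
        using zero[OF Cons.prems(1) _ _ _ that] Cons.prems(2,3) \<mu> z by (simp add: B_def)
      then show ?thesis using False z by (intro exI[of _ 0]) auto
    next
      case True
      define \<kappa> :: complex where "\<kappa> = of_real (kap TYPE('n) (c # y))"
      have \<kappa>: "\<kappa> \<noteq> 0" using kap_ge_1[OF N2, of "c # y"] by (simp add: \<kappa>_def)
      \<comment> \<open>The multiple of \<open>jw (c # y)\<close> is chosen to cancel the partial
        trace: closing its first strand gives \<open>\<kappa> * jw y\<close>.\<close>
      define A' where "A' = (\<lambda>k i. A k i - \<mu> / \<kappa> * jw (c # y) k i)"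
      have "A' k i = 0" if ki: "length k = length z" "length i = Suc (length y)" for k i
      proof (rule zero[OF _ _ _ _ ki])
        show "hom (c # y) z A'"
          unfolding A'_def using Cons.prems(1) hom_jw[of "c # y"] z True by (intro hom_diff hom_scale) auto
        show "capfree z (\<lambda>k. A' k i)" if "length i = Suc (length y)" for i
          unfolding A'_def using that Cons.prems(2) z True capfree_jw[OF N2, of i "c # y"]
          by (intro capfree_diff capfree_scale) auto
        show "capfree (c # y) (\<lambda>i. A' k i)" if "length k = length z" for k
          unfolding A'_def jw_sym[of "c # y" k] using that Cons.prems(3) z True capfree_jw[OF N2, of k "c # y"]
          by (intro capfree_diff capfree_scale) auto
        show "(\<Sum>a\<in>UNIV. A' (a # k) (a # j)) = 0" if "length j = length y" "Suc (length k) = length z" for j k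
        proof -
          have "(\<Sum>a\<in>UNIV. A' (a # k) (a # j)) = B k j - \<mu> / \<kappa> * (\<Sum>a\<in>UNIV. jw (c # y) (a # k) (a # j))"
            by (simp only: A'_def B_def sum_subtractf sum_distrib_left)
          also have "(\<Sum>a\<in>UNIV. jw (c # y) (a # k) (a # j)) = \<kappa> * jw y k j"
            using that z True by (simp add: jw_partial_trace[OF N2] \<kappa>_def)
          finally show ?thesis using \<mu>[of k j] that z True \<kappa> by simp
        qed
      qed
      then show ?thesis using True z by (intro exI[of _ "\<mu> / \<kappa>"]) (simp add: A'_def)
    qed
  qed
qed

text \<open>Otherwise Schur's lemma applies to endomorphisms of the cap-free space of
  \<open>x\<close>, and the rank-one operator built from an invariant vector would be a multiple of
  \<open>jw x\<close>. That forces dimension one, which a nonempty word never has.\<close>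

lemma inv_words_suffix:
  assumes "x \<in> inv_words" "x \<noteq> []"
  shows "\<exists>s. s \<noteq> [] \<and> bar s @ s \<in> inv_words"
proof (rule ccontr)
  assume none: "\<not> ?thesis"
  obtain \<xi> i0 where \<xi>: "fixed x \<xi>" "capfree x \<xi>" "length i0 = length x" "\<xi> i0 \<noteq> 0"
    using assms(1) by (auto simp: inv_words_def)
  define A where "A = (\<lambda>k i. \<xi> k * cnj (\<xi> i))"
  have "hom x x A"
    unfolding hom_def A_def
  proof (intro allI impI)
    fix k i :: "'n list" assume k: "length k = length x" "length i = length x"
    have "(\<Sum>k'\<in>ix x. (\<xi> k' * cnj (\<xi> i)) *\<^sub>C U x k k') = cnj (\<xi> i) *\<^sub>C (\<xi> k *\<^sub>C 1)"
      unfolding fixedD[OF \<xi>(1) k(1), symmetric] scaleC_sum_right by (simp add: mult.commute)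
    also have "\<dots> = \<xi> k *\<^sub>C (cnj (\<xi> i) *\<^sub>C 1)" by (simp add: mult.commute)
    also have "\<dots> = (\<Sum>i'\<in>ix x. (\<xi> k * cnj (\<xi> i')) *\<^sub>C U x i' i)"
      unfolding fixed_cnj[OF \<xi>(1) k(2), symmetric] scaleC_sum_right by simp
    finally show "(\<Sum>k'\<in>ix x. (\<xi> k' * cnj (\<xi> i)) *\<^sub>C U x k k') =
        (\<Sum>i'\<in>ix x. (\<xi> k * cnj (\<xi> i')) *\<^sub>C U x i' i)" .
  qed
  moreover have "capfree x (\<lambda>k. A k i)" for i
    unfolding A_def using capfree_scale[OF \<xi>(2), of "cnj (\<xi> i)"] by (simp add: mult.commute)
  moreover have "capfree x (\<lambda>i. A k i)" for k
    unfolding A_def by (intro capfree_scale capfree_cnj \<xi>)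
  ultimately have "\<exists>\<mu>. \<forall>k i. length k = length x \<longrightarrow> length i = length x \<longrightarrow> A k i = (if x = x then \<mu> * jw x k i else 0)"
    using none by (intro schur) auto
  then obtain \<mu> where \<mu>: "\<And>k i. length k = length x \<Longrightarrow> length i = length x \<Longrightarrow> A k i = \<mu> * jw x k i"
    by auto
  \<comment> \<open>\<open>n\<close> is the squared length of \<open>\<xi>\<close>. Comparing
    \<open>A A = n A\<close> with idempotence of \<open>jw x\<close> gives \<open>n = \<mu>\<close>,
    while comparing traces gives \<open>n\<close> as \<open>\<mu>\<close> times the
    dimension.\<close>
  define n where "n = (\<Sum>i\<in>ix x. \<xi> i * cnj (\<xi> i))"
  have A0: "A i0 i0 \<noteq> 0" using \<xi> by (simp add: A_def)
  have n1: "n = \<mu> * jw_dim TYPE('n) x"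
    unfolding n_def jw_dim_def sum_distrib_left by (intro sum.cong refl) (simp add: \<mu>[symmetric] A_def)
  have "n * A i0 i0 = (\<Sum>i\<in>ix x. A i0 i * A i i0)"
    unfolding n_def A_def sum_distrib_right by (simp add: mult_ac)
  also have "\<dots> = \<mu> * \<mu> * (\<Sum>i\<in>ix x. jw x i0 i * jw x i i0)"
    using \<xi>(3) unfolding sum_distrib_left by (intro sum.cong refl) (simp add: \<mu>)
  also have "\<dots> = \<mu> * A i0 i0" using \<xi>(3) by (simp add: jw_idem[OF N2] \<mu>)
  finally have "n = \<mu>" using A0 by simp
  moreover have "\<mu> \<noteq> 0" using A0 \<mu> \<xi>(3) by auto
  ultimately have "jw_dim TYPE('n) x = 1" using n1 by simp
  moreover obtain r where "r \<ge> 2" "jw_dim TYPE('n) x = of_real r" using jw_dim_ge[OF N2, of x] assms by auto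
  ultimately show False by simp
qed

text \<open>The product of two invariant vectors is invariant, and equal colours at the junction
  admit no new cap.\<close>

lemma inv_words_append:
  assumes x: "x \<in> inv_words" and y: "y \<in> inv_words" and "x \<noteq> [] \<Longrightarrow> y \<noteq> [] \<Longrightarrow> last x = hd y"
  shows "x @ y \<in> inv_words"
proof -
  obtain \<xi> i where \<xi>: "fixed x \<xi>" "capfree x \<xi>" "length i = length x" "\<xi> i \<noteq> 0"
    using x by (auto simp: inv_words_def)
  obtain \<eta> j where \<eta>: "fixed y \<eta>" "capfree y \<eta>" "length j = length y" "\<eta> j \<noteq> 0"
    using y by (auto simp: inv_words_def)
  define \<zeta> where "\<zeta> = (\<lambda>l. \<xi> (take (length x) l) * \<eta> (drop (length x) l))"
  have \<zeta>: "\<zeta> (i @ j) = \<xi> i * \<eta> j" if "length i = length x" for i j using that by (simp add: \<zeta>_def)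
  have "fixed (x @ y) \<zeta>"
    unfolding fixed_def
  proof (intro allI impI)
    fix l :: "'n list" assume l: "length l = length (x @ y)"
    obtain a b where ab: "l = a @ b" "length a = length x" "length b = length y"
      using l by (intro that[of "take (length x) l" "drop (length x) l"]) auto
    have "(\<Sum>j\<in>ix (x @ y). \<zeta> j *\<^sub>C U (x @ y) l j) =
        (\<Sum>i\<in>ix x. \<xi> i *\<^sub>C U x a i) * (\<Sum>j\<in>ix y. \<eta> j *\<^sub>C U y b j)"
      using ab by (simp add: sum_idx_add um_append \<zeta> sum_product mult.commute)
    also have "\<dots> = \<zeta> l *\<^sub>C 1"
      using ab by (simp add: fixedD[OF \<xi>(1)] fixedD[OF \<eta>(1)] \<zeta>)
    finally show "(\<Sum>j\<in>ix (x @ y). \<zeta> j *\<^sub>C U (x @ y) l j) = \<zeta> l *\<^sub>C 1" .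
  qed
  moreover have "capfree (x @ y) \<zeta>"
  proof (rule capfree_append)
    show "capfree x (\<lambda>i. \<zeta> (i @ j))" for j
      using capfree_scale[OF \<xi>(2), of "\<eta> j"] by (rule capfree_cong) (simp add: \<zeta>)
    show "capfree y (\<lambda>j. \<zeta> (i @ j))" if "length i = length x" for i
      using capfree_scale[OF \<eta>(2), of "\<xi> i"] by (rule capfree_cong) (simp add: \<zeta> that)
  qed (use assms in auto)
  ultimately show ?thesis
    unfolding inv_words_def using \<xi>(3,4) \<eta>(3,4) by (auto intro!: exI[of _ \<zeta>] exI[of _ "i @ j"] simp: \<zeta>)
qed

text \<open>The vector is the invariant of \<open>y @ bar y\<close> given by \<open>jw y\<close>,
  with \<open>\<xi>\<close> inserted in the middle. Both junctions are free of caps: on the left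
  \<open>last y = hd x\<close>, and on the right \<open>hd (bar y)\<close> is the opposite of
  \<open>hd x\<close>, hence equals \<open>last x\<close>.\<close>

lemma inv_words_conj:
  assumes x: "x \<in> inv_words" "x \<noteq> []" "last x \<noteq> hd x" and y: "y \<noteq> [] \<Longrightarrow> last y = hd x"
  shows "y @ x @ bar y \<in> inv_words"
proof -
  obtain \<xi> i where \<xi>: "fixed x \<xi>" "capfree x \<xi>" "length i = length x" "\<xi> i \<noteq> 0"
    using x by (auto simp: inv_words_def)
  obtain r where "r \<ge> (if y = [] then 1 else 2)" and r: "jw_dim TYPE('n) y = of_real r"
    using jw_dim_ge[OF N2, of y] by blast
  then have "r \<noteq> 0" by (auto split: if_splits)
  \<comment> \<open>A nonzero trace supplies a nonzero diagonal entry, which will certify that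
    \<open>\<zeta>\<close> is not zero.\<close>
  have "\<exists>k :: 'n list. length k = length y \<and> jw y k k \<noteq> 0"
  proof (rule ccontr)
    assume "\<not> ?thesis"
    then have "jw_dim TYPE('n) y = 0" unfolding jw_dim_def by (intro sum.neutral) auto
    then show False using r \<open>r \<noteq> 0\<close> by simp
  qed
  then obtain k :: "'n list" where k: "length k = length y" "jw y k k \<noteq> 0" by blast
  define \<zeta> where "\<zeta> = (\<lambda>l. jw y (take (length y) l) (rev (drop (length x) (drop (length y) l))) *
     \<xi> (take (length x) (drop (length y) l)))"
  have \<zeta>: "\<zeta> (i @ j @ k) = jw y i (rev k) * \<xi> j" if "length i = length y" "length j = length x" for i j k
    using that by (simp add: \<zeta>_def)
  have "fixed (y @ x @ bar y) \<zeta>"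
    unfolding fixed_def
  proof (intro allI impI)
    fix l :: "'n list" assume l: "length l = length (y @ x @ bar y)"
    obtain a b d where ab: "l = a @ b @ rev d" "length a = length y" "length b = length x" "length d = length y"
      using l by (intro that[of "take (length y) l" "take (length x) (drop (length y) l)" "rev (drop (length x) (drop (length y) l))"])
        (simp only: rev_rev_ident append_take_drop_id, auto)
    have "(\<Sum>m\<in>ix (y @ x @ bar y). \<zeta> m *\<^sub>C U (y @ x @ bar y) l m) =
        (\<Sum>i\<in>ix y. \<Sum>j\<in>ix x. \<Sum>k\<in>ix y.
          (jw y i (rev k) * \<xi> j) *\<^sub>C (U y a i * (U x b j * star (U y d (rev k)))))"
      using ab by (simp add: sum_idx_add um_append um_bar \<zeta>)
    also have "\<dots> = (\<Sum>i\<in>ix y. \<Sum>j\<in>ix x. \<Sum>k\<in>ix y.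
          (jw y i k * \<xi> j) *\<^sub>C (U y a i * (U x b j * star (U y d k))))"
      by (intro sum.cong refl sum_idx_rev[where f = "\<lambda>k. (jw y _ k * \<xi> _) *\<^sub>C (U y a _ * (U x b _ * star (U y d k)))"])
    also have "\<dots> = (\<Sum>i\<in>ix y. \<Sum>k\<in>ix y. \<Sum>j\<in>ix x.
          (jw y i k * \<xi> j) *\<^sub>C (U y a i * (U x b j * star (U y d k))))"
      by (intro sum.cong refl sum.swap)
    also have "\<dots> = (\<Sum>i\<in>ix y. \<Sum>k\<in>ix y.
          jw y i k *\<^sub>C (U y a i * ((\<Sum>j\<in>ix x. \<xi> j *\<^sub>C U x b j) * star (U y d k))))"
      by (simp add: scaleC_sum_right sum_distrib_left sum_distrib_right)
    also have "\<dots> = \<xi> b *\<^sub>C (\<Sum>k\<in>ix y. (\<Sum>i\<in>ix y. jw y i k *\<^sub>C U y a i) * star (U y d k))"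
      unfolding fixedD[OF \<xi>(1) ab(3)] sum_distrib_right scaleC_sum_right
      by (subst sum.swap) (simp add: mult.commute)
    also have "\<dots> = \<xi> b *\<^sub>C (\<Sum>k\<in>ix y. (\<Sum>i\<in>ix y. jw y a i *\<^sub>C U y i k) * star (U y d k))"
      using ab by (simp add: jw_U_comm)
    also have "\<dots> = \<xi> b *\<^sub>C (\<Sum>i\<in>ix y. jw y a i *\<^sub>C (\<Sum>k\<in>ix y. U y i k * star (U y d k)))"
      unfolding sum_distrib_right scaleC_sum_right by (subst sum.swap) simp
    also have "\<dots> = \<xi> b *\<^sub>C (\<Sum>i\<in>ix y. if i = d then jw y a i *\<^sub>C 1 else 0)"
      using ab by (intro arg_cong2[where f = scaleC] sum.cong refl) (simp add: U_row)
    also have "\<dots> = \<zeta> l *\<^sub>C 1"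
      using ab by (simp add: \<zeta> mult.commute)
    finally show "(\<Sum>m\<in>ix (y @ x @ bar y). \<zeta> m *\<^sub>C U (y @ x @ bar y) l m) = \<zeta> l *\<^sub>C 1" .
  qed
  moreover have "capfree (y @ x @ bar y) \<zeta>"
  proof (rule capfree_append)
    fix m :: "'n list" assume m: "length m = length (x @ bar y)"
    obtain b d where bd: "m = b @ d" "length b = length x" "length d = length y"
      using m by (intro that[of "take (length x) m" "drop (length x) m"]) auto
    have "capfree y (\<lambda>i. \<xi> b * jw y i (rev d))"
      using bd by (intro capfree_scale capfree_jw N2) simp
    then show "capfree y (\<lambda>i. \<zeta> (i @ m))"
      by (rule capfree_cong) (simp add: bd \<zeta>)
  next
    fix a :: "'n list" assume a: "length a = length y"
    show "capfree (x @ bar y) (\<lambda>j. \<zeta> (a @ j))"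
    proof (rule capfree_append)
      fix d :: "'n list"
      have "capfree x (\<lambda>b. jw y a (rev d) * \<xi> b)"
        by (intro capfree_scale \<xi>)
      then show "capfree x (\<lambda>b. \<zeta> (a @ b @ d))"
        by (rule capfree_cong) (simp add: \<zeta> a)
    next
      fix b :: "'n list" assume b: "length b = length x"
      have "capfree (bar y) (\<lambda>d. \<xi> b * jw y (rev d) a)"
        using a by (intro capfree_scale capfree_bar[where \<xi> = "\<lambda>d. jw y d a"] capfree_jw N2)
      then show "capfree (bar y) (\<lambda>d. \<zeta> (a @ b @ d))"
        by (rule capfree_cong) (simp add: \<zeta> a b jw_sym[of y _ a])
    qed (use x y in \<open>auto simp: hd_bar\<close>)
  qed (use x y in auto)
  ultimately show ?thesis
    unfolding inv_words_def using k \<xi>(3,4)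
    by (auto intro!: exI[of _ \<zeta>] exI[of _ "k @ i @ rev k"] simp: \<zeta>)
qed

end

section \<open>Growth of the set of words with invariant vectors\<close>

definition fold_word :: "bool list \<Rightarrow> bool list" where
  "fold_word g = g @ bar g"

lemma length_fold_word [simp]: "length (fold_word g) = 2 * length g"
  by (simp add: fold_word_def)

lemma fold_word_nth:
  assumes "i < length g"
  shows "fold_word g ! i = g ! i" "fold_word g ! (2 * length g - 1 - i) = (\<not> g ! i)"
proof -
  show "fold_word g ! i = g ! i" using assms by (simp add: fold_word_def nth_append)
  have "2 * length g - 1 - i = length g + (length g - 1 - i)" using assms by simp
  then have "fold_word g ! (2 * length g - 1 - i) = bar g ! (length g - 1 - i)"
    by (simp only: fold_word_def nth_append_length_plus)
  then show "fold_word g ! (2 * length g - 1 - i) = (\<not> g ! i)"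
    using assms by (simp add: bar_def rev_nth)
qed

text \<open>If \<open>fold_word g\<close> is a prefix of \<open>fold_word g'\<close>, composing the two reflections gives a
  translation, so \<open>g'\<close> is periodic.\<close>

lemma fold_word_prefix_periodic:
  assumes pre: "take (2 * length g) (fold_word g') = fold_word g" and len: "length g' = length g + d"
    and "i + 2 * d < length g'"
  shows "g' ! i = g' ! (i + 2 * d)"
proof -
  have nth: "fold_word g' ! m = fold_word g ! m" if "m < 2 * length g" for m
    using that by (simp flip: pre)
  have "(\<not> g' ! (i + 2 * d)) = fold_word g' ! (2 * length g' - 1 - (i + 2 * d))"
    using fold_word_nth(2)[OF assms(3)] by simp
  also have "2 * length g' - 1 - (i + 2 * d) = 2 * length g - 1 - i"
    using len by simp
  also have "fold_word g' ! (2 * length g - 1 - i) = fold_word g ! (2 * length g - 1 - i)"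
    using assms(3) len by (intro nth) linarith
  also have "\<dots> = (\<not> fold_word g ! i)"
    using assms(3) len fold_word_nth[of i g] by simp
  also have "fold_word g ! i = g' ! i"
    using assms(3) len nth[of i] by (simp add: fold_word_nth)
  finally show ?thesis by simp
qed

text \<open>The prefix of length \<open>2 * d\<close> determines such a word, and it allows at most
  \<open>4 ^ d\<close> choices.\<close>

lemma card_periodic_le:
  assumes "d \<noteq> 0"
  shows "card {g :: bool list. length g = j \<and> (\<forall>i. i + 2 * d < j \<longrightarrow> g ! i = g ! (i + 2 * d))} \<le> 4 ^ d"
    (is "card ?A \<le> _")
proof -
  have "inj_on (take (2 * d)) ?A"
  proof (rule inj_onI)
    fix g h assume g: "g \<in> ?A" and h: "h \<in> ?A" and eq: "take (2 * d) g = take (2 * d) h"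
    have "g ! i = h ! i" if "i < j" for i
      using that
    proof (induction i rule: less_induct)
      case (less i)
      show ?case
      proof (cases "i < 2 * d")
        case True
        then show ?thesis using arg_cong[OF eq, of "\<lambda>l. l ! i"] by simp
      next
        case F: False
        then have "g ! (i - 2 * d) = g ! i" "h ! (i - 2 * d) = h ! i"
          using g h less.prems by (auto dest!: spec[of _ "i - 2 * d"])
        moreover have "g ! (i - 2 * d) = h ! (i - 2 * d)"
          using F assms less.prems by (intro less.IH) auto
        ultimately show ?thesis by simp
      qed
    qed
    then show "g = h" using g h by (intro nth_equalityI) auto
  qed
  moreover have "take (2 * d) ` ?A \<subseteq> idx (min j (2 * d))" by auto
  ultimately have "card ?A \<le> card (idx (min j (2 * d)) :: bool list set)"
    by (rule card_inj_on_le) simp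
  also have "\<dots> \<le> 2 ^ (2 * d)" by (simp add: card_idx)
  finally show ?thesis by (simp add: power_mult)
qed

text \<open>The excluded periods are those that \<open>fold_word_prefix_periodic\<close> produces
  when the lengths of the two halves differ by at most \<open>K\<close>.\<close>

definition aperiodic :: "nat \<Rightarrow> bool list \<Rightarrow> bool" where
  "aperiodic K g \<longleftrightarrow> (\<forall>d\<in>{1..K}. \<exists>i. i + 2 * d < length g \<and> g ! i \<noteq> g ! (i + 2 * d))"

text \<open>The first letter \<open>b\<close> settles the colours at both ends of the fold word; the
  suffix \<open>s\<close> is what places the fold word in the set to be counted. \<open>K\<close> is
  the spread of lengths within which the fold words form a prefix code.\<close>

definition code_words :: "nat \<Rightarrow> bool list \<Rightarrow> bool \<Rightarrow> nat \<Rightarrow> bool list set" where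
  "code_words K s b j = {g. length g = j \<and> g \<noteq> [] \<and> hd g = b \<and> (\<exists>y. g = y @ s) \<and> aperiodic K g}"

text \<open>Of the \<open>2 ^ (j - 1 - length s)\<close> words \<open>b # y @ s\<close>, the
  periodic ones number at most \<open>2 * 4 ^ K\<close>, by a geometric sum. The lower bound on
  \<open>j\<close> makes this at most one half, at the cost of one more bit in the exponent.\<close>

lemma card_code_words:
  assumes "j \<ge> 2 * K + length s + 4"
  shows "card (code_words K s b j) \<ge> 2 ^ (j - 2 - length s)"
proof -
  define m where "m = j - 1 - length s"
  let ?A = "(\<lambda>y. b # y @ s) ` idx m"
  let ?P = "\<lambda>d. {g :: bool list. length g = j \<and> (\<forall>i. i + 2 * d < j \<longrightarrow> g ! i = g ! (i + 2 * d))}"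
  have finP: "finite (?P d)" for d
    by (rule finite_subset[of _ "idx j"]) auto
  have "?A \<subseteq> code_words K s b j \<union> (\<Union>d\<in>{1..K}. ?P d)"
  proof
    fix g assume "g \<in> ?A"
    then obtain y where y: "g = b # y @ s" "length y = m" by auto
    then have len: "length g = j" using assms by (simp add: m_def)
    show "g \<in> code_words K s b j \<union> (\<Union>d\<in>{1..K}. ?P d)"
    proof (cases "aperiodic K g")
      case True
      then show ?thesis using y len by (auto simp: code_words_def intro!: exI[of _ "b # y"])
    next
      case False
      then show ?thesis using len by (auto simp: aperiodic_def)
    qed
  qed
  moreover have fin: "finite (code_words K s b j)"
    by (rule finite_subset[of _ "idx j"]) (auto simp: code_words_def)
  ultimately have "card ?A \<le> card (code_words K s b j \<union> (\<Union>d\<in>{1..K}. ?P d))"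
    by (intro card_mono) (auto simp: finP)
  also have "\<dots> \<le> card (code_words K s b j) + card (\<Union>d\<in>{1..K}. ?P d)"
    by (rule card_Un_le)
  also have "card (\<Union>d\<in>{1..K}. ?P d) \<le> (\<Sum>d\<in>{1..K}. card (?P d))"
    by (rule card_UN_le) simp
  also have "\<dots> \<le> (\<Sum>d\<in>{1..K}. 4 ^ d)"
    by (intro sum_mono card_periodic_le) simp
  also have "\<dots> \<le> 2 * 4 ^ K"
  proof (induction K)
    case (Suc K)
    then show ?case by simp
  qed simp
  also have "card ?A = 2 ^ m"
    by (subst card_image) (auto simp: inj_on_def card_idx)
  finally have *: "2 ^ m \<le> card (code_words K s b j) + 2 * 4 ^ K" by simp
  have "2 * 4 ^ K = (2::nat) ^ (2 * K + 1)" by (simp add: power_mult)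
  also have "\<dots> \<le> 2 ^ (j - 2 - length s)" using assms by (intro power_increasing) auto
  finally have **: "2 * 4 ^ K \<le> (2::nat) ^ (j - 2 - length s)" .
  have "m = Suc (j - 2 - length s)" using assms by (simp add: m_def)
  then have "(2::nat) ^ m = 2 ^ (j - 2 - length s) + 2 ^ (j - 2 - length s)" by simp
  then show ?thesis using * ** by linarith
qed

text \<open>Of two fold words that begin a common word, one is a prefix of the other. Unequal
  lengths would make the longer half periodic with an excluded period.\<close>

lemma code_words_inj:
  assumes g: "g \<in> code_words K s b j" and h: "h \<in> code_words K s b' j'"
    and eq: "fold_word g @ u = fold_word h @ v" and "j \<le> j' + K" "j' \<le> j + K"
  shows "g = h"
proof -
  have step: "\<not> j < j'" if g: "g \<in> code_words K s b j" and h: "h \<in> code_words K s b' j'"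
    and eq: "fold_word g @ u = fold_word h @ v" and le: "j' \<le> j + K" for g h b b' j j' u v
  proof
    assume lt: "j < j'"
    have len: "length g = j" "length h = j'" using g h by (auto simp: code_words_def)
    have "take (2 * j) (fold_word h @ v) = fold_word g"
      by (simp add: len flip: eq)
    then have pre: "take (2 * length g) (fold_word h) = fold_word g"
      using len lt by simp
    have "aperiodic K h" using h by (simp add: code_words_def)
    moreover have "j' - j \<in> {1..K}" using le lt by auto
    ultimately obtain i where i: "i + 2 * (j' - j) < length h" "h ! i \<noteq> h ! (i + 2 * (j' - j))"
      unfolding aperiodic_def by blast
    moreover have "length h = length g + (j' - j)" using len lt by simp
    ultimately show False using fold_word_prefix_periodic[OF pre] by blast
  qed
  have "\<not> j < j'" "\<not> j' < j"
    using step[OF g h eq] step[OF h g eq[symmetric]] assms(4,5) by auto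
  then have "length g = length h" using g h by (simp add: code_words_def)
  then show ?thesis using eq by (simp add: fold_word_def)
qed

text \<open>Each product of three fold words has half-length \<open>e\<close>, and two of the three
  half-lengths vary freely over \<open>k + 1\<close> values each. The gain is quadratic in
  \<open>k\<close>, whereas \<open>e\<close> is linear in \<open>k\<close>.\<close>

lemma growth:
  fixes S :: "bool list set"
  assumes app: "\<And>x y. x \<in> S \<Longrightarrow> y \<in> S \<Longrightarrow> x \<noteq> [] \<Longrightarrow> y \<noteq> [] \<Longrightarrow> last x = hd y \<Longrightarrow> x @ y \<in> S"
    and fam: "\<And>y. fold_word (y @ s) \<in> S"
  shows "\<exists>e. card {x \<in> S. length x = 2 * e} > (2 * e + 2) * 2 ^ e"
proof -
  define t where "t = length s"
  \<comment> \<open>A factor loses \<open>2 + t\<close> bits in \<open>card_code_words\<close>;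
    \<open>M\<close> collects the loss of three factors.\<close>
  define M :: nat where "M = 2 ^ (6 + 3 * t)"
  \<comment> \<open>Since \<open>e = 14 * k + 3 * t + 12\<close>, the aim is
    \<open>(28 * k + 6 * t + 26) * M < (k + 1)\<^sup>2\<close>; the number 54 is 28 + 26.\<close>
  define k where "k = M * (6 * t + 54)"
  \<comment> \<open>Half-lengths range from \<open>J\<close> to \<open>J + 2 * k\<close>, so the
    code needs \<open>K = 2 * k\<close>, and \<open>J\<close> is the least length that
    \<open>card_code_words\<close> admits for it.\<close>
  define J where "J = 2 * (2 * k) + t + 4"
  define e where "e = 3 * J + 2 * k"
  define G where "G = code_words (2 * k) s"
  \<comment> \<open>A fold word ends with the opposite of its first letter, so the first letters of
    consecutive factors alternate. The third half-length is forced by the total.\<close>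
  define D where "D = (SIGMA p : {0..k} \<times> {0..k}. G True (J + fst p) \<times> G False (J + snd p) \<times> G True (J + 2 * k - fst p - snd p))"
  define F where "F = (\<lambda>(p :: nat \<times> nat, g1, g2, g3). fold_word g1 @ fold_word g2 @ fold_word g3)"
  have finG: "finite (G b j)" for b j
    unfolding G_def by (rule finite_subset[of _ "idx j"]) (auto simp: code_words_def)
  have cardG: "card (G b j) \<ge> 2 ^ (j - 2 - t)" if "j \<ge> J" for b j
    unfolding G_def t_def by (rule card_code_words) (use that in \<open>simp add: J_def t_def\<close>)
  have "inj_on F D"
  proof (rule inj_onI)
    fix x x' assume x: "x \<in> D" and x': "x' \<in> D" and eq: "F x = F x'"
    obtain a b g1 g2 g3 where xe: "x = ((a, b), g1, g2, g3)" by (metis prod.exhaust)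
    obtain a' b' g1' g2' g3' where xe': "x' = ((a', b'), g1', g2', g3')" by (metis prod.exhaust)
    have ab: "a \<le> k" "b \<le> k" "a' \<le> k" "b' \<le> k" using x x' by (auto simp: xe xe' D_def)
    have g: "g1 \<in> G True (J + a)" "g2 \<in> G False (J + b)" "g3 \<in> G True (J + 2 * k - a - b)"
      "g1' \<in> G True (J + a')" "g2' \<in> G False (J + b')" "g3' \<in> G True (J + 2 * k - a' - b')"
      using x x' by (auto simp: xe xe' D_def)
    have eq1: "fold_word g1 @ (fold_word g2 @ fold_word g3) = fold_word g1' @ (fold_word g2' @ fold_word g3')"
      using eq by (simp add: F_def xe xe')
    have 1: "g1 = g1'"
      using ab by (intro code_words_inj[OF g(1)[unfolded G_def] g(4)[unfolded G_def] eq1]) auto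
    then have eq2: "fold_word g2 @ fold_word g3 = fold_word g2' @ fold_word g3'" using eq1 by simp
    have 2: "g2 = g2'"
      using ab by (intro code_words_inj[OF g(2)[unfolded G_def] g(5)[unfolded G_def] eq2]) auto
    then have "fold_word g3 @ [] = fold_word g3' @ []" using eq2 by simp
    then have 3: "g3 = g3'"
      using ab by (intro code_words_inj[OF g(3)[unfolded G_def] g(6)[unfolded G_def]]) auto
    have "a = a'" "b = b'" using g 1 2 by (auto simp: G_def code_words_def)
    then show "x = x'" using 1 2 3 by (simp add: xe xe')
  qed
  moreover have "F ` D \<subseteq> {x \<in> S. length x = 2 * e}"
  proof
    fix z assume "z \<in> F ` D"
    then obtain a b g1 g2 g3 where z: "z = fold_word g1 @ fold_word g2 @ fold_word g3"
      and ab: "a \<le> k" "b \<le> k"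
      and g: "g1 \<in> G True (J + a)" "g2 \<in> G False (J + b)" "g3 \<in> G True (J + 2 * k - a - b)"
      by (auto simp: F_def D_def)
    have S: "fold_word g \<in> S" "fold_word g \<noteq> []" "hd (fold_word g) = c" "last (fold_word g) = (\<not> c)" "length g = j"
      if "g \<in> G c j" for g c j
      using that fam by (auto simp: G_def code_words_def fold_word_def last_bar)
    have 12: "fold_word g1 @ fold_word g2 \<in> S"
      using S[OF g(1)] S[OF g(2)] by (intro app) auto
    have "(fold_word g1 @ fold_word g2) @ fold_word g3 \<in> S"
      using S[OF g(1)] S[OF g(2)] S[OF g(3)] by (intro app 12) auto
    then show "z \<in> {x \<in> S. length x = 2 * e}"
      using S(5)[OF g(1)] S(5)[OF g(2)] S(5)[OF g(3)] ab by (simp add: z e_def)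
  qed
  ultimately have "card D \<le> card {x \<in> S. length x = 2 * e}"
    by (intro card_inj_on_le[of F]) (auto intro: finite_subset[of _ "idx (2 * e)"])
  moreover have "card D \<ge> (k + 1)\<^sup>2 * 2 ^ (e - 6 - 3 * t)"
  proof -
    have "card D = (\<Sum>p\<in>{0..k} \<times> {0..k}. card (G True (J + fst p) \<times> G False (J + snd p) \<times> G True (J + 2 * k - fst p - snd p)))"
      unfolding D_def by (rule card_SigmaI) (auto simp: finG)
    also have "\<dots> \<ge> (\<Sum>p\<in>{0..k} \<times> {0..k}. 2 ^ (e - 6 - 3 * t))"
    proof (rule sum_mono)
      fix p assume p: "p \<in> {0..k} \<times> {0..k}"
      have "(2::nat) ^ (e - 6 - 3 * t) = 2 ^ (J + fst p - 2 - t) * (2 ^ (J + snd p - 2 - t) * 2 ^ (J + 2 * k - fst p - snd p - 2 - t))"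
        unfolding power_add[symmetric] using p by (intro arg_cong[where f = "power 2"]) (auto simp: e_def J_def)
      also have "\<dots> \<le> card (G True (J + fst p)) * (card (G False (J + snd p)) * card (G True (J + 2 * k - fst p - snd p)))"
        using p by (intro mult_mono cardG) auto
      finally show "2 ^ (e - 6 - 3 * t) \<le> card (G True (J + fst p) \<times> G False (J + snd p) \<times> G True (J + 2 * k - fst p - snd p))"
        by (simp add: card_cartesian_product)
    qed
    finally show ?thesis by (simp add: power2_eq_square)
  qed
  moreover have "(k + 1)\<^sup>2 * 2 ^ (e - 6 - 3 * t) > (2 * e + 2) * 2 ^ e"
  proof -
    have "(2 * e + 2) * M = M * (28 * k + 6 * t + 26)"
      by (simp add: e_def J_def)
    also have "\<dots> < M * ((6 * t + 54) * (k + 1))"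
      by (simp add: M_def algebra_simps)
    also have "\<dots> = k * (k + 1)" by (simp only: k_def[symmetric] mult.assoc[symmetric])
    also have "\<dots> \<le> (k + 1)\<^sup>2" by (simp add: power2_eq_square)
    finally have "(2 * e + 2) * M * 2 ^ (e - 6 - 3 * t) < (k + 1)\<^sup>2 * 2 ^ (e - 6 - 3 * t)" by simp
    moreover have "M * 2 ^ (e - 6 - 3 * t) = 2 ^ e"
      unfolding M_def power_add[symmetric] by (intro arg_cong[where f = "power 2"]) (simp add: e_def J_def)
    ultimately show ?thesis by (simp only: mult.assoc)
  qed
  ultimately show ?thesis by (intro exI[of _ e]) linarith
qed

lemma (in biunitary) inv_words_growth:
  assumes "x \<in> inv_words" "x \<noteq> []"
  shows "\<exists>e. card {x \<in> inv_words. length x = 2 * e} > (2 * e + 2) * 2 ^ e"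
proof -
  obtain s0 where s0: "s0 \<noteq> []" "bar s0 @ s0 \<in> inv_words"
    using inv_words_suffix[OF assms] by blast
  define g where "g = bar s0"
  have g: "g \<noteq> []" "fold_word g \<in> inv_words" using s0 by (simp_all add: g_def fold_word_def)
  have "fold_word (y @ hd g # g) \<in> inv_words" for y
  proof -
    \<comment> \<open>The extra letter \<open>hd g\<close> fulfils the colour condition of
      \<open>inv_words_conj\<close> for every \<open>y\<close>; the fixed suffix handed to
      \<open>growth\<close> is therefore \<open>hd g # g\<close>.\<close>
    have "(y @ [hd g]) @ fold_word g @ bar (y @ [hd g]) \<in> inv_words"
      using g by (intro inv_words_conj) (auto simp: fold_word_def last_bar)
    then show ?thesis by (simp add: fold_word_def)
  qed
  then show ?thesis by (intro growth inv_words_append) auto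
qed

section \<open>The Haar functional and invariant vectors\<close>

text \<open>Invariance and hermiticity on coefficients say that the matrices
  \<open>h (U w i j)\<close> are orthogonal projections onto the invariant vectors. Positivity is
  absent here since for \<open>h_U\<close> it has to be derived from these data, in
  \<open>h_comb_nonneg\<close>.\<close>

locale haar_biunitary = biunitary u for u :: "'n::finite \<Rightarrow> 'n \<Rightarrow> 'a::complex_star_algebra" +
  fixes h :: "'a \<Rightarrow> complex"
  assumes linear_h: "clinear h" and h_one: "h 1 = 1"
    and inv_right: "length i = length w \<Longrightarrow> length j = length w \<Longrightarrow>
      (\<Sum>k\<in>ix w. h (U w k j) *\<^sub>C U w i k) = h (U w i j) *\<^sub>C 1"
    and h_herm: "length i = length w \<Longrightarrow> length j = length w \<Longrightarrow> cnj (h (U w i j)) = h (U w j i)"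
begin

lemma h_add: "h (x + y) = h x + h y" and h_scale: "h (c *\<^sub>C x) = c * h x"
  using linear_h by (simp_all add: clinear_iff scaleC_complex_def)

lemma h_zero [simp]: "h 0 = 0"
  using h_add[of 0 0] by simp

lemma h_sum: "h (sum f A) = (\<Sum>x\<in>A. h (f x))"
  by (induction A rule: infinite_finite_induct) (simp_all add: h_add)

lemma fixed_h:
  assumes "fixed w \<xi>" "length i = length w"
  shows "(\<Sum>j\<in>ix w. h (U w i j) * \<xi> j) = \<xi> i"
  using arg_cong[OF fixedD[OF assms], of h] by (simp add: h_sum h_scale h_one mult.commute)

text \<open>The product of two commuting projections, onto the cap-free and onto the invariant
  vectors, hence the projection onto the invariant vectors of the component labelled
  \<open>w\<close>.\<close>

definition Q :: "bool list \<Rightarrow> 'n list \<Rightarrow> 'n list \<Rightarrow> complex" where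
  "Q w i j = (\<Sum>k\<in>ix w. jw w i k * h (U w k j))"

lemma Q_alt:
  "length i = length w \<Longrightarrow> length j = length w \<Longrightarrow> Q w i j = (\<Sum>k\<in>ix w. h (U w i k) * jw w k j)"
  using arg_cong[OF jw_U_comm[of i w j], of h] by (simp add: Q_def h_sum h_scale mult.commute)

lemma fixed_h_column: "length j = length w \<Longrightarrow> fixed w (\<lambda>k. h (U w k j))"
  by (simp add: fixed_def inv_right)

lemma fixed_Q: "length j = length w \<Longrightarrow> fixed w (\<lambda>i. Q w i j)"
  unfolding fixed_def
proof (intro allI impI)
  fix i :: "'n list" assume j: "length j = length w" and i: "length i = length w"
  have "(\<Sum>k\<in>ix w. Q w k j *\<^sub>C U w i k) =
      (\<Sum>m\<in>ix w. jw w m j *\<^sub>C (\<Sum>k\<in>ix w. h (U w k m) *\<^sub>C U w i k))"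
    using j unfolding scaleC_sum_right
    by (subst sum.swap) (simp add: Q_alt scaleC_sum_left mult.commute)
  also have "\<dots> = Q w i j *\<^sub>C 1"
    using i j by (simp add: inv_right Q_alt scaleC_sum_left mult.commute)
  finally show "(\<Sum>k\<in>ix w. Q w k j *\<^sub>C U w i k) = Q w i j *\<^sub>C 1" .
qed

lemma capfree_Q: "capfree w (\<lambda>i. Q w i j)"
  unfolding Q_def
  using capfree_scale[OF capfree_jw[OF N2], of _ w "h (U w _ j)"]
  by (intro capfree_sum) (simp add: mult.commute)

lemma Q_fixed_capfree:
  assumes "fixed w \<xi>" "capfree w \<xi>" "length i = length w"
  shows "(\<Sum>j\<in>ix w. Q w i j * \<xi> j) = \<xi> i"
proof -
  have "(\<Sum>j\<in>ix w. Q w i j * \<xi> j) =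
      (\<Sum>k\<in>ix w. jw w i k * (\<Sum>j\<in>ix w. h (U w k j) * \<xi> j))"
    unfolding Q_def sum_distrib_left sum_distrib_right by (subst sum.swap) (simp add: mult.assoc)
  also have "\<dots> = (\<Sum>k\<in>ix w. jw w i k * \<xi> k)"
    by (intro sum.cong refl) (simp add: fixed_h[OF assms(1)])
  finally show ?thesis by (simp add: jw_capfree assms)
qed

lemma cnj_Q: "length i = length w \<Longrightarrow> length j = length w \<Longrightarrow> cnj (Q w i j) = Q w j i"
  by (subst (2) Q_alt) (simp_all add: Q_def h_herm jw_sym[of w i] mult.commute)

text \<open>The trace of a hermitian idempotent is its squared Hilbert--Schmidt norm, which makes
  the sign visible.\<close>

lemma h_chr_eq: "h (chr w) = of_real (\<Sum>i\<in>ix w. \<Sum>j\<in>ix w. (cmod (Q w i j))\<^sup>2)"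
proof -
  have "h (chr w) = (\<Sum>i\<in>ix w. Q w i i)"
    unfolding chr_def by (simp add: h_sum h_scale Q_alt mult.commute)
  also have "\<dots> = (\<Sum>i\<in>ix w. \<Sum>j\<in>ix w. Q w i j * Q w j i)"
    by (intro sum.cong refl) (simp add: Q_fixed_capfree[OF fixed_Q capfree_Q])
  also have "\<dots> = (\<Sum>i\<in>ix w. \<Sum>j\<in>ix w. Q w i j * cnj (Q w i j))"
    by (intro sum.cong refl) (simp add: cnj_Q)
  finally show ?thesis
    by (simp add: complex_norm_square[symmetric])
qed

lemma h_chr_nonneg: "Re (h (chr w)) \<ge> 0"
  unfolding h_chr_eq by (auto intro!: sum_nonneg)

text \<open>A projection that fixes a nonzero vector has Hilbert--Schmidt norm at least 1, by
  Cauchy--Schwarz applied to each row.\<close>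

lemma h_chr_ge_1:
  assumes "w \<in> inv_words"
  shows "Re (h (chr w)) \<ge> 1"
proof -
  obtain \<xi> i0 where \<xi>: "fixed w \<xi>" "capfree w \<xi>" "length i0 = length w" "\<xi> i0 \<noteq> 0"
    using assms by (auto simp: inv_words_def)
  define X where "X = (\<Sum>j\<in>ix w. (cmod (\<xi> j))\<^sup>2)"
  have "X > 0" unfolding X_def using \<xi> by (intro sum_pos2[of _ i0]) auto
  have "X \<le> (\<Sum>i\<in>ix w. (\<Sum>j\<in>ix w. (cmod (Q w i j))\<^sup>2) * X)"
    unfolding X_def
  proof (rule sum_mono)
    fix i :: "'n list" assume i: "i \<in> ix w"
    have "cmod (\<xi> i) \<le> (\<Sum>j\<in>ix w. cmod (Q w i j) * cmod (\<xi> j))"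
      using Q_fixed_capfree[OF \<xi>(1,2), of i] i norm_sum[of "\<lambda>j. Q w i j * \<xi> j" "ix w"]
      by (simp add: norm_mult)
    then have "(cmod (\<xi> i))\<^sup>2 \<le> (\<Sum>j\<in>ix w. cmod (Q w i j) * cmod (\<xi> j))\<^sup>2"
      by (rule power_mono) simp
    also have "\<dots> \<le> (\<Sum>j\<in>ix w. (cmod (Q w i j))\<^sup>2) * (\<Sum>j\<in>ix w. (cmod (\<xi> j))\<^sup>2)"
      by (rule Cauchy_Schwarz_sum)
    finally show "(cmod (\<xi> i))\<^sup>2 \<le> (\<Sum>j\<in>ix w. (cmod (Q w i j))\<^sup>2) * (\<Sum>j\<in>ix w. (cmod (\<xi> j))\<^sup>2)" .
  qed
  also have "\<dots> = Re (h (chr w)) * X"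
    by (simp add: h_chr_eq sum_distrib_right)
  finally show ?thesis using \<open>X > 0\<close> by simp
qed

lemma Q_zero:
  assumes "w \<notin> inv_words" "length i = length w" "length j = length w"
  shows "Q w i j = 0"
  using assms fixed_Q[of j w] capfree_Q[of w j] unfolding inv_words_def by blast

lemma h_chr_zero: "w \<notin> inv_words \<Longrightarrow> h (chr w) = 0"
  unfolding h_chr_eq by (simp add: Q_zero)

lemma h_sig_ge: "Re (h (sig d)) \<ge> card {w \<in> inv_words. length w = d}"
proof -
  have "real (card {w \<in> inv_words. length w = d}) = (\<Sum>w\<in>idx d. if w \<in> inv_words then 1 else 0)"
    by (simp add: sum.If_cases Int_def conj_commute)
  also have "\<dots> \<le> (\<Sum>w\<in>idx d. Re (h (chr w)))"
    by (intro sum_mono) (simp add: h_chr_ge_1 h_chr_nonneg)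
  finally show ?thesis by (simp add: sig_def h_sum)
qed

end

section \<open>Orthogonality relations\<close>

context biunitary
begin

text \<open>Converse of \<open>fixed_bend\<close>: multiplying the invariance equation by the
  coefficients of \<open>y\<close> undoes the adjoint part.\<close>

lemma hom_of_fixed:
  assumes \<xi>: "fixed (bar y @ z) \<xi>"
  shows "hom y z (\<lambda>k i. \<xi> (rev i @ k))"
  unfolding hom_def
proof (intro allI impI)
  fix k i :: "'n list" assume k: "length k = length z" and i: "length i = length y"
  define X where "X = (\<lambda>i. \<Sum>k'\<in>ix z. \<xi> (rev i @ k') *\<^sub>C U z k k')"
  have *: "(\<Sum>i'\<in>ix y. star (U y i i') * X i') = \<xi> (rev i @ k) *\<^sub>C 1" if i: "length i = length y" for i
  proof -
    have "(\<Sum>i'\<in>ix y. star (U y i i') * X i') =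
        (\<Sum>i'\<in>ix y. star (U y i (rev i')) * X (rev i'))"
      by (rule sum_idx_rev[symmetric])
    also have "\<dots> = (\<Sum>j\<in>ix (bar y @ z). \<xi> j *\<^sub>C U (bar y @ z) (rev i @ k) j)"
      using i k by (simp add: sum_idx_add um_append um_bar X_def sum_distrib_left)
    also have "\<dots> = \<xi> (rev i @ k) *\<^sub>C 1"
      using i k by (intro fixedD[OF \<xi>]) simp
    finally show ?thesis .
  qed
  have "(\<Sum>i'\<in>ix y. \<xi> (rev i' @ k) *\<^sub>C U y i' i) =
      (\<Sum>i'\<in>ix y. U y i' i * (\<xi> (rev i' @ k) *\<^sub>C 1))" by simp
  also have "\<dots> = (\<Sum>i'\<in>ix y. U y i' i * (\<Sum>l\<in>ix y. star (U y i' l) * X l))"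
    by (intro sum.cong refl arg_cong2[where f = "(*)"]) (simp add: *)
  also have "\<dots> = (\<Sum>l\<in>ix y. (\<Sum>i'\<in>ix y. U y i' i * star (U y i' l)) * X l)"
    unfolding sum_distrib_left sum_distrib_right by (subst sum.swap) (simp add: mult.assoc)
  also have "\<dots> = (\<Sum>l\<in>ix y. if i = l then X l else 0)"
    using i by (intro sum.cong refl) (simp add: U_col')
  also have "\<dots> = X i" using i by simp
  finally show "(\<Sum>k'\<in>ix z. \<xi> (rev i @ k') *\<^sub>C U z k k') =
      (\<Sum>i'\<in>ix y. \<xi> (rev i' @ k) *\<^sub>C U y i' i)" by (simp add: X_def)
qed

section \<open>Coefficients of the irreducible corepresentations and their span\<close>

definition irr :: "bool list \<Rightarrow> 'n list \<Rightarrow> 'n list \<Rightarrow> 'a" where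
  "irr z i j = (\<Sum>m\<in>ix z. jw z i m *\<^sub>C U z m j)"

lemma irr_alt:
  "length i = length z \<Longrightarrow> length j = length z \<Longrightarrow> irr z i j = (\<Sum>m\<in>ix z. jw z m j *\<^sub>C U z i m)"
  by (simp add: irr_def jw_U_comm)

lemma irr_Nil [simp]: "irr [] i j = 1"
  by (simp add: irr_def)

lemma irr_orth:
  assumes "length j = length z" "length l = length z"
  shows "(\<Sum>i\<in>ix z. star (irr z i j) * irr z i l) = jw z j l *\<^sub>C 1"
proof -
  have "(\<Sum>i\<in>ix z. star (irr z i j) * irr z i l) =
      (\<Sum>i\<in>ix z. \<Sum>m\<in>ix z. \<Sum>n\<in>ix z.
        (jw z m i * jw z i n) *\<^sub>C (star (U z m j) * U z n l))"
    by (simp add: irr_def star_sum star_scaleC sum_product jw_sym[of z _ "_ :: 'n list"] mult.commute)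
  also have "\<dots> = (\<Sum>m\<in>ix z. \<Sum>n\<in>ix z. \<Sum>i\<in>ix z.
        (jw z m i * jw z i n) *\<^sub>C (star (U z m j) * U z n l))"
    by (rule sum_rot3)
  also have "\<dots> = (\<Sum>m\<in>ix z. \<Sum>n\<in>ix z. jw z m n *\<^sub>C (star (U z m j) * U z n l))"
    by (intro sum.cong refl) (simp add: jw_idem[OF N2] flip: scaleC_sum_left)
  also have "\<dots> = (\<Sum>m\<in>ix z. star (U z m j) * irr z m l)"
    by (simp add: irr_def sum_distrib_left)
  also have "\<dots> = (\<Sum>m\<in>ix z. \<Sum>n\<in>ix z. jw z n l *\<^sub>C (star (U z m j) * U z m n))"
    using assms by (simp add: irr_alt sum_distrib_left)
  also have "\<dots> = (\<Sum>n\<in>ix z. jw z n l *\<^sub>C (\<Sum>m\<in>ix z. star (U z m j) * U z m n))"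
    unfolding scaleC_sum_right by (rule sum.swap)
  also have "\<dots> = (\<Sum>n\<in>ix z. if j = n then jw z n l *\<^sub>C 1 else 0)"
    using assms by (intro sum.cong refl) (simp add: U_col)
  finally show ?thesis using assms by simp
qed

text \<open>The elements \<open>irr z i j\<close> are in general linearly dependent; compressing a
  coefficient matrix by \<open>jw z\<close> on both sides retains the part on which the combination
  depends.\<close>

definition sandwich :: "bool list \<Rightarrow> ('n list \<Rightarrow> 'n list \<Rightarrow> complex) \<Rightarrow> 'n list \<Rightarrow> 'n list \<Rightarrow> complex" where
  "sandwich z a i j = (\<Sum>k\<in>ix z. \<Sum>l\<in>ix z. jw z i k * a k l * jw z l j)"

lemma sandwich_idem:
  assumes "length i = length z" "length j = length z"
  shows "sandwich z (sandwich z a) i j = sandwich z a i j"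
proof -
  let ?I = "ix z :: 'n list set"
  have "sandwich z (sandwich z a) i j =
      (\<Sum>k\<in>?I. \<Sum>l\<in>?I. \<Sum>k'\<in>?I. \<Sum>l'\<in>?I. (jw z i k * jw z k k') * (a k' l' * (jw z l' l * jw z l j)))"
    unfolding sandwich_def sum_distrib_left sum_distrib_right by (simp add: mult_ac)
  also have "\<dots> = (\<Sum>k\<in>?I. \<Sum>k'\<in>?I. \<Sum>l'\<in>?I. \<Sum>l\<in>?I. (jw z i k * jw z k k') * (a k' l' * (jw z l' l * jw z l j)))"
    by (intro sum.cong refl sum_rot3)
  also have "\<dots> = (\<Sum>k'\<in>?I. \<Sum>l'\<in>?I. \<Sum>k\<in>?I. \<Sum>l\<in>?I. (jw z i k * jw z k k') * (a k' l' * (jw z l' l * jw z l j)))"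
    by (rule sum_rot3)
  also have "\<dots> = (\<Sum>k'\<in>?I. \<Sum>l'\<in>?I. (\<Sum>k\<in>?I. jw z i k * jw z k k') * (a k' l' * (\<Sum>l\<in>?I. jw z l' l * jw z l j)))"
    by (intro sum.cong refl) (simp only: sum_distrib_left[symmetric] sum_distrib_right[symmetric])
  also have "\<dots> = sandwich z a i j"
    unfolding sandwich_def using assms by (intro sum.cong refl) (simp add: jw_idem[OF N2])
  finally show ?thesis .
qed

lemma sandwich_adjoint:
  "(\<Sum>i\<in>ix z. \<Sum>j\<in>ix z. cnj (a i j) * sandwich z b i j) =
   (\<Sum>i\<in>ix z. \<Sum>j\<in>ix z. cnj (sandwich z a i j) * b i j)"
proof -
  let ?I = "ix z :: 'n list set"
  have "(\<Sum>i\<in>?I. \<Sum>j\<in>?I. cnj (a i j) * sandwich z b i j) =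
      (\<Sum>i\<in>?I. \<Sum>j\<in>?I. \<Sum>k\<in>?I. \<Sum>l\<in>?I. cnj (a i j) * (jw z i k * b k l * jw z l j))"
    by (simp add: sandwich_def sum_distrib_left)
  also have "\<dots> = (\<Sum>i\<in>?I. \<Sum>k\<in>?I. \<Sum>l\<in>?I. \<Sum>j\<in>?I. cnj (a i j) * (jw z i k * b k l * jw z l j))"
    by (intro sum.cong refl sum_rot3)
  also have "\<dots> = (\<Sum>k\<in>?I. \<Sum>l\<in>?I. \<Sum>i\<in>?I. \<Sum>j\<in>?I. cnj (a i j) * (jw z i k * b k l * jw z l j))"
    by (rule sum_rot3)
  also have "\<dots> = (\<Sum>k\<in>?I. \<Sum>l\<in>?I. cnj (sandwich z a k l) * b k l)"
    unfolding sandwich_def cnj_sum sum_distrib_right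
    by (intro sum.cong refl) (simp add: jw_sym mult_ac)
  finally show ?thesis .
qed

lemma sum_irr_sandwich:
  "(\<Sum>i\<in>ix z. \<Sum>j\<in>ix z. a i j *\<^sub>C irr z i j) =
   (\<Sum>i\<in>ix z. \<Sum>j\<in>ix z. sandwich z a i j *\<^sub>C U z i j)"
proof -
  let ?I = "ix z :: 'n list set"
  have irr: "irr z i j = (\<Sum>k\<in>?I. \<Sum>l\<in>?I. (jw z k i * jw z j l) *\<^sub>C U z k l)"
    if "length i = length z" "length j = length z" for i j
  proof -
    have "irr z i j = (\<Sum>m\<in>?I. (\<Sum>k\<in>?I. jw z i k * jw z k m) *\<^sub>C U z m j)"
      unfolding irr_def using that by (intro sum.cong refl) (simp add: jw_idem[OF N2])
    also have "\<dots> = (\<Sum>k\<in>?I. jw z i k *\<^sub>C irr z k j)"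
      unfolding irr_def scaleC_sum_left scaleC_sum_right
      by (subst sum.swap) simp
    also have "\<dots> = (\<Sum>k\<in>?I. \<Sum>l\<in>?I. (jw z i k * jw z l j) *\<^sub>C U z k l)"
      using that by (simp add: irr_alt scaleC_sum_right)
    finally show ?thesis by (simp add: jw_sym[of z i] jw_sym[of z j])
  qed
  have "(\<Sum>i\<in>?I. \<Sum>j\<in>?I. a i j *\<^sub>C irr z i j) =
      (\<Sum>i\<in>?I. \<Sum>j\<in>?I. \<Sum>k\<in>?I. \<Sum>l\<in>?I. (jw z k i * a i j * jw z j l) *\<^sub>C U z k l)"
    by (intro sum.cong refl) (simp add: irr scaleC_sum_right mult_ac)
  also have "\<dots> = (\<Sum>i\<in>?I. \<Sum>k\<in>?I. \<Sum>l\<in>?I. \<Sum>j\<in>?I. (jw z k i * a i j * jw z j l) *\<^sub>C U z k l)"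
    by (intro sum.cong refl sum_rot3)
  also have "\<dots> = (\<Sum>k\<in>?I. \<Sum>l\<in>?I. \<Sum>i\<in>?I. \<Sum>j\<in>?I. (jw z k i * a i j * jw z j l) *\<^sub>C U z k l)"
    by (rule sum_rot3)
  also have "\<dots> = (\<Sum>k\<in>?I. \<Sum>l\<in>?I. sandwich z a k l *\<^sub>C U z k l)"
    by (simp add: sandwich_def scaleC_sum_left)
  finally show ?thesis .
qed

definition comb :: "bool list set \<Rightarrow> (bool list \<Rightarrow> 'n list \<Rightarrow> 'n list \<Rightarrow> complex) \<Rightarrow> 'a" where
  "comb Z a = (\<Sum>z\<in>Z. \<Sum>i\<in>ix z. \<Sum>j\<in>ix z. a z i j *\<^sub>C irr z i j)"

lemma comb_zero:
  assumes "\<And>z i j. z \<in> Z \<Longrightarrow> length i = length z \<Longrightarrow> length j = length z \<Longrightarrow> sandwich z (a z) i j = 0"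
  shows "comb Z a = 0"
  unfolding comb_def sum_irr_sandwich by (intro sum.neutral ballI) (simp add: assms)

definition irr_span :: "'a set" where
  "irr_span = cspan {irr z i j |z i j. length i = length z \<and> length j = length z}"

lemma irr_in_span: "length i = length z \<Longrightarrow> length j = length z \<Longrightarrow> irr z i j \<in> irr_span"
  unfolding irr_span_def by (rule complex_vector.span_base) blast

lemma irr_span_comb:
  assumes "x \<in> irr_span"
  shows "\<exists>Z a. finite Z \<and> x = comb Z a"
  using assms unfolding irr_span_def
proof (induction rule: complex_vector.span_induct_alt)
  case base
  show ?case by (intro exI[of _ "{}"]) (simp add: comb_def)
next
  case (step c r y)
  then obtain Z a z0 i0 j0 where Z: "finite Z" "y = comb Z a"
    and r: "r = irr z0 i0 j0" "length i0 = length z0" "length j0 = length z0" by auto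
  \<comment> \<open>\<open>a1\<close> is cut off outside \<open>Z\<close> because \<open>z0\<close>
    may or may not lie in \<open>Z\<close>; both summands then live on
    \<open>insert z0 Z\<close>.\<close>
  define a1 where "a1 = (\<lambda>z i j. if z \<in> Z then a z i j else 0)"
  define a2 where "a2 = (\<lambda>z i j. if j = j0 then if i = i0 then if z = z0 then c else 0 else 0 else 0)"
  have "comb (insert z0 Z) (\<lambda>z i j. a1 z i j + a2 z i j) = comb (insert z0 Z) a1 + comb (insert z0 Z) a2"
    unfolding comb_def by (simp only: scaleC_add_left sum.distrib)
  also have "comb (insert z0 Z) a1 = comb Z a1"
    unfolding comb_def using Z(1) by (intro sum.mono_neutral_right) (auto simp: a1_def)
  also have "comb Z a1 = y" unfolding Z comb_def by (intro sum.cong refl) (simp add: a1_def)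
  also have "comb (insert z0 Z) a2 = (\<Sum>z\<in>insert z0 Z. if z = z0 then c *\<^sub>C r else 0)"
    unfolding comb_def
  proof (rule sum.cong[OF refl])
    fix z
    show "(\<Sum>i\<in>ix z. \<Sum>j\<in>ix z. a2 z i j *\<^sub>C irr z i j) = (if z = z0 then c *\<^sub>C r else 0)"
      by (cases "z = z0") (simp_all add: a2_def r scaleC_if cong: if_cong)
  qed
  also have "\<dots> = c *\<^sub>C r" using Z(1) by simp
  finally have "comb (insert z0 Z) (\<lambda>z i j. a1 z i j + a2 z i j) = c *\<^sub>C r + y"
    by (simp add: add.commute)
  then show ?case using Z(1) by (intro exI[of _ "insert z0 Z"] exI conjI) (auto intro: sym)
qed

text \<open>Wenzl's recursion solved for the product: the leading term is \<open>irr\<close> of the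
  longer word, and the cup-cap term reduces to coefficients of the tail. So the span is stable under
  multiplication by letters and contains the coefficients of all words.\<close>

lemma V_irr_in_span:
  assumes "length i = length z" "length j = length z"
  shows "V c a b * irr z i j \<in> irr_span"
proof -
  let ?t = "of_real (theta TYPE('n) c z) :: complex"
  let ?X = "\<Sum>e\<in>UNIV. \<Sum>m\<in>ix z. (\<Sum>k\<in>idx (length z - 1). jw z i (a # k) * jw z (e # k) m) *\<^sub>C (V c e b * U z m j)"
  have "irr (c # z) (a # i) (b # j) =
      (\<Sum>e\<in>UNIV. \<Sum>m\<in>ix z. if a = e then jw z i m *\<^sub>C (V c e b * U z m j) else 0) - ?t *\<^sub>C ?X"
    unfolding irr_def length_Cons sum_idx_Suc jw_Cons
    by (simp add: complex_vector.scale_left_diff_distrib scaleC_if sum_subtractf scaleC_sum_right)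
  also have "\<dots> = V c a b * irr z i j - ?t *\<^sub>C ?X"
    unfolding sum_delta_outer by (simp add: irr_def sum_distrib_left)
  finally have eq: "V c a b * irr z i j = irr (c # z) (a # i) (b # j) + ?t *\<^sub>C ?X" by simp
  have "?t *\<^sub>C ?X \<in> irr_span"
  proof (rule theta_cases[of "TYPE('n)" c z])
    fix z1 assume z: "z = (\<not> c) # z1"
    obtain f i1 where i: "i = f # i1" "length i1 = length z1" using assms z by (cases i) auto
    have "?X = (\<Sum>e\<in>UNIV. \<Sum>k\<in>ix z1. \<Sum>m\<in>ix z. jw z i (a # k) *\<^sub>C (V c e b * jw z (e # k) m *\<^sub>C U z m j))"
      by (rule sum.cong[OF refl], subst sum.swap) (simp add: z scaleC_sum_left)
    also have "\<dots> = (\<Sum>k\<in>ix z1. jw z i (a # k) *\<^sub>C (\<Sum>e\<in>UNIV. V c e b * (\<Sum>m\<in>ix z. jw z (e # k) m *\<^sub>C U z m j)))"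
      by (subst sum.swap) (simp only: scaleC_sum_right sum_distrib_left)
    also have "\<dots> = (\<Sum>k\<in>ix z1. jw z i (a # k) *\<^sub>C (\<Sum>k'\<in>ix z1. jw z (b # k') j *\<^sub>C U z1 k k'))"
      using assms jw_U_comm[of _ "(\<not> c) # z1"] unfolding z
      by (intro sum.cong refl arg_cong2[where f = scaleC]) (simp add: jw_cap_aux')
    \<comment> \<open>Inserting \<open>jw z1\<close>, which \<open>jw z\<close> absorbs, turns the
      plain coefficients of \<open>z1\<close> into \<open>irr\<close>.\<close>
    also have "\<dots> = (\<Sum>k\<in>ix z1. (\<Sum>m\<in>ix z1. jw z i (a # m) * jw z1 m k) *\<^sub>C (\<Sum>k'\<in>ix z1. jw z (b # k') j *\<^sub>C U z1 k k'))"
    proof (intro sum.cong refl arg_cong2[where f = scaleC])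
      fix k :: "'n list" assume "k \<in> ix z1"
      then show "jw z i (a # k) = (\<Sum>m\<in>ix z1. jw z i (a # m) * jw z1 m k)"
        using jw_absorb[OF N2, of k z1 i1 "\<not> c" a f] i
        by (simp add: z jw_sym[of _ "f # i1"] jw_sym[of z1 k] mult.commute)
    qed
    also have "\<dots> = (\<Sum>k\<in>ix z1. \<Sum>m\<in>ix z1. \<Sum>k'\<in>ix z1. (jw z i (a # m) * jw z (b # k') j) *\<^sub>C (jw z1 m k *\<^sub>C U z1 k k'))"
      unfolding scaleC_sum_left unfolding scaleC_sum_right by (simp add: mult_ac)
    also have "\<dots> = (\<Sum>m\<in>ix z1. \<Sum>k'\<in>ix z1. \<Sum>k\<in>ix z1. (jw z i (a # m) * jw z (b # k') j) *\<^sub>C (jw z1 m k *\<^sub>C U z1 k k'))"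
      by (rule sum_rot3)
    also have "\<dots> = (\<Sum>m\<in>ix z1. \<Sum>k'\<in>ix z1. (jw z i (a # m) * jw z (b # k') j) *\<^sub>C irr z1 m k')"
      by (simp only: irr_def scaleC_sum_right)
    also have "\<dots> \<in> irr_span"
      unfolding irr_span_def
      by (intro complex_vector.span_sum complex_vector.span_scale) (auto intro: irr_in_span[unfolded irr_span_def])
    finally show ?thesis
      unfolding irr_span_def by (intro complex_vector.span_scale)
  qed (simp add: irr_span_def complex_vector.span_zero)
  then show ?thesis
    unfolding eq irr_span_def using assms
    by (intro complex_vector.span_add irr_in_span[unfolded irr_span_def]) auto
qed

lemma V_irr_span:
  assumes "x \<in> irr_span"
  shows "V c a b * x \<in> irr_span"
  using assms unfolding irr_span_def
proof (induction rule: complex_vector.span_induct_alt)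
  case base
  show ?case by (simp add: complex_vector.span_zero)
next
  case (step k r y)
  then show ?case
    using V_irr_in_span[of _ _ _ c a b]
    by (auto simp: distrib_left irr_span_def intro!: complex_vector.span_add complex_vector.span_scale)
qed

lemma U_in_irr_span:
  "length i = length w \<Longrightarrow> length j = length w \<Longrightarrow> U w i j \<in> irr_span"
proof (induction w arbitrary: i j)
  case Nil
  then show ?case using irr_in_span[of "[]" "[]" "[]"] by simp
next
  case (Cons c w)
  then obtain a i0 b j0 where "i = a # i0" "j = b # j0" "length i0 = length w" "length j0 = length w"
    by (metis length_Suc_conv)
  then show ?case using V_irr_span[OF Cons.IH] by simp
qed

end

section \<open>Orthogonality, positivity and faithfulness of the Haar functional\<close>

context haar_biunitary
begin

text \<open>A column of the projection onto the invariant vectors of \<open>bar y @ z\<close> is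
  invariant; unbending it gives the averaged operator of the classical proof of the orthogonality
  relations.\<close>

lemma hom_h:
  assumes "length j = length y" "length l = length z"
  shows "hom y z (\<lambda>k i. h (star (U y i j) * U z k l))"
proof -
  have "hom y z (\<lambda>k i. h (U (bar y @ z) (rev i @ k) (rev j @ l)))"
    using assms by (intro hom_of_fixed fixed_h_column) simp
  moreover have "h (U (bar y @ z) (rev i @ k) (rev j @ l)) = h (star (U y i j) * U z k l)"
    if "length i = length y" "length k = length z" for i k
    using that assms by (simp add: um_append um_bar)
  ultimately show ?thesis unfolding hom_def by simp
qed

text \<open>Schur's lemma applies because \<open>triv\<close> excludes invariant vectors in
  \<open>bar s @ t\<close>. It leaves one scalar, which is found by summing the diagonal and using
  \<open>irr_orth\<close>.\<close>

lemma h_irr_mult: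
  assumes triv: "inv_words \<subseteq> {[]}"
    and len: "length i = length y" "length j = length y" "length k = length z" "length l = length z"
  shows "h (star (irr y i j) * irr z k l) = (if y = z then jw z k i * jw z j l / jw_dim TYPE('n) z else 0)"
proof -
  define B where "B = (\<lambda>k i. h (star (U y i j) * U z k l))"
  define A where "A = (\<lambda>k i. \<Sum>m\<in>ix z. jw z k m * (\<Sum>n\<in>ix y. B m n * jw y n i))"
  have A: "h (star (irr y i j) * irr z k l) = A k i" for i k
  proof -
    have "star (irr y i j) * irr z k l =
        (\<Sum>n\<in>ix y. \<Sum>m\<in>ix z. (jw y i n * jw z k m) *\<^sub>C (star (U y n j) * U z m l))"
      by (simp add: irr_def star_sum star_scaleC sum_product mult.commute)
    then have "h (star (irr y i j) * irr z k l) =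
        (\<Sum>n\<in>ix y. \<Sum>m\<in>ix z. (jw y i n * jw z k m) * B m n)"
      by (simp add: h_sum h_scale B_def)
    also have "\<dots> = A k i"
      unfolding A_def sum_distrib_left by (subst sum.swap) (simp add: jw_sym[of y i] mult_ac)
    finally show ?thesis .
  qed
  have "\<exists>\<mu>. \<forall>k i. length k = length z \<longrightarrow> length i = length y \<longrightarrow> A k i = (if y = z then \<mu> * jw y k i else 0)"
  proof (rule schur)
    have "hom y z B" unfolding B_def by (rule hom_h) (use len in auto)
    then show "hom y z A"
      unfolding A_def by (intro hom_comp[OF hom_comp] hom_jw)
    show "capfree z (\<lambda>k. A k i)" for i
      unfolding A_def
      by (intro capfree_sum, subst mult.commute) (auto intro!: capfree_scale capfree_jw N2)
    show "capfree y (\<lambda>i. A k i)" for k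
    proof -
      have "capfree y (jw y n)" if "length n = length y" for n :: "'n list"
        using capfree_jw[OF N2 that] by (rule capfree_cong) (rule jw_sym)
      then show ?thesis
        unfolding A_def by (intro capfree_sum capfree_scale) simp
    qed
    show "bar s @ t \<notin> inv_words" if "(s, t) \<noteq> ([], [])" for s t
      using that triv by auto
  qed
  then obtain \<mu> where \<mu>: "\<And>k i. length k = length z \<Longrightarrow> length i = length y \<Longrightarrow>
      A k i = (if y = z then \<mu> * jw y k i else 0)" by blast
  show ?thesis
  proof (cases "y = z")
    case True
    have "jw z j l = h (\<Sum>i\<in>ix z. star (irr z i j) * irr z i l)"
      using len True by (simp add: irr_orth h_scale h_one)
    also have "\<dots> = (\<Sum>i\<in>ix z. A i i)"
      unfolding h_sum using A True by simp
    also have "\<dots> = \<mu> * jw_dim TYPE('n) z"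
      unfolding jw_dim_def sum_distrib_left using \<mu> True by simp
    finally have "jw z j l = \<mu> * jw_dim TYPE('n) z" .
    moreover have "jw_dim TYPE('n) z \<noteq> 0"
      using jw_dim_ge[OF N2, of z] by (auto split: if_splits)
    ultimately show ?thesis using A \<mu> len True by simp
  next
    case False
    then show ?thesis using A \<mu> len by simp
  qed
qed

text \<open>Orthogonality leaves pairings of \<open>a z\<close> with its compression, and
  compression is a selfadjoint idempotent. The resulting sum of squares yields positivity and
  faithfulness at once.\<close>

lemma h_comb:
  assumes triv: "inv_words \<subseteq> {[]}" and fin: "finite Z"
  shows "h (star (comb Z a) * comb Z a) = of_real (\<Sum>z\<in>Z. (\<Sum>i\<in>ix z. \<Sum>j\<in>ix z.
     (cmod (sandwich z (a z) i j))\<^sup>2) / Re (jw_dim TYPE('n) z))"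
proof -
  let ?I = "\<lambda>z. ix z :: 'n list set"
  have D: "jw_dim TYPE('n) z = of_real (Re (jw_dim TYPE('n) z))" for z
    using jw_dim_ge[OF N2, of z] by auto
  have "h (star (comb Z a) * comb Z a) = (\<Sum>y\<in>Z. \<Sum>z\<in>Z. \<Sum>i\<in>?I y. \<Sum>j\<in>?I y. \<Sum>k\<in>?I z. \<Sum>l\<in>?I z.
      cnj (a y i j) * a z k l * h (star (irr y i j) * irr z k l))"
  proof -
    have "star (comb Z a) * comb Z a = (\<Sum>y\<in>Z. \<Sum>z\<in>Z. \<Sum>i\<in>?I y. \<Sum>j\<in>?I y. \<Sum>k\<in>?I z. \<Sum>l\<in>?I z.
      (cnj (a y i j) * a z k l) *\<^sub>C (star (irr y i j) * irr z k l))"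
      unfolding comb_def star_sum star_scaleC
      unfolding sum_distrib_right unfolding sum_distrib_left
      by (rule sum.cong[OF refl], rule trans[OF sum_rot3[symmetric]], intro sum.cong refl) (simp add: mult.commute)
    then show ?thesis by (simp only: h_sum h_scale)
  qed
  also have "\<dots> = (\<Sum>y\<in>Z. \<Sum>z\<in>Z. if y = z then \<Sum>i\<in>?I z. \<Sum>j\<in>?I z. \<Sum>k\<in>?I z. \<Sum>l\<in>?I z.
      cnj (a z i j) * (jw z i k * a z k l * jw z l j) / jw_dim TYPE('n) z else 0)"
    by (intro sum.cong refl) (auto simp: h_irr_mult[OF triv] jw_sym intro!: sum.cong)
  also have "\<dots> = (\<Sum>z\<in>Z. \<Sum>i\<in>?I z. \<Sum>j\<in>?I z. \<Sum>k\<in>?I z. \<Sum>l\<in>?I z.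
      cnj (a z i j) * (jw z i k * a z k l * jw z l j) / jw_dim TYPE('n) z)"
    using fin by simp
  also have "\<dots> = (\<Sum>z\<in>Z. (\<Sum>i\<in>?I z. \<Sum>j\<in>?I z. cnj (a z i j) * sandwich z (a z) i j) / jw_dim TYPE('n) z)"
    by (simp add: sandwich_def sum_distrib_left sum_divide_distrib)
  also have "\<dots> = (\<Sum>z\<in>Z. (\<Sum>i\<in>?I z. \<Sum>j\<in>?I z. of_real ((cmod (sandwich z (a z) i j))\<^sup>2)) / jw_dim TYPE('n) z)"
  proof (rule sum.cong[OF refl])
    fix z
    have "(\<Sum>i\<in>?I z. \<Sum>j\<in>?I z. cnj (a z i j) * sandwich z (a z) i j) =
        (\<Sum>i\<in>?I z. \<Sum>j\<in>?I z. cnj (a z i j) * sandwich z (sandwich z (a z)) i j)"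
      by (intro sum.cong refl) (simp add: sandwich_idem)
    also have "\<dots> = (\<Sum>i\<in>?I z. \<Sum>j\<in>?I z. of_real ((cmod (sandwich z (a z) i j))\<^sup>2))"
      unfolding sandwich_adjoint[where a = "a z" and b = "sandwich z (a z)"] by (simp only: complex_norm_square mult.commute)
    finally show "(\<Sum>i\<in>?I z. \<Sum>j\<in>?I z. cnj (a z i j) * sandwich z (a z) i j) / jw_dim TYPE('n) z =
        (\<Sum>i\<in>?I z. \<Sum>j\<in>?I z. of_real ((cmod (sandwich z (a z) i j))\<^sup>2)) / jw_dim TYPE('n) z"
      by (rule arg_cong)
  qed
  also have "\<dots> = of_real (\<Sum>z\<in>Z. (\<Sum>i\<in>?I z. \<Sum>j\<in>?I z. (cmod (sandwich z (a z) i j))\<^sup>2) / Re (jw_dim TYPE('n) z))"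
    by (subst D) (simp add: of_real_sum)
  finally show ?thesis .
qed

lemma jw_dim_pos: "Re (jw_dim TYPE('n) z) > 0"
  using jw_dim_ge[OF N2, of z] by (auto split: if_splits)

lemma h_comb_nonneg:
  assumes "inv_words \<subseteq> {[]}" "finite Z"
  shows "h (star (comb Z a) * comb Z a) \<in> \<real>\<^sub>\<ge>\<^sub>0"
  unfolding h_comb[OF assms] nonneg_Reals_of_real_iff using jw_dim_pos
  by (intro sum_nonneg divide_nonneg_pos) auto

lemma h_comb_faithful:
  assumes "inv_words \<subseteq> {[]}" "finite Z" "h (star (comb Z a) * comb Z a) = 0"
    and "z \<in> Z" "length i = length z" "length j = length z"
  shows "sandwich z (a z) i j = 0"
proof -
  have "(\<Sum>z\<in>Z. (\<Sum>i\<in>ix z. \<Sum>j\<in>ix z.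
     (cmod (sandwich z (a z) i j))\<^sup>2) / Re (jw_dim TYPE('n) z)) = 0"
    using assms(3) unfolding h_comb[OF assms(1,2)] of_real_eq_0_iff .
  then have "(\<Sum>i\<in>ix z. \<Sum>j\<in>ix z. (cmod (sandwich z (a z) i j))\<^sup>2) / Re (jw_dim TYPE('n) z) = 0"
    using assms(2,4) jw_dim_pos less_imp_le[OF jw_dim_pos]
    by (subst (asm) sum_nonneg_eq_0_iff) (auto intro!: divide_nonneg_nonneg sum_nonneg)
  then have "(\<Sum>i\<in>ix z. \<Sum>j\<in>ix z. (cmod (sandwich z (a z) i j))\<^sup>2) = 0"
    using jw_dim_pos[of z] by simp
  then have "(\<Sum>j\<in>ix z. (cmod (sandwich z (a z) i j))\<^sup>2) = 0"
    using assms(5) by (subst (asm) sum_nonneg_eq_0_iff) (auto intro!: sum_nonneg)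
  then show ?thesis using assms(6) by (subst (asm) sum_nonneg_eq_0_iff) auto
qed

end

section \<open>Noncrossing pairings\<close>

definition cup :: "nat \<Rightarrow> ('n list \<Rightarrow> complex) \<Rightarrow> 'n list \<Rightarrow> complex" where
  "cup p \<eta> l = (if l ! p = l ! Suc p then \<eta> (take p l @ drop (Suc (Suc p)) l) else 0)"

lemma cup_append:
  "length i = p \<Longrightarrow> cup p \<eta> (i @ a # b # j) = (if a = b then \<eta> (i @ j) else 0)"
  by (simp add: cup_def nth_append)

inductive nc :: "bool list \<Rightarrow> ('n::finite list \<Rightarrow> complex) \<Rightarrow> bool" where
  nc_Nil: "nc [] (\<lambda>_. 1)"
| nc_cup: "nc (v @ w) \<eta> \<Longrightarrow> nc (v @ c # (\<not> c) # w) (cup (length v) \<eta>)"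

text \<open>A pairing comes from a shorter word by a cup at one of finitely many positions.
  Finiteness is what \<open>projection_exists\<close> asks for.\<close>

lemma finite_nc: "finite {\<eta> :: 'n::finite list \<Rightarrow> complex. nc w \<eta>}"
proof (induction w rule: length_induct)
  case (1 w)
  have "{\<eta> :: 'n list \<Rightarrow> complex. nc w \<eta>} \<subseteq> insert (\<lambda>_. 1)
      (\<Union>p\<in>{p. Suc p < length w}. cup p ` {\<eta>. nc (take p w @ drop (Suc (Suc p)) w) \<eta>})"
  proof
    fix \<eta> :: "'n list \<Rightarrow> complex" assume "\<eta> \<in> {\<eta>. nc w \<eta>}"
    then have "nc w \<eta>" by simp
    then show "\<eta> \<in> insert (\<lambda>_. 1) (\<Union>p\<in>{p. Suc p < length w}. cup p ` {\<eta>. nc (take p w @ drop (Suc (Suc p)) w) \<eta>})"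
    proof cases
      case (nc_cup v w' \<eta>' c)
      then show ?thesis by (intro insertI2 UN_I[of "length v"]) auto
    qed simp
  qed
  moreover have "finite (insert (\<lambda>_. 1 :: complex)
      (\<Union>p\<in>{p. Suc p < length w}. cup p ` {\<eta> :: 'n list \<Rightarrow> complex. nc (take p w @ drop (Suc (Suc p)) w) \<eta>}))"
  proof (intro finite.insertI finite_UN_I finite_imageI)
    show "finite {p. Suc p < length w}" by (rule finite_subset[of _ "{..<length w}"]) auto
    fix p assume "p \<in> {p. Suc p < length w}"
    then have "length (take p w @ drop (Suc (Suc p)) w) < length w" by simp
    then show "finite {\<eta> :: 'n list \<Rightarrow> complex. nc (take p w @ drop (Suc (Suc p)) w) \<eta>}" using 1 by blast
  qed
  ultimately show ?case by (rule finite_subset)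
qed

text \<open>Capping a noncrossing pairing either closes a loop, straightens a zigzag, or commutes with an
  outer cup.\<close>

lemma nc_cap:
  fixes \<eta> :: "'n::finite list \<Rightarrow> complex"
  assumes "nc w \<eta>" "w = v @ c # (\<not> c) # u"
  shows "\<exists>\<eta>' k. nc (v @ u) \<eta>' \<and> (\<forall>i j. length i = length v \<longrightarrow> length j = length u \<longrightarrow>
    (\<Sum>a\<in>UNIV. \<eta> (i @ a # a # j)) = k * \<eta>' (i @ j))"
  using assms
proof (induction arbitrary: v c u rule: nc.induct)
  case nc_Nil
  then show ?case by simp
next
  case (nc_cup v0 w0 \<eta> d)
  from nc_cup.prems consider us where "v0 @ us = v" "d # (\<not> d) # w0 = us @ c # (\<not> c) # u"
    | us where "v0 = v @ us" "us @ d # (\<not> d) # w0 = c # (\<not> c) # u"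
    unfolding append_eq_append_conv2 by blast
  then show ?case
  proof cases
    case 1
    then consider "us = []" | x where "us = [x]" | x y us' where "us = x # y # us'"
      by (metis list.exhaust)
    then show ?thesis
    proof cases
      assume us: "us = []"
      then show ?thesis
        using 1 nc_cup.hyps by (intro exI[of _ \<eta>] exI[of _ "of_nat CARD('n)"]) (auto simp: cup_append)
    next
      fix x assume us: "us = [x]"
      then have e: "x = d" "c = (\<not> d)" "w0 = d # u" "v = v0 @ [d]" using 1 by auto
      have "(\<Sum>a\<in>UNIV. cup (length v0) \<eta> (i @ a # a # j)) = 1 * \<eta> (i @ j)" if i: "length i = length v" for i j
      proof -
        obtain i0 f where "i = i0 @ [f]" "length i0 = length v0"
          using i e by (cases i rule: rev_cases) auto
        then show ?thesis by (simp add: cup_append)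
      qed
      then show ?thesis using nc_cup.hyps e by (intro exI[of _ \<eta>] exI[of _ 1]) auto
    next
      fix x y us' assume us: "us = x # y # us'"
      then have e: "x = d" "y = (\<not> d)" "w0 = us' @ c # (\<not> c) # u" "v = v0 @ d # (\<not> d) # us'" using 1 by auto
      obtain \<eta>' k where IH: "nc ((v0 @ us') @ u) \<eta>'"
        "\<And>i j. length i = length (v0 @ us') \<Longrightarrow> length j = length u \<Longrightarrow> (\<Sum>a\<in>UNIV. \<eta> (i @ a # a # j)) = k * \<eta>' (i @ j)"
        using nc_cup.IH[of "v0 @ us'" c u] e by auto
      have "(\<Sum>a\<in>UNIV. cup (length v0) \<eta> (i @ a # a # j)) = k * cup (length v0) \<eta>' (i @ j)"
        if ij: "length i = length v" "length j = length u" for i j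
      proof -
        obtain i0 f g i1 where i: "i = i0 @ f # g # i1" "length i0 = length v0" "length i1 = length us'"
        proof -
          have "length i = length v0 + Suc (Suc (length us'))" using ij e by simp
          then show ?thesis
            by (intro that[of "take (length v0) i" "i ! length v0" "i ! Suc (length v0)" "drop (Suc (Suc (length v0))) i"])
              (simp_all add: id_take_nth_drop[symmetric] Cons_nth_drop_Suc)
        qed
        then show ?thesis using IH(2)[of "i0 @ i1" j] ij by (cases "f = g") (simp_all add: cup_append)
      qed
      moreover have "nc (v0 @ d # (\<not> d) # (us' @ u)) (cup (length v0) \<eta>')"
        using IH(1) by (intro nc.nc_cup) simp
      ultimately show ?thesis using e by (intro exI[of _ "cup (length v0) \<eta>'"] exI[of _ k]) auto
    qed
  next
    case 2
    then consider "us = []" | x where "us = [x]" | x y us' where "us = x # y # us'"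
      by (metis list.exhaust)
    then show ?thesis
    proof cases
      assume us: "us = []"
      then show ?thesis
        using 2 nc_cup.hyps by (intro exI[of _ \<eta>] exI[of _ "of_nat CARD('n)"]) (auto simp: cup_append)
    next
      fix x assume us: "us = [x]"
      then have e: "x = c" "d = (\<not> c)" "u = c # w0" "v0 = v @ [c]" using 2 by auto
      have "(\<Sum>a\<in>UNIV. cup (length v0) \<eta> (i @ a # a # j)) = 1 * \<eta> (i @ j)"
        if ij: "length i = length v" "length j = length u" for i j
      proof -
        obtain f j0 where j: "j = f # j0" using ij e by (cases j) auto
        have "cup (length v0) \<eta> (i @ a # a # j) = (if a = f then \<eta> (i @ a # j0) else 0)" for a
          using cup_append[of "i @ [a]" "length v0" \<eta> a f j0] ij e j by simp
        then show ?thesis by (simp add: j)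
      qed
      then show ?thesis using nc_cup.hyps e by (intro exI[of _ \<eta>] exI[of _ 1]) auto
    next
      fix x y us' assume us: "us = x # y # us'"
      then have e: "x = c" "y = (\<not> c)" "u = us' @ d # (\<not> d) # w0" "v0 = v @ c # (\<not> c) # us'" using 2 by auto
      obtain \<eta>' k where IH: "nc (v @ us' @ w0) \<eta>'"
        "\<And>i j. length i = length v \<Longrightarrow> length j = length (us' @ w0) \<Longrightarrow> (\<Sum>a\<in>UNIV. \<eta> (i @ a # a # j)) = k * \<eta>' (i @ j)"
        using nc_cup.IH[of v c "us' @ w0"] e by auto
      have "(\<Sum>a\<in>UNIV. cup (length v0) \<eta> (i @ a # a # j)) = k * cup (length (v @ us')) \<eta>' (i @ j)"
        if ij: "length i = length v" "length j = length u" for i j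
      proof -
        obtain j0 f g j1 where j: "j = j0 @ f # g # j1" "length j0 = length us'" "length j1 = length w0"
        proof -
          have "length j = length us' + Suc (Suc (length w0))" using ij e by simp
          then show ?thesis
            by (intro that[of "take (length us') j" "j ! length us'" "j ! Suc (length us')" "drop (Suc (Suc (length us'))) j"])
              (simp_all add: id_take_nth_drop[symmetric] Cons_nth_drop_Suc)
        qed
        have "cup (length v0) \<eta> (i @ a # a # j) = (if f = g then \<eta> (i @ a # a # j0 @ j1) else 0)" for a
          using cup_append[of "i @ a # a # j0" "length v0" \<eta> f g j1] ij e j by simp
        moreover have "cup (length (v @ us')) \<eta>' (i @ j) = (if f = g then \<eta>' (i @ j0 @ j1) else 0)"
          using cup_append[of "i @ j0" "length (v @ us')" \<eta>' f g j1] ij j by simp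
        ultimately show ?thesis using IH(2)[of i "j0 @ j1"] ij j by (cases "f = g") simp_all
      qed
      moreover have "nc ((v @ us') @ d # (\<not> d) # w0) (cup (length (v @ us')) \<eta>')"
        using IH(1) by (intro nc.nc_cup) simp
      ultimately show ?thesis using e by (intro exI[of _ "cup (length (v @ us')) \<eta>'"] exI[of _ k]) auto
    qed
  qed
qed

lemma sum_idx_cup:
  fixes f :: "'n::finite list \<Rightarrow> 'b::ab_group_add"
  shows "(\<Sum>l\<in>ix (v @ c # d # w). f l) =
    (\<Sum>i\<in>ix v. \<Sum>a\<in>UNIV. \<Sum>b\<in>UNIV. \<Sum>j\<in>ix w. f (i @ a # b # j))"
  by (simp only: length_append sum_idx_add length_Cons sum_idx_Suc)

lemma sum_cup:
  fixes \<eta> :: "'n::finite list \<Rightarrow> complex"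
  shows "(\<Sum>l\<in>ix (v @ c # d # w). f l * cup (length v) \<eta> l) =
    (\<Sum>i\<in>ix v. \<Sum>j\<in>ix w. (\<Sum>a\<in>UNIV. f (i @ a # a # j)) * \<eta> (i @ j))"
proof -
  have "(\<Sum>a\<in>UNIV. \<Sum>b\<in>UNIV. \<Sum>j\<in>ix w. f (i @ a # b # j) * cup (length v) \<eta> (i @ a # b # j)) =
      (\<Sum>j\<in>ix w. (\<Sum>a\<in>UNIV. f (i @ a # a # j)) * \<eta> (i @ j))" if "length i = length v" for i
  proof -
    have "(\<Sum>b\<in>UNIV. \<Sum>j\<in>ix w. f (i @ a # b # j) * cup (length v) \<eta> (i @ a # b # j)) =
       (\<Sum>b\<in>UNIV. \<Sum>j\<in>ix w. if a = b then f (i @ a # b # j) * \<eta> (i @ j) else 0)" for a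
      using that by (intro sum.cong refl) (simp add: cup_append)
    then show ?thesis
      unfolding sum_distrib_right by (simp add: sum_delta_outer sum.swap[of _ "idx _"])
  qed
  then show ?thesis unfolding sum_idx_cup by simp
qed

text \<open>Pairing with the last inserted cup applies the matching cap to
  \<open>\<xi>\<close>.\<close>

lemma capfree_orth_nc:
  assumes "nc w \<eta>" "capfree w \<xi>" "w \<noteq> []"
  shows "(\<Sum>i\<in>ix w. cnj (\<eta> i) * \<xi> i) = 0"
  using assms(1)
proof cases
  case nc_Nil
  then show ?thesis using assms by simp
next
  case (nc_cup v u \<eta>' c)
  have "(\<Sum>i\<in>ix w. cnj (\<eta> i) * \<xi> i) = (\<Sum>l\<in>ix (v @ c # (\<not> c) # u). \<xi> l * cup (length v) (\<lambda>l. cnj (\<eta>' l)) l)"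
    unfolding nc_cup by (intro sum.cong refl) (simp add: cup_def)
  also have "\<dots> = 0"
    unfolding sum_cup using assms(2) nc_cup by (intro sum.neutral ballI) (simp add: capfreeD)
  finally show ?thesis .
qed

section \<open>Projections onto the spans of noncrossing pairings\<close>

text \<open>Gram--Schmidt, one vector at a time. The function \<open>g\<close> records that the
  columns of \<open>P\<close> lie in the span of \<open>B\<close>.\<close>

lemma projection_exists:
  fixes B :: "('i \<Rightarrow> complex) set"
  assumes "finite I" "finite B"
  shows "\<exists>P g. (\<forall>i\<in>I. \<forall>j\<in>I. cnj (P i j) = P j i) \<and> (\<forall>\<eta>\<in>B. \<forall>i\<in>I. (\<Sum>j\<in>I. P i j * \<eta> j) = \<eta> i) \<and>
    (\<forall>i\<in>I. \<forall>j\<in>I. P i j = (\<Sum>\<eta>\<in>B. \<eta> i * g \<eta> j))"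
  using assms(2)
proof induction
  case empty
  show ?case by (intro exI[of _ "\<lambda>_ _. 0"] exI) auto
next
  case (insert v B)
  then obtain P g where herm: "\<And>i j. i \<in> I \<Longrightarrow> j \<in> I \<Longrightarrow> cnj (P i j) = P j i"
    and fixB: "\<And>\<eta> i. \<eta> \<in> B \<Longrightarrow> i \<in> I \<Longrightarrow> (\<Sum>j\<in>I. P i j * \<eta> j) = \<eta> i"
    and comb: "\<And>i j. i \<in> I \<Longrightarrow> j \<in> I \<Longrightarrow> P i j = (\<Sum>\<eta>\<in>B. \<eta> i * g \<eta> j)" by blast
  define v' where "v' = (\<lambda>i. v i - (\<Sum>j\<in>I. P i j * v j))"
  define q where "q = (\<Sum>i\<in>I. cnj (v' i) * v' i)"
  have orth: "(\<Sum>i\<in>I. cnj (v' i) * \<eta> i) = 0" if \<eta>: "\<eta> \<in> B" for \<eta>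
  proof -
    have "(\<Sum>i\<in>I. cnj (v' i) * \<eta> i) = (\<Sum>i\<in>I. cnj (v i) * \<eta> i) - (\<Sum>i\<in>I. \<Sum>j\<in>I. P j i * cnj (v j) * \<eta> i)"
      by (simp add: v'_def left_diff_distrib sum_subtractf sum_distrib_right herm)
    also have "(\<Sum>i\<in>I. \<Sum>j\<in>I. P j i * cnj (v j) * \<eta> i) = (\<Sum>j\<in>I. cnj (v j) * (\<Sum>i\<in>I. P j i * \<eta> i))"
      unfolding sum_distrib_left by (subst sum.swap) (simp add: mult_ac)
    also have "\<dots> = (\<Sum>j\<in>I. cnj (v j) * \<eta> j)" using fixB[OF \<eta>] by simp
    finally show ?thesis by simp
  qed
  show ?case
  proof (cases "q = 0")
    \<comment> \<open>The new vector already lies in the span, so the projection stays as it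
      is.\<close>
    case True
    have "q = of_real (\<Sum>i\<in>I. (cmod (v' i))\<^sup>2)"
      unfolding q_def of_real_sum by (intro sum.cong refl) (simp only: complex_norm_square mult.commute)
    then have "(\<Sum>i\<in>I. (cmod (v' i))\<^sup>2) = 0" using True by (metis of_real_eq_0_iff)
    then have "v' i = 0" if "i \<in> I" for i
      using that assms(1) by (subst (asm) sum_nonneg_eq_0_iff) auto
    then have "(\<Sum>j\<in>I. P i j * v j) = v i" if "i \<in> I" for i
      using that by (simp add: v'_def)
    moreover have "P i j = (\<Sum>\<eta>\<in>insert v B. \<eta> i * (if \<eta> = v then 0 else g \<eta> j))" if "i \<in> I" "j \<in> I" for i j
      using that insert.hyps comb by (auto intro!: sum.cong)
    ultimately show ?thesis
      using herm fixB by (intro exI[of _ P] exI[of _ "\<lambda>\<eta> j. if \<eta> = v then 0 else g \<eta> j"]) auto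
  next
    case False
    have cq: "cnj q = q" by (simp add: q_def mult.commute)
    define P' where "P' = (\<lambda>i j. P i j + v' i * cnj (v' j) / q)"
    define g' where "g' = (\<lambda>\<eta> j. if \<eta> = v then cnj (v' j) / q else g \<eta> j - (\<Sum>k\<in>I. g \<eta> k * v k) * cnj (v' j) / q)"
    have P'\<eta>: "(\<Sum>j\<in>I. P' i j * \<eta> j) = (\<Sum>j\<in>I. P i j * \<eta> j) + v' i * (\<Sum>j\<in>I. cnj (v' j) * \<eta> j) / q" for i \<eta>
      by (simp add: P'_def distrib_left distrib_right sum.distrib sum_distrib_left sum_divide_distrib mult_ac)
    have "(\<Sum>j\<in>I. cnj (v' j) * v j) = q"
    proof -
      have "(\<Sum>j\<in>I. cnj (v' j) * (\<Sum>k\<in>I. P j k * v k)) =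
          (\<Sum>j\<in>I. cnj (v' j) * (\<Sum>\<eta>\<in>B. \<eta> j * (\<Sum>k\<in>I. g \<eta> k * v k)))"
        by (intro sum.cong refl arg_cong2[where f = "(*)"])
          (simp add: comb sum_distrib_left sum_distrib_right mult.assoc sum.swap[of _ I])
      also have "\<dots> = (\<Sum>\<eta>\<in>B. (\<Sum>j\<in>I. cnj (v' j) * \<eta> j) * (\<Sum>k\<in>I. g \<eta> k * v k))"
        unfolding sum_distrib_left[of "cnj _"] sum_distrib_right by (subst sum.swap) (simp add: mult.assoc)
      also have "\<dots> = 0" by (simp add: orth)
      finally have "(\<Sum>j\<in>I. cnj (v' j) * v j) = (\<Sum>j\<in>I. cnj (v' j) * v j) - (\<Sum>j\<in>I. cnj (v' j) * (\<Sum>k\<in>I. P j k * v k))"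
        by simp
      also have "\<dots> = q"
        unfolding q_def sum_subtractf[symmetric] right_diff_distrib[symmetric] by (simp add: v'_def)
      finally show ?thesis .
    qed
    then have 1: "(\<Sum>j\<in>I. P' i j * v j) = v i" for i
      unfolding P'\<eta> using False by (simp add: v'_def)
    have 2: "(\<Sum>j\<in>I. P' i j * \<eta> j) = \<eta> i" if "\<eta> \<in> B" "i \<in> I" for \<eta> i
      unfolding P'\<eta> using that by (simp add: orth fixB)
    have 3: "P' i j = (\<Sum>\<eta>\<in>insert v B. \<eta> i * g' \<eta> j)" if ij: "i \<in> I" "j \<in> I" for i j
    proof -
      have "(\<Sum>k\<in>I. P i k * v k) = (\<Sum>\<eta>\<in>B. \<eta> i * (\<Sum>k\<in>I. g \<eta> k * v k))"
        using ij by (simp add: comb sum_distrib_left sum_distrib_right mult.assoc sum.swap[of _ I])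
      then have v'i: "v' i = v i - (\<Sum>\<eta>\<in>B. \<eta> i * (\<Sum>k\<in>I. g \<eta> k * v k))" by (simp add: v'_def)
      have "(\<Sum>\<eta>\<in>insert v B. \<eta> i * g' \<eta> j) = v i * (cnj (v' j) / q) +
          (\<Sum>\<eta>\<in>B. \<eta> i * (g \<eta> j - (\<Sum>k\<in>I. g \<eta> k * v k) * cnj (v' j) / q))"
        using insert.hyps by (auto simp: g'_def intro!: sum.cong)
      also have "(\<Sum>\<eta>\<in>B. \<eta> i * (g \<eta> j - (\<Sum>k\<in>I. g \<eta> k * v k) * cnj (v' j) / q)) =
          P i j - (\<Sum>\<eta>\<in>B. \<eta> i * (\<Sum>k\<in>I. g \<eta> k * v k)) * (cnj (v' j) / q)"
        unfolding comb[OF ij] sum_distrib_right[of _ B] sum_subtractf[symmetric]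
        by (intro sum.cong refl) (simp add: right_diff_distrib)
      finally show ?thesis by (simp add: P'_def v'i left_diff_distrib algebra_simps diff_divide_distrib)
    qed
    have 4: "cnj (P' i j) = P' j i" if "i \<in> I" "j \<in> I" for i j
      using that herm cq by (simp add: P'_def mult.commute)
    show ?thesis
    proof (intro exI[of _ P'] exI[of _ g'] conjI ballI)
      show "(\<Sum>j\<in>I. P' i j * \<eta> j) = \<eta> i" if "\<eta> \<in> insert v B" "i \<in> I" for \<eta> i
        using that 1 2 by blast
    qed (rule 4 3; assumption)+
  qed
qed

definition is_nc_proj :: "bool list \<Rightarrow> ('n::finite list \<Rightarrow> 'n list \<Rightarrow> complex) \<Rightarrow> (('n list \<Rightarrow> complex) \<Rightarrow> 'n list \<Rightarrow> complex) \<Rightarrow> bool" where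
  "is_nc_proj w P g \<longleftrightarrow> (\<forall>i\<in>ix w. \<forall>j\<in>ix w. cnj (P i j) = P j i) \<and>
    (\<forall>\<eta>\<in>{\<eta>. nc w \<eta>}. \<forall>i\<in>ix w. (\<Sum>j\<in>ix w. P i j * \<eta> j) = \<eta> i) \<and>
    (\<forall>i\<in>ix w. \<forall>j\<in>ix w. P i j = (\<Sum>\<eta>\<in>{\<eta>. nc w \<eta>}. \<eta> i * g \<eta> j))"

text \<open>The Haar integrals of the coefficients of \<open>w\<close> for the free unitary quantum
  group: the Weingarten formula expressed through a projection. On lists of the right length the
  choice is unambiguous, as an orthogonal projection is determined by its range.\<close>

definition nc_proj :: "bool list \<Rightarrow> 'n::finite list \<Rightarrow> 'n list \<Rightarrow> complex" where
  "nc_proj w = (SOME P. \<exists>g. is_nc_proj w P g)"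

lemma nc_proj: "\<exists>g. is_nc_proj w (nc_proj w :: 'n::finite list \<Rightarrow> 'n list \<Rightarrow> complex) g"
proof -
  have "\<exists>(P :: 'n list \<Rightarrow> 'n list \<Rightarrow> complex) g. is_nc_proj w P g"
    unfolding is_nc_proj_def by (rule projection_exists[OF finite_idx finite_nc])
  then show ?thesis unfolding nc_proj_def by (rule someI_ex)
qed

lemma nc_proj_herm:
  fixes i j :: "'n::finite list"
  assumes "length i = length w" "length j = length w"
  shows "cnj (nc_proj w i j) = nc_proj w j i"
proof -
  obtain g where P: "is_nc_proj w (nc_proj w :: 'n list \<Rightarrow> 'n list \<Rightarrow> complex) g" using nc_proj by blast
  show ?thesis using P[unfolded is_nc_proj_def, THEN conjunct1] assms by simp
qed

lemma nc_proj_fix: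
  fixes i :: "'n::finite list"
  assumes "nc w \<eta>" "length i = length w"
  shows "(\<Sum>j\<in>ix w. nc_proj w i j * \<eta> j) = \<eta> i"
proof -
  obtain g where P: "is_nc_proj w (nc_proj w :: 'n list \<Rightarrow> 'n list \<Rightarrow> complex) g" using nc_proj by blast
  show ?thesis using P[unfolded is_nc_proj_def, THEN conjunct2, THEN conjunct1] assms by simp
qed

lemma nc_proj_comb:
  obtains g where "\<And>i j :: 'n::finite list. length i = length w \<Longrightarrow> length j = length w \<Longrightarrow>
    nc_proj w i j = (\<Sum>\<eta>\<in>{\<eta>. nc w \<eta>}. \<eta> i * g \<eta> j)"
proof -
  obtain g where "is_nc_proj w (nc_proj w :: 'n list \<Rightarrow> 'n list \<Rightarrow> complex) g" using nc_proj by blast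
  then show ?thesis by (intro that[of g]) (simp add: is_nc_proj_def)
qed

lemma nc_proj_orth:
  fixes \<zeta> :: "'n::finite list \<Rightarrow> complex"
  assumes orth: "\<And>\<eta>. nc w \<eta> \<Longrightarrow> (\<Sum>i\<in>ix w. cnj (\<eta> i) * \<zeta> i) = 0" and i: "length i = length w"
  shows "(\<Sum>j\<in>ix w. nc_proj w i j * \<zeta> j) = 0"
proof -
  obtain g where g: "\<And>i j :: 'n list. length i = length w \<Longrightarrow> length j = length w \<Longrightarrow>
    nc_proj w i j = (\<Sum>\<eta>\<in>{\<eta>. nc w \<eta>}. \<eta> i * g \<eta> j)" using nc_proj_comb by blast
  have "(\<Sum>j\<in>ix w. nc_proj w i j * \<zeta> j) = (\<Sum>j\<in>ix w. cnj (nc_proj w j i) * \<zeta> j)"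
    using i by (simp add: nc_proj_herm)
  also have "\<dots> = (\<Sum>\<eta>\<in>{\<eta>. nc w \<eta>}. cnj (g \<eta> i) * (\<Sum>j\<in>ix w. cnj (\<eta> j) * \<zeta> j))"
    using i unfolding sum_distrib_left by (subst sum.swap) (simp add: g sum_distrib_left sum_distrib_right mult_ac)
  also have "\<dots> = 0" using orth by simp
  finally show ?thesis .
qed

lemma nc_proj_Nil [simp]: "nc_proj [] [] [] = 1"
  using nc_proj_fix[OF nc_Nil, of "[]"] by simp

text \<open>Inserting a cup preserves noncrossing pairings, and so does its adjoint, the cap, up to
  a factor, by \<open>nc_cap\<close>. Hence the cup respects the spans and their orthogonal
  complements and intertwines the two projections. For the Haar functional this means that the
  unitarity relators are sent to zero.\<close>

lemma nc_proj_cup: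
  fixes i1 i2 j1 j2 :: "'n::finite list"
  assumes "length i1 = length v" "length j1 = length v" "length i2 = length w" "length j2 = length w"
  shows "(\<Sum>k\<in>UNIV. nc_proj (v @ c # (\<not> c) # w) (i1 @ a # b # i2) (j1 @ k # k # j2)) =
    (if a = b then nc_proj (v @ w) (i1 @ i2) (j1 @ j2) else 0)"
proof -
  let ?W = "v @ c # (\<not> c) # w" and ?I = "i1 @ a # b # i2"
  let ?P = "nc_proj (v @ w) :: 'n list \<Rightarrow> 'n list \<Rightarrow> complex"
  let ?j = "j1 @ j2"
  have I: "length ?I = length ?W" using assms by simp
  obtain g where g: "\<And>i j :: 'n list. length i = length (v @ w) \<Longrightarrow> length j = length (v @ w) \<Longrightarrow>
    ?P i j = (\<Sum>\<eta>\<in>{\<eta>. nc (v @ w) \<eta>}. \<eta> i * g \<eta> j)" using nc_proj_comb by blast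
  have cup_P: "cup (length v) (\<lambda>m. ?P m ?j) l = (\<Sum>\<eta>\<in>{\<eta>. nc (v @ w) \<eta>}. cup (length v) \<eta> l * g \<eta> ?j)"
    if "length l = length ?W" for l
  proof -
    have "length (take (length v) l @ drop (Suc (Suc (length v))) l) = length (v @ w)" using that by simp
    from g[OF this, of ?j] show ?thesis using assms unfolding cup_def by simp
  qed
  \<comment> \<open>The basis vector at \<open>?j\<close> minus its projection; its cup is
    orthogonal to all pairings of the longer word.\<close>
  define \<zeta> where "\<zeta> = (\<lambda>m. (if m = ?j then 1 else 0) - ?P m ?j)"
  have orth: "(\<Sum>m\<in>ix (v @ w). cnj (\<eta> m) * \<zeta> m) = 0" if \<eta>: "nc (v @ w) \<eta>" for \<eta>
  proof -
    have "(\<Sum>m\<in>ix (v @ w). cnj (\<eta> m) * ?P m ?j) = cnj (\<Sum>m\<in>ix (v @ w). ?P ?j m * \<eta> m)"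
      using assms unfolding cnj_sum by (intro sum.cong refl) (simp add: nc_proj_herm mult.commute)
    also have "\<dots> = cnj (\<eta> ?j)" using assms by (subst nc_proj_fix[OF \<eta>]) auto
    finally have "(\<Sum>m\<in>ix (v @ w). cnj (\<eta> m) * ?P m ?j) = cnj (\<eta> ?j)" .
    moreover have "cnj (\<eta> m) * \<zeta> m = (if m = ?j then cnj (\<eta> m) else 0) - cnj (\<eta> m) * ?P m ?j" for m
      by (simp add: \<zeta>_def right_diff_distrib)
    ultimately show ?thesis using assms by (simp add: sum_subtractf)
  qed
  have "(\<Sum>l\<in>ix ?W. nc_proj ?W ?I l * cup (length v) \<zeta> l) = 0"
  proof (rule nc_proj_orth[OF _ I])
    fix \<eta> :: "'n list \<Rightarrow> complex" assume "nc ?W \<eta>"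
    then obtain \<eta>' k where \<eta>': "nc (v @ w) \<eta>'" "\<And>i j. length i = length v \<Longrightarrow> length j = length w \<Longrightarrow>
        (\<Sum>a\<in>UNIV. \<eta> (i @ a # a # j)) = k * \<eta>' (i @ j)" using nc_cap by blast
    have "(\<Sum>l\<in>ix ?W. cnj (\<eta> l) * cup (length v) \<zeta> l) =
        (\<Sum>i\<in>ix v. \<Sum>j\<in>ix w. cnj k * cnj (\<eta>' (i @ j)) * \<zeta> (i @ j))"
      unfolding sum_cup by (intro sum.cong refl) (simp add: \<eta>'(2) flip: cnj_sum)
    also have "\<dots> = cnj k * (\<Sum>m\<in>ix (v @ w). cnj (\<eta>' m) * \<zeta> m)"
      by (simp add: sum_idx_add sum_distrib_left mult.assoc)
    finally show "(\<Sum>l\<in>ix ?W. cnj (\<eta> l) * cup (length v) \<zeta> l) = 0"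
      using orth[OF \<eta>'(1)] by simp
  qed
  moreover have "cup (length v) \<zeta> l = cup (length v) (\<lambda>m. if m = ?j then 1 else 0) l - cup (length v) (\<lambda>m. ?P m ?j) l" for l
    by (simp add: cup_def \<zeta>_def)
  ultimately have "(\<Sum>l\<in>ix ?W. nc_proj ?W ?I l * cup (length v) (\<lambda>m. if m = ?j then 1 else 0) l) =
      (\<Sum>l\<in>ix ?W. nc_proj ?W ?I l * cup (length v) (\<lambda>m. ?P m ?j) l)"
    by (simp add: right_diff_distrib sum_subtractf)
  also have "\<dots> = (\<Sum>\<eta>\<in>{\<eta>. nc (v @ w) \<eta>}. (\<Sum>l\<in>ix ?W. nc_proj ?W ?I l * cup (length v) \<eta> l) * g \<eta> ?j)"
    unfolding sum_distrib_right
    by (subst sum.swap, rule sum.cong[OF refl]) (simp add: cup_P sum_distrib_left mult.assoc)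
  also have "\<dots> = (\<Sum>\<eta>\<in>{\<eta>. nc (v @ w) \<eta>}. cup (length v) \<eta> ?I * g \<eta> ?j)"
    using nc_proj_fix[OF nc_cup I] by (intro sum.cong refl) simp
  also have "\<dots> = cup (length v) (\<lambda>m. ?P m ?j) ?I" using cup_P[OF I] by simp
  also have "\<dots> = (if a = b then ?P (i1 @ i2) ?j else 0)" using assms by (simp add: cup_append)
  also have "(\<Sum>l\<in>ix ?W. nc_proj ?W ?I l * cup (length v) (\<lambda>m. if m = ?j then 1 else 0) l) =
      (\<Sum>k\<in>UNIV. nc_proj ?W ?I (j1 @ k # k # j2))"
  proof -
    have "(\<Sum>l\<in>ix ?W. nc_proj ?W ?I l * cup (length v) (\<lambda>m. if m = ?j then 1 else 0) l) =
        (\<Sum>i\<in>ix v. \<Sum>j\<in>ix w. if j = j2 then if i = j1 then (\<Sum>k\<in>UNIV. nc_proj ?W ?I (i @ k # k # j)) else 0 else 0)"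
      unfolding sum_cup using assms by (intro sum.cong refl) auto
    also have "\<dots> = (\<Sum>k\<in>UNIV. nc_proj ?W ?I (j1 @ k # k # j2))" using assms by simp
    finally show ?thesis .
  qed
  finally show ?thesis .
qed

lemma nc_proj_cup':
  fixes i1 i2 j1 j2 :: "'n::finite list"
  assumes "length i1 = length v" "length j1 = length v" "length i2 = length w" "length j2 = length w"
  shows "(\<Sum>k\<in>UNIV. nc_proj (v @ c # (\<not> c) # w) (i1 @ k # k # i2) (j1 @ a # b # j2)) =
    (if a = b then nc_proj (v @ w) (i1 @ i2) (j1 @ j2) else 0)"
proof -
  have "(\<Sum>k\<in>UNIV. nc_proj (v @ c # (\<not> c) # w) (i1 @ k # k # i2) (j1 @ a # b # j2)) =
      cnj (\<Sum>k\<in>UNIV. nc_proj (v @ c # (\<not> c) # w) (j1 @ a # b # j2) (i1 @ k # k # i2))"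
    using assms by (simp add: nc_proj_herm)
  also have "\<dots> = (if a = b then nc_proj (v @ w) (i1 @ i2) (j1 @ j2) else 0)"
    using assms by (simp add: nc_proj_cup nc_proj_herm)
  finally show ?thesis .
qed

text \<open>The two letters under a cup are contracted by \<open>row\<close>, so inserting a cup
  preserves invariance.\<close>

lemma (in biunitary) fixed_nc: "nc w \<eta> \<Longrightarrow> fixed w \<eta>"
proof (induction rule: nc.induct)
  case nc_Nil
  show ?case by (simp add: fixed_def)
next
  case (nc_cup v w \<eta> c)
  show ?case
    unfolding fixed_def
  proof (intro allI impI)
    let ?W = "v @ c # (\<not> c) # w"
    fix l :: "'n list" assume l: "length l = length ?W"
    obtain i a b j where ij: "l = i @ a # b # j" "length i = length v" "length j = length w"
    proof -
      have "length l = length v + Suc (Suc (length w))" using l by simp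
      then show ?thesis
        by (intro that[of "take (length v) l" "l ! length v" "l ! Suc (length v)" "drop (Suc (Suc (length v))) l"])
          (simp_all add: id_take_nth_drop[symmetric] Cons_nth_drop_Suc)
    qed
    have "(\<Sum>m\<in>ix ?W. cup (length v) \<eta> m *\<^sub>C U ?W l m) =
        (\<Sum>i'\<in>ix v. \<Sum>e\<in>UNIV. \<Sum>f\<in>UNIV. \<Sum>j'\<in>ix w.
          if e = f then \<eta> (i' @ j') *\<^sub>C (U v i i' * (V c a e * (V (\<not> c) b f * U w j j'))) else 0)"
      unfolding sum_idx_cup using ij by (intro sum.cong refl) (auto simp: cup_append um_append mult.assoc)
    also have "\<dots> = (\<Sum>i'\<in>ix v. \<Sum>j'\<in>ix w. \<eta> (i' @ j') *\<^sub>C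
        (U v i i' * (\<Sum>e\<in>UNIV. V c a e * (V (\<not> c) b e * U w j j'))))"
      unfolding sum_delta_outer sum_distrib_left scaleC_sum_right
      by (intro sum.cong refl sum.swap)
    also have "\<dots> = (if a = b then \<Sum>m\<in>ix (v @ w). \<eta> m *\<^sub>C U (v @ w) (i @ j) m else 0)"
      unfolding row_mult using ij by (simp add: sum_idx_add um_append)
    also have "\<dots> = (if a = b then \<eta> (i @ j) *\<^sub>C 1 else 0)"
      using fixedD[OF nc_cup.IH, of "i @ j"] ij by simp
    also have "\<dots> = cup (length v) \<eta> l *\<^sub>C 1" using ij by (simp add: cup_append)
    finally show "(\<Sum>m\<in>ix ?W. cup (length v) \<eta> m *\<^sub>C U ?W l m) = cup (length v) \<eta> l *\<^sub>C 1" .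
  qed
qed

section \<open>Universal *-algebras\<close>

lift_definition free_mono :: "'g star_word \<Rightarrow> 'g free_star" is "\<lambda>w. Poly_Mapping.single w 1" .

lemma free_mono_mult: "free_mono v * free_mono w = free_mono (v + w)"
  by transfer (simp add: mult_single)

lemma free_mono_0: "free_mono 0 = 1"
  by transfer simp

lemma star_free_mono: "star (free_mono w) = free_mono (word_star w)"
  by transfer (simp add: poly_star_single)

lemma free_gen_mono: "free_gen g = free_mono (Word [Gen g])"
  by transfer simp

definition lin_ext :: "('g star_word \<Rightarrow> 'b::complex_vector) \<Rightarrow> 'g free_star \<Rightarrow> 'b" where
  "lin_ext \<phi> x = (\<Sum>w\<in>Poly_Mapping.keys (Rep_free_star x). Poly_Mapping.lookup (Rep_free_star x) w *\<^sub>C \<phi> w)"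

lemma lin_ext_add: "lin_ext \<phi> (x + y) = lin_ext \<phi> x + lin_ext \<phi> y"
  unfolding lin_ext_def plus_free_star.rep_eq
  by (rule setsum_keys_plus_distrib) (simp_all add: scaleC_add_left)

lemma lin_ext_scale_mono: "lin_ext \<phi> (c *\<^sub>C free_mono w) = c *\<^sub>C \<phi> w"
  by (cases "c = 0")
    (simp_all add: lin_ext_def scaleC_free_star.rep_eq free_mono.rep_eq zero_free_star.rep_eq scaleC_single scaleC_complex_def)

lemma free_ext:
  fixes F G :: "'g free_star \<Rightarrow> 'b::ab_group_add"
  assumes "\<And>x y. F (x + y) = F x + F y" "\<And>x y. G (x + y) = G x + G y"
    and "\<And>c w. F (c *\<^sub>C free_mono w) = G (c *\<^sub>C free_mono w)"
  shows "F x = G x"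
proof -
  have mono: "Abs_free_star (Poly_Mapping.single w c) = c *\<^sub>C free_mono w" for w :: "'g star_word" and c
    by (metis Rep_free_star_inverse free_mono.rep_eq mult.right_neutral scaleC_complex_def scaleC_free_star.rep_eq scaleC_single)
  have "F (Abs_free_star (Rep_free_star x)) = G (Abs_free_star (Rep_free_star x))"
    by (rule poly_mapping_additive_ext[where F = "\<lambda>f. F (Abs_free_star f)" and G = "\<lambda>f. G (Abs_free_star f)"])
      (simp_all add: plus_free_star.abs_eq[symmetric] assms mono)
  then show ?thesis by (simp add: Rep_free_star_inverse)
qed

lemma lin_ext_scale: "lin_ext \<phi> (c *\<^sub>C x) = c *\<^sub>C lin_ext \<phi> x"
  by (rule free_ext[where x = x])
    (simp_all add: scaleC_add_right lin_ext_add lin_ext_scale_mono)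

lemma lin_ext_mono: "lin_ext \<phi> (free_mono w) = \<phi> w"
  using lin_ext_scale_mono[of \<phi> 1 w] by simp

lemma lin_ext_0 [simp]: "lin_ext \<phi> 0 = 0"
  using lin_ext_add[of \<phi> 0 0] by simp

lemma lin_ext_diff: "lin_ext \<phi> (x - y) = lin_ext \<phi> x - lin_ext \<phi> y"
  using lin_ext_add[of \<phi> "x - y" y] by simp

lemma lin_ext_sum: "lin_ext \<phi> (sum f A) = (\<Sum>x\<in>A. lin_ext \<phi> (f x))"
  by (induction A rule: infinite_finite_induct) (simp_all add: lin_ext_add)

lemma free_induct:
  assumes "\<And>c w. P (c *\<^sub>C free_mono w)" and "\<And>x y. P x \<Longrightarrow> P y \<Longrightarrow> P (x + y)"
  shows "P x"
proof -
  have x: "x = lin_ext free_mono x"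
    by (rule free_ext[where F = "\<lambda>x. x"]) (simp_all add: lin_ext_add lin_ext_scale_mono)
  have "P (\<Sum>w\<in>A. c w *\<^sub>C free_mono w)" for A and c :: "'a star_word \<Rightarrow> complex"
  proof (induction A rule: infinite_finite_induct)
    case (insert w A)
    then show ?case using assms by simp
  qed (use assms(1)[of 0 undefined] in simp_all)
  then show ?thesis by (subst x) (simp add: lin_ext_def)
qed

section \<open>Evaluation homomorphisms and the universal property\<close>

definition letter_val :: "('g \<Rightarrow> 'b::complex_star_algebra) \<Rightarrow> 'g letter \<Rightarrow> 'b" where
  "letter_val b l = (case l of Gen g \<Rightarrow> b g | Gen_star g \<Rightarrow> star (b g))"

definition word_val :: "('g \<Rightarrow> 'b::complex_star_algebra) \<Rightarrow> 'g star_word \<Rightarrow> 'b" where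
  "word_val b w = prod_list (map (letter_val b) (letters w))"

lemma word_val_plus: "word_val b (v + w) = word_val b v * word_val b w"
  by (simp add: word_val_def plus_star_word_def)

lemma star_prod_list: "star (prod_list xs) = prod_list (rev (map star xs))"
  for xs :: "'b::complex_star_algebra list"
  by (induction xs) (simp_all add: star_mult)

lemma star_word_val: "star (word_val b w) = word_val b (word_star w)"
proof -
  have "star (letter_val b l) = letter_val b (letter_star l)" for l
    by (cases l) (simp_all add: letter_val_def)
  then show ?thesis by (simp add: word_val_def word_star_def star_prod_list rev_map comp_def)
qed

definition free_eval :: "('g \<Rightarrow> 'b::complex_star_algebra) \<Rightarrow> 'g free_star \<Rightarrow> 'b" where
  "free_eval b = lin_ext (word_val b)"

lemma star_hom_iff: "star_hom \<phi> \<longleftrightarrow> (\<forall>x y. \<phi> (x + y) = \<phi> x + \<phi> y) \<and> (\<forall>c x. \<phi> (c *\<^sub>C x) = c *\<^sub>C \<phi> x) \<and>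
    \<phi> 1 = 1 \<and> (\<forall>x y. \<phi> (x * y) = \<phi> x * \<phi> y) \<and> (\<forall>x. \<phi> (star x) = star (\<phi> x))"
  by (auto simp: star_hom_def algebra_hom_def clinear_iff)

lemma free_eval_star_hom: "star_hom (free_eval b)"
  unfolding star_hom_iff
proof (intro conjI allI)
  show add: "free_eval b (x + y) = free_eval b x + free_eval b y" for x y
    by (simp add: free_eval_def lin_ext_add)
  show scale: "free_eval b (c *\<^sub>C x) = c *\<^sub>C free_eval b x" for c x
    by (simp add: free_eval_def lin_ext_scale)
  have mono: "free_eval b (free_mono w) = word_val b w" for w
    by (simp add: free_eval_def lin_ext_mono)
  show "free_eval b 1 = 1"
    unfolding free_mono_0[symmetric] mono by (simp add: word_val_def zero_star_word_def)
  show "free_eval b (x * y) = free_eval b x * free_eval b y" for x y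
  proof (rule free_ext[where x = x])
    show "free_eval b (c *\<^sub>C free_mono w * y) = free_eval b (c *\<^sub>C free_mono w) * free_eval b y" for c w
      by (rule free_ext[where x = y])
        (simp_all add: distrib_left add scale mono free_mono_mult word_val_plus scaleC_add_right)
  qed (simp_all add: distrib_right add)
  show "free_eval b (star x) = star (free_eval b x)" for x
    by (rule free_ext[where x = x])
      (simp_all add: star_add add star_scaleC scale star_free_mono mono star_word_val)
qed

lemma free_eval_gen: "free_eval b (free_gen g) = b g"
  by (simp add: free_gen_mono free_eval_def lin_ext_mono word_val_def letter_val_def)

lemma star_hom_props:
  assumes "star_hom \<phi>"
  shows "\<phi> (x + y) = \<phi> x + \<phi> y" "\<phi> (c *\<^sub>C x) = c *\<^sub>C \<phi> x" "\<phi> 1 = 1" "\<phi> (x * y) = \<phi> x * \<phi> y"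
    "\<phi> (star x) = star (\<phi> x)" "\<phi> 0 = 0" "\<phi> (x - y) = \<phi> x - \<phi> y" "\<phi> (sum f A) = (\<Sum>a\<in>A. \<phi> (f a))"
    "\<phi> (x ^ k) = \<phi> x ^ k"
proof -
  show add: "\<phi> (x + y) = \<phi> x + \<phi> y" and "\<phi> (c *\<^sub>C x) = c *\<^sub>C \<phi> x" and one: "\<phi> 1 = 1" and mult: "\<phi> (x * y) = \<phi> x * \<phi> y"
    and "\<phi> (star x) = star (\<phi> x)" for x y c
    using assms by (auto simp: star_hom_iff)
  show 0: "\<phi> 0 = 0" using add[of 0 0] by simp
  show "\<phi> (x - y) = \<phi> x - \<phi> y" using add[of "x - y" y] by simp
  show "\<phi> (sum f A) = (\<Sum>a\<in>A. \<phi> (f a))"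
    by (induction A rule: infinite_finite_induct) (simp_all add: add 0)
  show "\<phi> (x ^ k) = \<phi> x ^ k"
    by (induction k) (simp_all add: one mult)
qed

lemma abs_univ_star_hom: "star_hom (abs_univ_star :: 'g::presentation free_star \<Rightarrow> 'g univ_star)"
  unfolding star_hom_iff
  by (simp add: plus_univ_star.abs_eq scaleC_univ_star.abs_eq one_univ_star.abs_eq times_univ_star.abs_eq star_univ_star.abs_eq)

lemma rep_abs_univ_star: "rep_univ_star (abs_univ_star x) - x \<in> star_ideal relators"
  using Quotient3_rep_abs[OF Quotient3_univ_star, where r = x] by (simp add: star_ideal.zero)

lemma abs_univ_star_relator: "r \<in> relators \<Longrightarrow> abs_univ_star r = 0"
  unfolding zero_univ_star.abs_eq univ_star.abs_eq_iff by (simp add: star_ideal.base)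

lemma univ_star_hom_exists:
  fixes b :: "'g::presentation \<Rightarrow> 'b::complex_star_algebra"
  assumes "\<And>r. r \<in> relators \<Longrightarrow> free_eval b r = 0"
  shows "\<exists>\<psi>. star_hom \<psi> \<and> (\<forall>g. \<psi> (univ_gen g) = b g)"
proof -
  note ev = star_hom_props[OF free_eval_star_hom[of b]]
  have ideal: "free_eval b x = 0" if "x \<in> star_ideal relators" for x
    using that by induction (simp_all add: assms ev)
  define \<psi> where "\<psi> = (\<lambda>x. free_eval b (rep_univ_star x))"
  have abs: "\<psi> (abs_univ_star x) = free_eval b x" for x
    using ideal[OF rep_abs_univ_star[of x]] by (simp add: \<psi>_def ev)
  note ab = star_hom_props[OF abs_univ_star_hom, symmetric]
  have "star_hom \<psi>"
    unfolding star_hom_iff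
  proof (intro conjI allI)
    show "\<psi> (x + y) = \<psi> x + \<psi> y" for x y
      by (induction x rule: univ_star.abs_induct, induction y rule: univ_star.abs_induct) (simp add: ab(1) abs ev)
    show "\<psi> (x * y) = \<psi> x * \<psi> y" for x y
      by (induction x rule: univ_star.abs_induct, induction y rule: univ_star.abs_induct) (simp add: ab(4) abs ev)
    show "\<psi> (c *\<^sub>C x) = c *\<^sub>C \<psi> x" for c x
      by (induction x rule: univ_star.abs_induct) (simp add: ab(2) abs ev)
    show "\<psi> (star x) = star (\<psi> x)" for x
      by (induction x rule: univ_star.abs_induct) (simp add: ab(5) abs ev)
    show "\<psi> 1 = 1" by (simp add: ab(3) abs ev)
  qed
  moreover have "\<psi> (univ_gen g) = b g" for g
    by (simp add: univ_gen.abs_eq abs free_eval_gen)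
  ultimately show ?thesis by blast
qed

section \<open>The free unitary quantum group\<close>

lemma uc_hom: "star_hom \<phi> \<Longrightarrow> uc (\<lambda>i j. \<phi> (u i j)) c i j = \<phi> (uc u c i j)"
  by (simp add: uc_def star_hom_props)

lemma um_hom: "star_hom \<phi> \<Longrightarrow> um (\<lambda>i j. \<phi> (u i j)) w i j = \<phi> (um u w i j)"
  by (induction w arbitrary: i j) (simp_all add: um.simps star_hom_props uc_hom)

lemma biunitary_hom:
  assumes "biunitary u" "star_hom \<phi>"
  shows "biunitary (\<lambda>i j. \<phi> (u i j))"
proof -
  interpret biunitary u by fact
  note \<phi> = star_hom_props[OF assms(2)]
  show ?thesis
    by unfold_locales (simp_all add: uc_hom[OF assms(2)] \<phi>(4,8)[symmetric] row col N2 \<phi>(3,6) if_distrib[of \<phi>])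
qed

definition ufree :: "'n \<Rightarrow> 'n \<Rightarrow> 'n gen_U free_star" where
  "ufree i j = free_gen (Gen_U i j)"

definition uuniv :: "'n::finite \<Rightarrow> 'n \<Rightarrow> 'n gen_U univ_star" where
  "uuniv i j = univ_gen (Gen_U i j)"

lemma uuniv_abs: "uuniv i j = abs_univ_star (ufree i j)"
  by (simp add: uuniv_def ufree_def univ_gen.abs_eq)

text \<open>Indexing by a colour merges the relators of \<open>u\<close> and of its conjugate into
  two families of the shape of \<open>row\<close> and \<open>col\<close>.\<close>

lemma relators_U:
  "(relators :: 'n::finite gen_U free_star set) =
    {(\<Sum>k\<in>UNIV. uc ufree c i k * uc ufree (\<not> c) j k) - (if i = j then 1 else 0) |c i j. True} \<union>
    {(\<Sum>k\<in>UNIV. uc ufree c k i * uc ufree (\<not> c) k j) - (if i = j then 1 else 0) |c i j. True}"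
proof -
  have *: "{f c i j |c i j. True} = {f True i j |i j. True} \<union> {f False i j |i j. True}" for f :: "bool \<Rightarrow> 'n \<Rightarrow> 'n \<Rightarrow> 'n gen_U free_star"
    by (auto, metis (full_types))
  show ?thesis
    unfolding * by (auto simp: relators_gen_U_def Let_def unitary_relators_def mat_mult_def mat_adjoint_def mat_one_def mat_conj_def
        uc_def ufree_def)
qed

lemma uuniv_biunitary:
  assumes "CARD('n::finite) \<ge> 2"
  shows "biunitary (uuniv :: 'n \<Rightarrow> 'n \<Rightarrow> 'n gen_U univ_star)"
proof -
  note ab = star_hom_props[OF abs_univ_star_hom]
  have uc: "uc uuniv c i j = abs_univ_star (uc ufree c i j)" for c and i j :: 'n
    unfolding uuniv_abs[abs_def] by (rule uc_hom[OF abs_univ_star_hom])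
  have 1: "abs_univ_star ((\<Sum>k\<in>UNIV. uc ufree c i k * uc ufree (\<not> c) j k) - (if i = j then 1 else 0)) = 0" for c and i j :: 'n
    by (rule abs_univ_star_relator, unfold relators_U) blast
  have 2: "abs_univ_star ((\<Sum>k\<in>UNIV. uc ufree c k i * uc ufree (\<not> c) k j) - (if i = j then 1 else 0)) = 0" for c and i j :: 'n
    by (rule abs_univ_star_relator, unfold relators_U) blast
  have if_abs: "abs_univ_star (if b then 1 else 0) = (if b then 1 else 0 :: 'n gen_U univ_star)" for b
    by (simp add: ab)
  show ?thesis
    using 1 2 assms by unfold_locales (simp_all add: ab uc if_abs)
qed

text \<open>Every functional on matrix words determines a linear functional on the free *-algebra, because a
  word in the generators is exactly a matrix coefficient of a coloured word.\<close>

primrec letter_colour :: "'n gen_U letter \<Rightarrow> bool" where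
  "letter_colour (Gen g) = True"
| "letter_colour (Gen_star g) = False"

primrec gen_row :: "'n gen_U \<Rightarrow> 'n" where "gen_row (Gen_U i j) = i"
primrec gen_col :: "'n gen_U \<Rightarrow> 'n" where "gen_col (Gen_U i j) = j"

primrec letter_gen :: "'g letter \<Rightarrow> 'g" where
  "letter_gen (Gen g) = g"
| "letter_gen (Gen_star g) = g"

definition colours :: "'n gen_U star_word \<Rightarrow> bool list" where "colours w = map letter_colour (letters w)"
definition rows :: "'n gen_U star_word \<Rightarrow> 'n list" where "rows w = map (gen_row \<circ> letter_gen) (letters w)"
definition cols :: "'n gen_U star_word \<Rightarrow> 'n list" where "cols w = map (gen_col \<circ> letter_gen) (letters w)"

lemma length_rows_cols [simp]: "length (rows w) = length (colours w)" "length (cols w) = length (colours w)"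
  by (simp_all add: rows_def cols_def colours_def)

lemma free_mono_um: "free_mono w = um ufree (colours w) (rows w) (cols w)"
proof -
  have "free_mono (Word ls) = um ufree (colours (Word ls)) (rows (Word ls)) (cols (Word ls))" for ls :: "'a gen_U letter list"
  proof (induction ls)
    case Nil
    then show ?case by (simp add: colours_def free_mono_0[symmetric] zero_star_word_def)
  next
    case (Cons l ls)
    have "free_mono (Word (l # ls)) = free_mono (Word [l]) * free_mono (Word ls)"
      by (simp add: free_mono_mult plus_star_word_def)
    also have "free_mono (Word [l]) = uc ufree (letter_colour l) (gen_row (letter_gen l)) (gen_col (letter_gen l))"
    proof (cases l)
      case (Gen g)
      then show ?thesis by (cases g) (simp add: uc_def ufree_def free_gen_mono)
    next
      case (Gen_star g)
      then show ?thesis by (cases g) (simp add: uc_def ufree_def free_gen_mono star_free_mono word_star_def)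
    qed
    finally show ?case using Cons by (simp add: colours_def rows_def cols_def)
  qed
  from this[of "letters w"] show ?thesis by simp
qed

lemma um_free_mono:
  assumes "length i = length w" "length j = length w"
  shows "\<exists>v. um ufree w i j = free_mono v \<and> colours v = w \<and> rows v = i \<and> cols v = j"
  using assms
proof (induction w arbitrary: i j)
  case Nil
  then show ?case
    by (intro exI[of _ "Word []"]) (simp add: colours_def rows_def cols_def free_mono_0[symmetric] zero_star_word_def)
next
  case (Cons c w)
  then obtain a i0 b j0 where ij: "i = a # i0" "j = b # j0" "length i0 = length w" "length j0 = length w"
    by (metis length_Suc_conv)
  then obtain v where v: "um ufree w i0 j0 = free_mono v" "colours v = w" "rows v = i0" "cols v = j0"
    using Cons.IH by blast
  define l where "l = (if c then Gen (Gen_U a b) else Gen_star (Gen_U a b))"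
  have "uc ufree c a b = free_mono (Word [l])"
    by (simp add: l_def uc_def ufree_def free_gen_mono star_free_mono word_star_def)
  then have "um ufree (c # w) i j = free_mono (Word [l] + v)"
    by (simp add: ij v free_mono_mult)
  then show ?case using v ij
    by (intro exI[of _ "Word [l] + v"]) (simp add: colours_def rows_def cols_def plus_star_word_def l_def)
qed

section \<open>The Haar functional on the free *-algebra and on its quotient\<close>

definition free_h :: "'n::finite gen_U free_star \<Rightarrow> complex" where
  "free_h = lin_ext (\<lambda>w. nc_proj (colours w) (rows w) (cols w))"

lemma free_h_um: "length i = length w \<Longrightarrow> length j = length w \<Longrightarrow> free_h (um ufree w i j) = nc_proj w i j"
  using um_free_mono[of i w j] by (auto simp: free_h_def lin_ext_mono)

lemma free_h_linear:
  "free_h (x + y) = free_h x + free_h y" "free_h (c *\<^sub>C x) = c * free_h x" "free_h 0 = 0"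
  "free_h (x - y) = free_h x - free_h y" "free_h (sum f A) = (\<Sum>a\<in>A. free_h (f a))"
  by (simp_all add: free_h_def lin_ext_add lin_ext_scale lin_ext_diff lin_ext_sum scaleC_complex_def)

lemma free_h_cup:
  assumes "length i1 = length v" "length j1 = length v" "length i2 = length w" "length j2 = length w"
  shows "free_h (um ufree v i1 j1 * ((\<Sum>k\<in>UNIV. uc ufree c a k * uc ufree (\<not> c) b k) - (if a = b then 1 else 0)) * um ufree w i2 j2) = 0"
    and "free_h (um ufree v i1 j1 * ((\<Sum>k\<in>UNIV. uc ufree c k a * uc ufree (\<not> c) k b) - (if a = b then 1 else 0)) * um ufree w i2 j2) = 0"
proof -
  have um: "um ufree v i1 j1 * (uc ufree c a k * uc ufree (\<not> c) b l) * um ufree w i2 j2 =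
      um ufree (v @ c # (\<not> c) # w) (i1 @ a # b # i2) (j1 @ k # l # j2)" for a b k l
    using assms by (simp add: um_append mult.assoc)
  have d: "um ufree v i1 j1 * (if a = b then 1 else 0) * um ufree w i2 j2 =
      (if a = b then um ufree (v @ w) (i1 @ i2) (j1 @ j2) else 0)"
    using assms by (simp add: um_append)
  show "free_h (um ufree v i1 j1 * ((\<Sum>k\<in>UNIV. uc ufree c a k * uc ufree (\<not> c) b k) - (if a = b then 1 else 0)) * um ufree w i2 j2) = 0"
    unfolding right_diff_distrib left_diff_distrib sum_distrib_left sum_distrib_right um d free_h_linear
    using assms nc_proj_cup[of i1 v j1 i2 w j2 c a b] by (simp add: free_h_um free_h_linear)
  show "free_h (um ufree v i1 j1 * ((\<Sum>k\<in>UNIV. uc ufree c k a * uc ufree (\<not> c) k b) - (if a = b then 1 else 0)) * um ufree w i2 j2) = 0"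
    unfolding right_diff_distrib left_diff_distrib sum_distrib_left sum_distrib_right um d free_h_linear
    using assms nc_proj_cup'[of i1 v j1 i2 w j2 c a b] by (simp add: free_h_um free_h_linear)
qed

lemma free_h_relator:
  assumes "r \<in> relators"
  shows "free_h (x * r * y) = 0"
proof (rule free_induct[where x = x])
  fix c and v :: "'a gen_U star_word"
  show "free_h (c *\<^sub>C free_mono v * r * y) = 0"
  proof (rule free_induct[where x = y])
    fix d and w :: "'a gen_U star_word"
    have "free_h (free_mono v * r * free_mono w) = 0"
      using assms unfolding relators_U free_mono_um by (auto intro!: free_h_cup)
    then show "free_h (c *\<^sub>C free_mono v * r * d *\<^sub>C free_mono w) = 0"
      by (simp add: free_h_linear)
  qed (auto simp add: distrib_left free_h_linear)
qed (simp add: distrib_right free_h_linear)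

text \<open>Taking adjoints only exchanges \<open>i\<close> and \<open>j\<close>. In
  \<open>free_h_ideal\<close> this handles the star clause of \<open>star_ideal\<close>.\<close>

lemma star_relator_U:
  assumes "r \<in> (relators :: 'n::finite gen_U free_star set)"
  shows "star r \<in> relators"
proof -
  have d: "star (if i = j then 1 else 0 :: 'n gen_U free_star) = (if j = i then 1 else 0)" for i j :: 'n
    by simp
  have 1: "star ((\<Sum>k\<in>UNIV. uc ufree c i k * uc ufree (\<not> c) j k) - (if i = j then 1 else 0)) =
      (\<Sum>k\<in>UNIV. uc ufree c j k * uc ufree (\<not> c) i k) - (if j = i then 1 else 0)" for c and i j :: 'n
    unfolding star_diff d star_sum by (simp add: star_mult)
  have 2: "star ((\<Sum>k\<in>UNIV. uc ufree c k i * uc ufree (\<not> c) k j) - (if i = j then 1 else 0)) =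
      (\<Sum>k\<in>UNIV. uc ufree c k j * uc ufree (\<not> c) k i) - (if j = i then 1 else 0)" for c and i j :: 'n
    unfolding star_diff d star_sum by (simp add: star_mult)
  consider c i j where "r = (\<Sum>k\<in>UNIV. uc ufree c i k * uc ufree (\<not> c) j k) - (if i = j then 1 else 0)"
    | c i j where "r = (\<Sum>k\<in>UNIV. uc ufree c k i * uc ufree (\<not> c) k j) - (if i = j then 1 else 0)"
    using assms unfolding relators_U by blast
  then show ?thesis
  proof cases
    case r: 1
    show ?thesis unfolding relators_U r 1 by blast
  next
    case r: 2
    show ?thesis unfolding relators_U r 2 by blast
  qed
qed

lemma free_h_ideal:
  assumes "x \<in> star_ideal relators"
  shows "free_h x = 0"
proof -
  \<comment> \<open>The factors on both sides and the adjoint are carried along because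
    \<open>star_ideal\<close> is closed under multiplication from either side and under the
    star.\<close>
  have "\<forall>a b. free_h (a * x * b) = 0 \<and> free_h (a * star x * b) = 0"
    using assms
  proof induction
    case (base r)
    then show ?case by (simp add: free_h_relator star_relator_U)
  next
    case (add x y)
    then show ?case by (simp add: star_add distrib_left distrib_right free_h_linear)
  next
    case (left x c)
    then show ?case by (metis mult.assoc star_mult)
  next
    case (right x c)
    then show ?case by (metis mult.assoc star_mult)
  qed (simp_all add: free_h_linear)
  then have "free_h (1 * x * 1) = 0" by blast
  then show ?thesis by simp
qed

definition h_U :: "'n::finite gen_U univ_star \<Rightarrow> complex" where
  "h_U x = free_h (rep_univ_star x)"

lemma h_U_abs: "h_U (abs_univ_star x) = free_h x"
  using free_h_ideal[OF rep_abs_univ_star[of x]] by (simp add: h_U_def free_h_linear)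

lemma um_uuniv: "um uuniv w i j = abs_univ_star (um ufree w i j)"
  unfolding uuniv_abs[abs_def] by (rule um_hom[OF abs_univ_star_hom])

lemma h_U_um: "length i = length w \<Longrightarrow> length j = length w \<Longrightarrow> h_U (um uuniv w i j) = nc_proj w i j"
  by (simp add: um_uuniv h_U_abs free_h_um)

lemma uuniv_induct:
  assumes "\<And>w i j. length i = length w \<Longrightarrow> length j = length w \<Longrightarrow> P (um uuniv w i j)"
    and "\<And>x y. P x \<Longrightarrow> P y \<Longrightarrow> P (x + y)" and "\<And>c x. P x \<Longrightarrow> P (c *\<^sub>C x)"
  shows "P x"
proof (induction x rule: univ_star.abs_induct)
  case (1 x)
  note ab = star_hom_props[OF abs_univ_star_hom]
  show ?case
  proof (rule free_induct[where x = x])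
    fix c and w :: "'a gen_U star_word"
    show "P (abs_univ_star (c *\<^sub>C free_mono w))"
      unfolding ab free_mono_um um_uuniv[symmetric] by (intro assms) auto
  qed (simp add: ab assms)
qed

lemma h_U_haar_biunitary:
  assumes N: "CARD('n::finite) \<ge> 2"
  shows "haar_biunitary (uuniv :: 'n \<Rightarrow> 'n \<Rightarrow> 'n gen_U univ_star) h_U"
proof -
  interpret biunitary "uuniv :: 'n \<Rightarrow> 'n \<Rightarrow> 'n gen_U univ_star" by (rule uuniv_biunitary[OF N])
  note ab = star_hom_props[OF abs_univ_star_hom, symmetric]
  have add: "h_U (x + y) = h_U x + h_U y" for x y :: "'n gen_U univ_star"
    by (induction x rule: univ_star.abs_induct, induction y rule: univ_star.abs_induct)
      (simp add: ab(1) h_U_abs free_h_linear)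
  have scale: "h_U (c *\<^sub>C x) = c * h_U x" for c and x :: "'n gen_U univ_star"
    by (induction x rule: univ_star.abs_induct) (simp add: ab(2) h_U_abs free_h_linear)
  show ?thesis
  proof (intro haar_biunitary.intro haar_biunitary_axioms.intro)
    show "biunitary (uuniv :: 'n \<Rightarrow> 'n \<Rightarrow> 'n gen_U univ_star)"
      by (rule uuniv_biunitary[OF N])
    show "clinear (h_U :: 'n gen_U univ_star \<Rightarrow> complex)"
      by (simp add: clinear_iff add scale scaleC_complex_def)
    show "h_U (1 :: 'n gen_U univ_star) = 1"
      using h_U_um[of "[] :: 'n list" "[]" "[]"] by simp
    fix w :: "bool list" and i j :: "'n list" assume ij: "length i = length w" "length j = length w"
    show "cnj (h_U (um uuniv w i j)) = h_U (um uuniv w j i)"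
      using ij by (simp add: h_U_um nc_proj_herm)
    obtain g where g: "\<And>i j :: 'n list. length i = length w \<Longrightarrow> length j = length w \<Longrightarrow>
      nc_proj w i j = (\<Sum>\<eta>\<in>{\<eta>. nc w \<eta>}. \<eta> i * g \<eta> j)" using nc_proj_comb by blast
    \<comment> \<open>Columns of the projection are combinations of noncrossing pairings, which are
      invariant for every \<open>biunitary\<close> matrix.\<close>
    have "(\<Sum>k\<in>ix w. nc_proj w k j *\<^sub>C um uuniv w i k) =
        (\<Sum>\<eta>\<in>{\<eta>. nc w \<eta>}. g \<eta> j *\<^sub>C (\<Sum>k\<in>ix w. \<eta> k *\<^sub>C um uuniv w i k))"
      using ij unfolding scaleC_sum_right
      by (subst sum.swap) (simp add: g scaleC_sum_left mult.commute)
    also have "\<dots> = (\<Sum>\<eta>\<in>{\<eta>. nc w \<eta>}. (\<eta> i * g \<eta> j) *\<^sub>C 1)"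
      using ij by (intro sum.cong refl) (simp add: fixedD[OF fixed_nc] mult.commute)
    also have "\<dots> = nc_proj w i j *\<^sub>C 1"
      using ij by (simp add: g scaleC_sum_left)
    finally show "(\<Sum>k\<in>ix w. h_U (um uuniv w k j) *\<^sub>C um uuniv w i k) = h_U (um uuniv w i j) *\<^sub>C 1"
      using ij by (simp add: h_U_um)
  qed
qed

text \<open>The integrals under \<open>h_U\<close> form the projection onto noncrossing pairings. It
  fixes every invariant vector and annihilates every cap-free one on a nonempty word.\<close>

lemma inv_words_uuniv:
  assumes N: "CARD('n::finite) \<ge> 2"
  shows "biunitary.inv_words (uuniv :: 'n \<Rightarrow> 'n \<Rightarrow> 'n gen_U univ_star) \<subseteq> {[]}"
proof
  interpret haar_biunitary "uuniv :: 'n \<Rightarrow> 'n \<Rightarrow> 'n gen_U univ_star" h_U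
    by (rule h_U_haar_biunitary[OF N])
  fix w assume "w \<in> inv_words"
  then obtain \<xi> i where \<xi>: "fixed w \<xi>" "capfree w \<xi>" "length i = length w" "\<xi> i \<noteq> 0"
    by (auto simp: inv_words_def)
  have "w = []"
  proof (rule ccontr)
    assume "w \<noteq> []"
    then have "(\<Sum>j\<in>ix w. nc_proj w i j * \<xi> j) = 0"
      using \<xi> by (intro nc_proj_orth capfree_orth_nc) auto
    moreover have "(\<Sum>j\<in>ix w. nc_proj w i j * \<xi> j) = \<xi> i"
      using fixed_h[OF \<xi>(1,3)] \<xi>(3) by (simp add: h_U_um)
    ultimately show False using \<xi>(4) by simp
  qed
  then show "w \<in> {[]}" by simp
qed

section \<open>Haar states\<close>

lemma tensor_zero [simp]: "(0 :: 'a::complex_vector) \<otimes>\<^sub>C b = 0" "a \<otimes>\<^sub>C (0 :: 'b::complex_vector) = 0"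
  using tensor_add_left[of 0 0 b] tensor_add_right[of a 0 0] by simp_all

lemma tensor_sum_left: "(\<Sum>x\<in>A. f x) \<otimes>\<^sub>C b = (\<Sum>x\<in>A. f x \<otimes>\<^sub>C b)"
  by (induction A rule: infinite_finite_induct) (simp_all add: tensor_add_left)

lemma tensor_sum_right: "a \<otimes>\<^sub>C (\<Sum>x\<in>A. f x) = (\<Sum>x\<in>A. a \<otimes>\<^sub>C f x)"
  by (induction A rule: infinite_finite_induct) (simp_all add: tensor_add_right)

lemma tensor_lift_sum:
  assumes "balanced \<beta>"
  shows "tensor_lift \<beta> (sum f A) = (\<Sum>x\<in>A. tensor_lift \<beta> (f x))"
proof -
  have "tensor_lift \<beta> 0 = 0" using tensor_lift_add[OF assms, of 0 0] by simp
  then show ?thesis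
    by (induction A rule: infinite_finite_induct) (simp_all add: tensor_lift_add[OF assms])
qed

lemma balanced_functional:
  assumes "clinear h"
  shows "balanced (\<lambda>a b. h a *\<^sub>C b)" "balanced (\<lambda>a b. h b *\<^sub>C a)"
  using assms by (simp_all add: balanced_def clinear_iff scaleC_add_left scaleC_add_right scaleC_complex_def mult.commute)

lemma comult_uc:
  assumes "star_hom \<Delta>" "matrix_comult \<Delta> u"
  shows "\<Delta> (uc u c i j) = (\<Sum>k\<in>UNIV. uc u c i k \<otimes>\<^sub>C uc u c k j)"
  using assms(2) by (simp add: uc_def star_hom_props[OF assms(1)] matrix_comult_def star_sum star_tensor_tensor)

lemma comult_um:
  assumes "star_hom \<Delta>" "matrix_comult \<Delta> u"
  shows "length i = length w \<Longrightarrow> length j = length w \<Longrightarrow>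
    \<Delta> (um u w i j) = (\<Sum>k\<in>ix w. um u w i k \<otimes>\<^sub>C um u w k j)"
proof (induction w arbitrary: i j)
  case Nil
  then show ?case by (simp add: star_hom_props[OF assms(1)] one_tensor_def)
next
  case (Cons c w)
  then obtain a i0 b j0 where ij: "i = a # i0" "j = b # j0" "length i0 = length w" "length j0 = length w"
    by (metis length_Suc_conv)
  then show ?case
    by (simp add: star_hom_props[OF assms(1)] comult_uc[OF assms] Cons.IH sum_product tensor_times_tensor sum_idx_Suc)
qed

text \<open>Evaluating the product functional of \<open>h\<close> and \<open>h'\<close> on
  \<open>\<Delta> x\<close> in the two possible orders gives \<open>h x\<close> and
  \<open>h' x\<close>.\<close>

lemma haar_state_unique:
  assumes h: "haar_state \<Delta> h" and h': "haar_state \<Delta> h'"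
  shows "h = h'"
proof
  fix x
  have lin: "clinear h" "clinear h'" and one: "h 1 = 1" "h' 1 = 1"
    and l: "tensor_lift (\<lambda>a b. h a *\<^sub>C b) (\<Delta> x) = h x *\<^sub>C 1"
    and r: "tensor_lift (\<lambda>a b. h' b *\<^sub>C a) (\<Delta> x) = h' x *\<^sub>C 1"
    using h h' by (auto simp: haar_state_def)
  note add = lin[unfolded clinear_iff, THEN conjunct1, rule_format]
    and scale = lin[unfolded clinear_iff, THEN conjunct2, rule_format]
  note b = balanced_functional[OF lin(1)] balanced_functional[OF lin(2)]
  have "h' (tensor_lift (\<lambda>a b. h a *\<^sub>C b) t) = h (tensor_lift (\<lambda>a b. h' b *\<^sub>C a) t)" for t
    by (rule tensor_additive_ext[where t = t])
      (simp_all add: tensor_lift_add[OF b(1)] tensor_lift_add[OF b(4)] add scale tensor_lift_tensor[OF b(1)] tensor_lift_tensor[OF b(4)]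
        scaleC_complex_def mult.commute)
  from this[of "\<Delta> x"] show "h x = h' x"
    by (simp add: l r scale one scaleC_complex_def)
qed

lemma haar_eqI: "haar_state \<Delta> h \<Longrightarrow> haar \<Delta> = h"
  unfolding haar_def by (rule the_equality) (auto intro: haar_state_unique)

section \<open>The GNS seminorm of a state\<close>

locale state =
  fixes h :: "'a::complex_star_algebra \<Rightarrow> complex"
  assumes linear_h: "clinear h" and h_one: "h 1 = 1" and h_pos: "h (star x * x) \<in> \<real>\<^sub>\<ge>\<^sub>0"
begin

lemma h_add: "h (x + y) = h x + h y" and h_scale: "h (c *\<^sub>C x) = c * h x"
  using linear_h by (simp_all add: clinear_iff scaleC_complex_def)

lemma h_diff: "h (x - y) = h x - h y"
  using h_add[of "x - y" y] by simp

lemma h_minus: "h (- x) = - h x"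
  using h_scale[of "- 1" x] by simp

text \<open>The square of the GNS seminorm; a bound \<open>2 * sqrt 2\<close> for \<open>T\<close>
  therefore appears as the constant 8.\<close>

definition nrm :: "'a \<Rightarrow> real" where
  "nrm x = Re (h (star x * x))"

lemma nrm_nonneg: "nrm x \<ge> 0"
  using h_pos[of x] by (simp add: nrm_def complex_nonneg_Reals_iff)

text \<open>Polarisation: positivity at \<open>x + c *\<^sub>C 1\<close> for \<open>c = 1\<close>
  and \<open>c = \<i>\<close> determines the imaginary and the real part.\<close>

lemma h_star: "h (star x) = cnj (h x)"
proof -
  have im: "Im (h (star y * y)) = 0" for y
    using h_pos[of y] by (simp add: complex_nonneg_Reals_iff)
  have "Im (h (star (x + c *\<^sub>C 1) * (x + c *\<^sub>C 1))) = Im (c * h (star x) + cnj c * h x)" for c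
    using im[of x] by (simp add: star_add star_scaleC algebra_simps h_add h_scale h_one)
  then have "Im (c * h (star x) + cnj c * h x) = 0" for c
    unfolding im by simp
  from this[of 1] this[of \<i>] show ?thesis by (simp add: complex_eq_iff)
qed

lemma Re_h_comm: "Re (h (star x * y)) = Re (h (star y * x))"
  using h_star[of "star y * x"] by (simp add: star_mult)

lemma nrm_add: "nrm (x + c *\<^sub>C y) = nrm x + 2 * Re (c * h (star x * y)) + (cmod c)\<^sup>2 * nrm y"
proof -
  have "h (star y * x) = cnj (h (star x * y))"
    using h_star[of "star x * y"] by (simp add: star_mult)
  then have "h (star (x + c *\<^sub>C y) * (x + c *\<^sub>C y)) =
      h (star x * x) + (c * h (star x * y) + cnj (c * h (star x * y))) + of_real ((cmod c)\<^sup>2) * h (star y * y)"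
    unfolding complex_norm_square by (simp add: star_add star_scaleC algebra_simps h_add h_scale)
  then show ?thesis by (simp add: nrm_def)
qed

lemma cauchy_schwarz: "(Re (h (star x * y)))\<^sup>2 \<le> nrm x * nrm y"
proof -
  define b where "b = Re (h (star x * y))"
  have q: "0 \<le> nrm x + 2 * t * b + t\<^sup>2 * nrm y" for t
    using nrm_nonneg[of "x + of_real t *\<^sub>C y"] unfolding nrm_add by (simp add: b_def)
  show ?thesis
  proof (cases "nrm y = 0")
    case True
    have "b = 0"
    proof (rule ccontr)
      assume "b \<noteq> 0"
      \<comment> \<open>With \<open>nrm y = 0\<close> the quadratic is linear in \<open>t\<close>;
        this value brings it down to -1.\<close>
      define t where "t = - (nrm x + 1) / (2 * b)"
      have "2 * t * b = - (nrm x + 1)" using \<open>b \<noteq> 0\<close> by (simp add: t_def)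
      moreover have "0 \<le> nrm x + 2 * t * b" using q[of t] True by simp
      ultimately show False by simp
    qed
    then show ?thesis using True by (simp add: b_def)
  next
    case False
    then have y: "nrm y > 0" using nrm_nonneg[of y] by simp
    have "0 \<le> nrm x - b\<^sup>2 / nrm y"
      using q[of "- b / nrm y"] y by (simp add: power2_eq_square field_simps)
    then show ?thesis using y by (simp add: b_def field_simps)
  qed
qed

lemma nrm_diff_le: "nrm (x - y) \<le> 2 * nrm x + 2 * nrm y"
proof -
  have "nrm (x - y) = nrm x - 2 * Re (h (star x * y)) + nrm y"
    using nrm_add[of x "-1" y] by simp
  moreover have "0 \<le> nrm x + 2 * Re (h (star x * y)) + nrm y"
    using nrm_nonneg[of "x + 1 *\<^sub>C y"] unfolding nrm_add by simp
  ultimately show ?thesis by simp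
qed

lemma nrm_one: "nrm 1 = 1"
  by (simp add: nrm_def h_one)

lemma nrm_scale: "nrm (of_real c *\<^sub>C x) = c\<^sup>2 * nrm x"
  by (simp add: nrm_def star_scaleC h_scale power2_eq_square)

end

section \<open>Operator norms from moments\<close>

text \<open>Successive quotients of a log-convex sequence do not decrease, so a first quotient above
  \<open>r\<close> would outgrow every \<open>C * r ^ k\<close>. This plays the part of the spectral
  radius formula: a crude bound on all powers of \<open>T\<close> sharpens to a norm bound on one
  vector.\<close>

lemma log_convex_growth:
  fixes s :: "nat \<Rightarrow> real"
  assumes nonneg: "\<And>k. s k \<ge> 0" and conv: "\<And>k. (s (Suc k))\<^sup>2 \<le> s k * s (Suc (Suc k))"
    and bound: "\<And>k. s k \<le> C * r ^ k" and r: "r > 0"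
  shows "s 1 \<le> r * s 0"
proof (rule ccontr)
  assume "\<not> ?thesis"
  then have gt: "s 1 > r * s 0" by simp
  have "s 0 \<noteq> 0" using conv[of 0] gt by auto
  then have s0: "s 0 > 0" using nonneg[of 0] by simp
  define q where "q = s 1 / s 0"
  have q: "q > r" using gt s0 by (simp add: q_def field_simps)
  have step: "s k > 0 \<and> s (Suc k) \<ge> q * s k" for k
  proof (induction k)
    case 0
    show ?case using s0 by (simp add: q_def)
  next
    case (Suc k)
    then have "s (Suc k) > 0" using q r by (smt (verit) mult_pos_pos)
    moreover have "q * s (Suc k) * s k \<le> s (Suc (Suc k)) * s k"
    proof -
      have "q * s (Suc k) * s k = s (Suc k) * (q * s k)" by simp
      also have "\<dots> \<le> s (Suc k) * s (Suc k)" using Suc \<open>s (Suc k) > 0\<close> by (intro mult_left_mono) auto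
      also have "\<dots> \<le> s (Suc (Suc k)) * s k" using conv[of k] by (simp add: power2_eq_square mult.commute)
      finally show ?thesis .
    qed
    ultimately show ?case using Suc by simp
  qed
  have "s k \<ge> q ^ k * s 0" for k
  proof (induction k)
    case (Suc k)
    have "q ^ Suc k * s 0 \<le> q * s k" using Suc q r by simp
    also have "\<dots> \<le> s (Suc k)" using step by simp
    finally show ?case .
  qed simp
  then have "q ^ k * s 0 \<le> C * r ^ k" for k using bound order_trans by blast
  then have le: "(q / r) ^ k \<le> C / s 0" for k using r s0 by (simp add: power_divide field_simps)
  have "q / r > 1" using q r by simp
  then obtain k where "C / s 0 < (q / r) ^ k" using real_arch_pow by blast
  then show False using le[of k] by simp
qed

text \<open>Log-convexity with \<open>s 0 = 1\<close> makes the roots nondecreasing, so the limit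
  exists and is the supremum; this lets \<open>lim\<close> bound every single moment.\<close>

lemma root_log_convex:
  fixes s :: "nat \<Rightarrow> real"
  assumes nonneg: "\<And>k. s k \<ge> 0" and conv: "\<And>k. (s (Suc k))\<^sup>2 \<le> s k * s (Suc (Suc k))"
    and s0: "s 0 = 1" and bound: "\<And>k. s k \<le> R ^ (2 * k)" and R: "R \<ge> 0"
  defines "N \<equiv> lim (\<lambda>k. root (2 * k) (s k))"
  shows "N \<le> R" "s k \<le> N ^ (2 * k)" "N \<ge> 0"
proof -
  define a where "a = (\<lambda>k. root (2 * k) (s k))"
  have a0: "a k \<ge> 0" for k using nonneg[of k] by (cases "k = 0") (auto simp: a_def)
  \<comment> \<open>At \<open>k = 0\<close> the convention \<open>root 0 x = 0\<close> gives
    \<open>0 ^ 0 = 1\<close>, in agreement with \<open>s 0\<close>.\<close>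
  have a_pow: "a k ^ (2 * k) = s k" for k
    using nonneg[of k] s0 by (cases "k = 0") (auto simp: a_def)
  \<comment> \<open>The comparison of consecutive roots, cleared of roots.\<close>
  have ineq: "s k ^ Suc k \<le> s (Suc k) ^ k" for k
  proof (induction k)
    case (Suc k)
    show ?case
    proof (cases "s (Suc k) = 0")
      case True
      then show ?thesis using nonneg[of "Suc (Suc k)"] by simp
    next
      case False
      then have pos: "s (Suc k) ^ k > 0" using nonneg[of "Suc k"] by simp
      have "s (Suc k) ^ k * s (Suc k) ^ Suc (Suc k) = ((s (Suc k))\<^sup>2) ^ Suc k"
        unfolding power_mult[symmetric] power_add[symmetric] by (intro arg_cong[where f = "power _"]) simp
      also have "\<dots> \<le> (s k * s (Suc (Suc k))) ^ Suc k"
        by (intro power_mono conv) simp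
      also have "\<dots> = s k ^ Suc k * s (Suc (Suc k)) ^ Suc k" by (rule power_mult_distrib)
      also have "\<dots> \<le> s (Suc k) ^ k * s (Suc (Suc k)) ^ Suc k"
        by (intro mult_right_mono Suc zero_le_power nonneg)
      finally show ?thesis using pos by (simp only: mult_le_cancel_left_pos)
    qed
  qed (simp add: s0)
  have "incseq a"
  proof (rule incseq_SucI)
    fix k
    show "a k \<le> a (Suc k)"
    proof (cases "k = 0")
      case True
      then show ?thesis using a0[of "Suc 0"] by (simp add: a_def)
    next
      case False
      have "a k ^ (2 * k * Suc k) \<le> a (Suc k) ^ (2 * Suc k * k)"
        using ineq[of k] unfolding power_mult[of "a k" "2 * k"] power_mult[of "a (Suc k)" "2 * Suc k"] a_pow .
      also have "2 * Suc k * k = 2 * k * Suc k" by simp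
      finally show ?thesis
        using False a0[of "Suc k"] power_le_imp_le_base[of "a k" "2 * k * Suc k - 1" "a (Suc k)"] by simp
    qed
  qed
  moreover have aR: "a k \<le> R" for k
  proof (cases "k = 0")
    case True
    then show ?thesis using R by (simp add: a_def)
  next
    case False
    have "a k ^ Suc (2 * k - 1) \<le> R ^ Suc (2 * k - 1)" using bound[of k] False by (simp add: a_pow)
    then show ?thesis using R by (rule power_le_imp_le_base)
  qed
  ultimately obtain L where L: "a \<longlonglongrightarrow> L" "\<And>k. a k \<le> L"
    using incseq_convergent by blast
  have N: "N = L" unfolding N_def a_def[symmetric] using L(1) by (rule limI)
  show "N \<le> R" unfolding N using L(1) by (rule LIMSEQ_le_const2) (use aR in auto)
  show "N \<ge> 0" unfolding N using order_trans[OF a0 L(2)] by blast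
  show "s k \<le> N ^ (2 * k)"
    unfolding N using power_mono[OF L(2) a0, of k "2 * k"] by (simp add: a_pow)
qed

context state
begin

text \<open>Selfadjointness of \<open>T\<close> shifts one factor from the left half to the right
  half; Cauchy--Schwarz does the rest.\<close>

lemma nrm_log_convex:
  assumes "star T = T"
  shows "(nrm (T ^ Suc k * x))\<^sup>2 \<le> nrm (T ^ k * x) * nrm (T ^ Suc (Suc k) * x)"
proof -
  have "star (T ^ Suc k * x) * (T ^ Suc k * x) = star (T ^ k * x) * (T ^ Suc (Suc k) * x)"
    by (simp add: star_mult star_power assms mult.assoc power_commutes flip: power_Suc)
      (simp add: power_commutes mult.assoc[symmetric])
  then show ?thesis
    using cauchy_schwarz[of "T ^ k * x" "T ^ Suc (Suc k) * x"] by (simp add: nrm_def)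
qed

lemma nrm_power:
  assumes "star T = T"
  shows "nrm (T ^ k) = Re (h (T ^ (2 * k)))"
  by (simp add: nrm_def star_power assms mult_2 flip: power_add)

lemma moment_norm:
  assumes T: "star T = T" and bound: "\<And>k. Re (h (T ^ (2 * k))) \<le> R ^ (2 * k)" and R: "R \<ge> 0"
  shows "lim (\<lambda>k. root (2 * k) (Re (h (T ^ (2 * k))))) \<le> R"
    and "Re (h (T ^ (2 * k))) \<le> lim (\<lambda>k. root (2 * k) (Re (h (T ^ (2 * k))))) ^ (2 * k)"
    and "lim (\<lambda>k. root (2 * k) (Re (h (T ^ (2 * k))))) \<ge> 0"
proof -
  have conv: "(nrm (T ^ Suc k))\<^sup>2 \<le> nrm (T ^ k) * nrm (T ^ Suc (Suc k))" for k
    using nrm_log_convex[OF T, of k 1] by simp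
  note * = root_log_convex[of "\<lambda>k. nrm (T ^ k)" R, OF nrm_nonneg conv]
  show "lim (\<lambda>k. root (2 * k) (Re (h (T ^ (2 * k))))) \<le> R"
    using *(1) bound R by (simp add: nrm_power[OF T] nrm_one)
  show "Re (h (T ^ (2 * k))) \<le> lim (\<lambda>k. root (2 * k) (Re (h (T ^ (2 * k))))) ^ (2 * k)"
    using *(2) bound R by (simp add: nrm_power[OF T] nrm_one)
  show "lim (\<lambda>k. root (2 * k) (Re (h (T ^ (2 * k))))) \<ge> 0"
    using *(3) bound R by (simp add: nrm_power[OF T] nrm_one)
qed

text \<open>The sequence \<open>p\<close> consists of rescaled Chebyshev polynomials of the second kind in \<open>T\<close>, and
  \<open>2 p (m + 1) - T p m\<close> of those of the first kind; the Pell equation bounds the latter.\<close>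

lemma chebyshev_bound:
  fixes p :: "nat \<Rightarrow> 'a"
  assumes T: "star T = T" and p0: "p 0 = 1" and p1: "p 1 = T"
    and rec: "\<And>d. T * p (Suc d) = p (Suc (Suc d)) + 2 *\<^sub>C p d"
    and bound: "\<And>k. Re (h (T ^ (2 * k))) \<le> 8 ^ k"
  shows "Re (h (p (2 * e))) \<le> (2 * e + 2) * 2 ^ e"
proof -
  have p2: "p (Suc (Suc d)) = T * p (Suc d) - 2 *\<^sub>C p d" for d using rec[of d] by simp
  \<comment> \<open>A crude constant for each \<open>p d\<close> is enough, since
    \<open>log_convex_growth\<close> removes it; two consecutive indices are kept for the
    recursion.\<close>
  have "(\<exists>C. \<forall>k. nrm (T ^ k * p d) \<le> C * 8 ^ k) \<and> (\<exists>C. \<forall>k. nrm (T ^ k * p (Suc d)) \<le> C * 8 ^ k)" for d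
  proof (induction d)
    case 0
    have 1: "nrm (T ^ k) \<le> 8 ^ k" for k using bound[of k] by (simp add: nrm_power[OF T])
    then have "nrm (T ^ k * p (Suc 0)) \<le> 8 * 8 ^ k" for k
      using 1[of "Suc k"] p1 by (simp add: power_commutes)
    then show ?case using 1 p0 by (intro conjI exI[of _ 1] exI[of _ 8]) auto
  next
    case (Suc d)
    then obtain C1 C2 where C: "\<And>k. nrm (T ^ k * p d) \<le> C1 * 8 ^ k" "\<And>k. nrm (T ^ k * p (Suc d)) \<le> C2 * 8 ^ k"
      by blast
    have "nrm (T ^ k * p (Suc (Suc d))) \<le> (16 * C2 + 8 * C1) * 8 ^ k" for k
    proof -
      have "T ^ k * p (Suc (Suc d)) = T ^ Suc k * p (Suc d) - of_real 2 *\<^sub>C (T ^ k * p d)"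
        by (simp add: p2 right_diff_distrib power_commutes flip: mult.assoc)
      then have "nrm (T ^ k * p (Suc (Suc d))) \<le> 2 * nrm (T ^ Suc k * p (Suc d)) + 2 * nrm (of_real 2 *\<^sub>C (T ^ k * p d))"
        using nrm_diff_le by metis
      also have "\<dots> \<le> 2 * (C2 * 8 ^ Suc k) + 8 * (C1 * 8 ^ k)"
        unfolding nrm_scale using C(1)[of k] C(2)[of "Suc k"] by simp
      finally show ?thesis by (simp add: algebra_simps)
    qed
    then show ?case using Suc by blast
  qed
  then have nT: "nrm (T * p d) \<le> 8 * nrm (p d)" for d
  proof -
    obtain C where "\<And>k. nrm (T ^ k * p d) \<le> C * 8 ^ k"
      using \<open>\<And>d. (\<exists>C. \<forall>k. nrm (T ^ k * p d) \<le> C * 8 ^ k) \<and> _ d\<close> by blast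
    from log_convex_growth[of "\<lambda>k. nrm (T ^ k * p d)", OF nrm_nonneg nrm_log_convex[OF T] this]
    show ?thesis by simp
  qed
  \<comment> \<open>One step of the recursion doubles the left-hand side; the terms
    \<open>nrm (T * p (Suc d))\<close> cancel.\<close>
  have pell: "nrm (p (Suc d)) - Re (h (star (p (Suc d)) * (T * p d))) + 2 * nrm (p d) = 2 ^ Suc d" for d
  proof (induction d)
    case 0
    then show ?case
      using p0 p1 T by (simp add: nrm_def h_one)
  next
    case (Suc d)
    let ?x = "p (Suc d)" and ?y = "p d"
    have x': "p (Suc (Suc d)) = T * ?x + (-2) *\<^sub>C ?y" by (simp add: p2)
    have c1: "star (T * ?x) * ?y = star ?x * (T * ?y)" by (simp add: star_mult T mult.assoc)
    have c2: "Re (h (star ?y * (T * ?x))) = Re (h (star ?x * (T * ?y)))"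
      using Re_h_comm[of ?y "T * ?x"] by (simp add: c1)
    have "nrm (p (Suc (Suc d))) = nrm (T * ?x) - 4 * Re (h (star ?x * (T * ?y))) + 4 * nrm ?y"
      unfolding x' nrm_add c1 by simp
    moreover have "Re (h (star (p (Suc (Suc d))) * (T * ?x))) = nrm (T * ?x) - 2 * Re (h (star ?x * (T * ?y)))"
      unfolding p2[of d] by (simp add: star_diff star_scaleC left_diff_distrib h_diff h_scale nrm_def c2)
    ultimately show ?case using Suc by simp
  qed
  have cheb: "Re (h (2 *\<^sub>C p (Suc d) - T * p d)) \<le> 2 * sqrt (2 ^ Suc d)" for d
  proof -
    let ?a = "(- 1) *\<^sub>C (T * p d) + 2 *\<^sub>C p (Suc d)"
    have "nrm ?a = nrm (T * p d) - 4 * Re (h (star (p (Suc d)) * (T * p d))) + 4 * nrm (p (Suc d))"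
      using nrm_add[of "(- 1) *\<^sub>C (T * p d)" 2 "p (Suc d)"] nrm_scale[of "-1" "T * p d"] Re_h_comm[of "T * p d" "p (Suc d)"]
      by (simp add: star_scaleC h_scale star_uminus h_minus)
    \<comment> \<open>The Pell identity eliminates the mixed term, and \<open>nT\<close> makes the
      remainder \<open>nrm (T * p d) - 8 * nrm (p d)\<close> nonpositive.\<close>
    also have "\<dots> = 4 * 2 ^ Suc d - 8 * nrm (p d) + nrm (T * p d)"
      using pell[of d] by simp
    also have "\<dots> \<le> 4 * 2 ^ Suc d" using nT[of d] by simp
    finally have "(Re (h (star 1 * ?a)))\<^sup>2 \<le> 4 * 2 ^ Suc d"
      using cauchy_schwarz[of 1 ?a] by (simp add: nrm_one)
    then have "\<bar>Re (h ?a)\<bar> \<le> sqrt (4 * 2 ^ Suc d)"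
      by (simp add: real_le_rsqrt real_sqrt_le_iff flip: real_sqrt_abs)
    also have "\<dots> = 2 * sqrt (2 ^ Suc d)" by (simp only: real_sqrt_mult real_sqrt_four)
    finally show ?thesis by simp
  qed
  show ?thesis
  proof (induction e)
    case 0
    then show ?case using p0 by (simp add: h_one)
  next
    case (Suc e)
    \<comment> \<open>By the recursion, the polynomial of the first kind is the difference of two of
      the second kind, so summing over even indices adds at most \<open>2 * 2 ^ Suc e\<close> at
      each step.\<close>
    have "2 *\<^sub>C p (Suc (Suc (2 * e))) - T * p (Suc (2 * e)) = p (Suc (Suc (2 * e))) - 2 *\<^sub>C p (2 * e)"
      unfolding rec using scaleC_add_left[of 1 1 "p (Suc (Suc (2 * e)))"] by simp
    then have "Re (h (p (2 * Suc e))) \<le> 2 * sqrt (2 ^ Suc (Suc (2 * e))) + 2 * Re (h (p (2 * e)))"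
      using cheb[of "Suc (2 * e)"] by (simp add: h_diff h_scale)
    also have "sqrt (2 ^ Suc (Suc (2 * e))) = 2 ^ Suc e"
      using real_sqrt_abs[of "2 ^ Suc e"] by (simp add: power_mult[symmetric] mult.commute flip: power_Suc)
    also have "2 * 2 ^ Suc e + 2 * Re (h (p (2 * e))) \<le> 2 * 2 ^ Suc e + 2 * ((2 * e + 2) * 2 ^ e)"
      using Suc by simp
    also have "\<dots> = (2 * real (Suc e) + 2) * 2 ^ Suc e" by (simp add: algebra_simps)
    finally show ?case by (simp add: algebra_simps)
  qed
qed

end

section \<open>Moments of the self-adjoint main character\<close>

context haar_biunitary
begin

lemma star_T: "star T = T"
  unfolding main_sum_def star_sum by (simp add: UNIV_bool add.commute)

lemma T_power: "T ^ k = (\<Sum>w\<in>idx k. \<Sum>i\<in>idx k. U w i i)"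
proof (induction k)
  case (Suc k)
  have "T ^ Suc k = (\<Sum>c\<in>UNIV. \<Sum>a\<in>UNIV. \<Sum>w\<in>idx k. \<Sum>i\<in>idx k. V c a a * U w i i)"
    unfolding power_Suc Suc unfolding main_sum_def sum_distrib_right unfolding sum_distrib_left ..
  also have "\<dots> = (\<Sum>c\<in>UNIV. \<Sum>w\<in>idx k. \<Sum>a\<in>UNIV. \<Sum>i\<in>idx k. V c a a * U w i i)"
    by (rule sum.cong[OF refl]) (rule sum.swap)
  also have "\<dots> = (\<Sum>w\<in>idx (Suc k). \<Sum>i\<in>idx (Suc k). U w i i)"
    by (simp add: sum_idx_Suc)
  finally show ?case .
qed simp

text \<open>The number is a diagonal entry of an orthogonal projection.\<close>

lemma cmod_h_diag_le_1:
  assumes "length i = length w"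
  shows "cmod (h (U w i i)) \<le> 1"
proof -
  have "h (U w i i) = (\<Sum>k\<in>ix w. h (U w k i) * h (U w i k))"
    using arg_cong[OF inv_right[OF assms assms], of h] by (simp add: h_sum h_scale h_one)
  also have "\<dots> = of_real (\<Sum>k\<in>ix w. (cmod (h (U w i k)))\<^sup>2)"
    unfolding of_real_sum complex_norm_square using assms by (intro sum.cong refl) (simp add: h_herm mult.commute)
  finally have eq: "h (U w i i) = of_real (\<Sum>k\<in>ix w. (cmod (h (U w i k)))\<^sup>2)" .
  have "(cmod (h (U w i i)))\<^sup>2 \<le> (\<Sum>k\<in>ix w. (cmod (h (U w i k)))\<^sup>2)"
    using assms by (intro member_le_sum) auto
  also have "\<dots> = cmod (h (U w i i))"
    by (subst eq) (simp only: norm_of_real abs_of_nonneg sum_nonneg zero_le_power2)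
  finally have "cmod (h (U w i i)) * cmod (h (U w i i)) \<le> cmod (h (U w i i)) * 1" by (simp add: power2_eq_square)
  then show ?thesis
    by (cases "h (U w i i) = 0") (simp_all add: mult_le_cancel_left)
qed

text \<open>Crude, but it guarantees that the limit defining \<open>char_norm\<close>
  exists.\<close>

lemma moment_bound: "Re (h (T ^ k)) \<le> (2 * real CARD('n)) ^ k"
proof -
  have "Re (h (T ^ k)) \<le> (\<Sum>w\<in>(idx k :: bool list set). \<Sum>i\<in>(idx k :: 'n list set). 1)"
    unfolding T_power h_sum Re_sum
    by (intro sum_mono order_trans[OF complex_Re_le_cmod cmod_h_diag_le_1]) simp
  also have "\<dots> = (2 * real CARD('n)) ^ k"
    by (simp add: card_idx power_mult_distrib)
  finally show ?thesis .
qed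

text \<open>Without nontrivial invariant vectors \<open>h\<close> kills every \<open>sig d\<close>
  except \<open>sig 0\<close>. The weights \<open>s d = sqrt 2 ^ d\<close> satisfy
  \<open>s (d + 2) + 2 * s d = 2 * sqrt 2 * s (d + 1)\<close>, matching \<open>T_sig\<close>, so
  each power of \<open>T\<close> costs a factor \<open>2 * sqrt 2\<close>.\<close>

lemma moment_bound_trivial:
  assumes "inv_words \<subseteq> {[]}"
  shows "Re (h (T ^ (2 * k))) \<le> 8 ^ k"
proof -
  have sig0: "h (sig d) = (if d = 0 then 1 else 0)" for d
  proof (cases "d = 0")
    case False
    have "h (chr w) = 0" if "w \<in> idx d" for w
      using that assms False by (intro h_chr_zero) auto
    then show ?thesis using False by (simp add: sig_def h_sum)
  qed (simp add: h_one)
  have "cmod (h (T ^ k * sig d)) \<le> (2 * sqrt 2) ^ k * sqrt 2 ^ d" for k d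
  proof (induction k arbitrary: d)
    case 0
    then show ?case by (simp add: sig0)
  next
    case (Suc k)
    show ?case
    proof (cases d)
      case 0
      have "T ^ Suc k * sig d = T ^ k * sig 1"
        using 0 T_sig_0 by (simp add: power_commutes)
      then have "cmod (h (T ^ Suc k * sig d)) \<le> (2 * sqrt 2) ^ k * sqrt 2 ^ 1"
        using Suc[of 1] by simp
      also have "\<dots> \<le> (2 * sqrt 2) ^ Suc k * sqrt 2 ^ d"
        using 0 by simp
      finally show ?thesis .
    next
      case (Suc d')
      have "T ^ Suc k * sig d = T ^ k * (T * sig (Suc d'))"
        using Suc by (simp add: power_commutes flip: mult.assoc)
      also have "\<dots> = T ^ k * sig (Suc (Suc d')) + 2 *\<^sub>C (T ^ k * sig d')"
        unfolding T_sig by (simp add: distrib_left)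
      finally have "cmod (h (T ^ Suc k * sig d)) \<le> cmod (h (T ^ k * sig (Suc (Suc d')))) + 2 * cmod (h (T ^ k * sig d'))"
        using norm_triangle_ineq[of "h (T ^ k * sig (Suc (Suc d')))" "2 * h (T ^ k * sig d')"]
        by (simp add: h_add h_scale norm_mult)
      also have "\<dots> \<le> (2 * sqrt 2) ^ k * sqrt 2 ^ Suc (Suc d') + 2 * ((2 * sqrt 2) ^ k * sqrt 2 ^ d')"
        by (intro add_mono mult_left_mono Suc.IH) auto
      also have "\<dots> = (2 * sqrt 2) ^ Suc k * sqrt 2 ^ d"
        using Suc by (simp add: algebra_simps)
      finally show ?thesis .
    qed
  qed
  from this[of "2 * k" 0] have "cmod (h (T ^ (2 * k))) \<le> (2 * sqrt 2) ^ (2 * k)" by simp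
  also have "\<dots> = 8 ^ k" by (simp add: power_mult power_mult_distrib)
  finally show ?thesis using complex_Re_le_cmod order_trans by blast
qed

lemma inv_left:
  assumes "length i = length w" "length j = length w"
  shows "(\<Sum>k\<in>ix w. h (U w i k) *\<^sub>C U w k j) = h (U w i j) *\<^sub>C 1"
proof -
  have "(\<Sum>k\<in>ix w. h (U w i k) *\<^sub>C U w k j) = (\<Sum>k\<in>ix w. cnj (h (U w k i)) *\<^sub>C U w k j)"
    using assms by (intro sum.cong refl) (simp add: h_herm)
  also have "\<dots> = cnj (h (U w j i)) *\<^sub>C 1"
    using assms by (intro fixed_cnj fixed_h_column)
  finally show ?thesis using assms by (simp add: h_herm)
qed

end

lemma haar_state_state: "haar_state \<Delta> h \<Longrightarrow> state h"
  by (simp add: haar_state_def state_def)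

text \<open>Hermiticity comes from unitarity: left invariance together with \<open>h_star\<close>
  shows that the matrix of values of \<open>h\<close> equals itself times its adjoint, hence is
  selfadjoint.\<close>

lemma haar_state_biunitary:
  fixes u :: "'n::finite \<Rightarrow> 'n \<Rightarrow> 'a::complex_star_algebra"
  assumes "biunitary u" and \<Delta>: "star_hom \<Delta>" "matrix_comult \<Delta> u" and h: "haar_state \<Delta> h"
  shows "haar_biunitary u h"
proof -
  interpret biunitary u by fact
  interpret state h by (rule haar_state_state[OF h])
  note b = balanced_functional[OF linear_h]
  have P: "(\<Sum>k\<in>ix w. h (U w i k) *\<^sub>C U w k j) = h (U w i j) *\<^sub>C 1"
    "(\<Sum>k\<in>ix w. h (U w k j) *\<^sub>C U w i k) = h (U w i j) *\<^sub>C 1"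
    if ij: "length i = length w" "length j = length w" for w i j
  proof -
    have "tensor_lift (\<lambda>a b. h a *\<^sub>C b) (\<Delta> (U w i j)) = h (U w i j) *\<^sub>C 1"
      "tensor_lift (\<lambda>a b. h b *\<^sub>C a) (\<Delta> (U w i j)) = h (U w i j) *\<^sub>C 1"
      using h by (auto simp: haar_state_def)
    then show "(\<Sum>k\<in>ix w. h (U w i k) *\<^sub>C U w k j) = h (U w i j) *\<^sub>C 1"
      "(\<Sum>k\<in>ix w. h (U w k j) *\<^sub>C U w i k) = h (U w i j) *\<^sub>C 1"
      by (simp_all add: comult_um[OF \<Delta> ij] tensor_lift_sum[OF b(1)] tensor_lift_sum[OF b(2)]
          tensor_lift_tensor[OF b(1)] tensor_lift_tensor[OF b(2)])
  qed
  have h_sum: "h (sum f A) = (\<Sum>x\<in>A. h (f x))" for f and A :: "'n list set"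
  proof -
    have "h 0 = 0" using h_add[of 0 0] by simp
    then show ?thesis by (induction A rule: infinite_finite_induct) (simp_all add: h_add)
  qed
  have PP: "h (U w i j) = (\<Sum>l\<in>ix w. h (U w i l) * cnj (h (U w j l)))"
    if ij: "length i = length w" "length j = length w" for w i j
  proof -
    have "(\<Sum>l\<in>ix w. h (U w i l) *\<^sub>C star (U w j l)) =
        (\<Sum>l\<in>ix w. (\<Sum>k\<in>ix w. h (U w i k) *\<^sub>C U w k l) * star (U w j l))"
      using ij by (intro sum.cong refl) (simp add: P(1))
    also have "\<dots> = (\<Sum>k\<in>ix w. h (U w i k) *\<^sub>C (\<Sum>l\<in>ix w. U w k l * star (U w j l)))"
      unfolding sum_distrib_right scaleC_sum_right by (subst sum.swap) simp
    also have "\<dots> = (\<Sum>k\<in>ix w. if k = j then h (U w i k) *\<^sub>C 1 else 0)"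
      using ij by (intro sum.cong refl) (simp add: U_row)
    also have "\<dots> = h (U w i j) *\<^sub>C 1" using ij by simp
    finally have "h (\<Sum>l\<in>ix w. h (U w i l) *\<^sub>C star (U w j l)) = h (h (U w i j) *\<^sub>C 1)" by simp
    then show ?thesis by (simp add: h_sum h_scale h_one h_star)
  qed
  show ?thesis
  proof (intro haar_biunitary.intro haar_biunitary_axioms.intro)
    show "biunitary u" "clinear h" "h 1 = 1" by (fact assms linear_h h_one)+
    fix w :: "bool list" and i j :: "'n list" assume ij: "length i = length w" "length j = length w"
    show "(\<Sum>k\<in>ix w. h (U w k j) *\<^sub>C U w i k) = h (U w i j) *\<^sub>C 1"
      using ij by (rule P(2))
    show "cnj (h (U w i j)) = h (U w j i)"
      by (subst PP[OF ij], subst PP[OF ij(2,1)]) (simp add: mult.commute)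
  qed
qed

lemma char_norm_eq:
  fixes \<Gamma> :: "('a::complex_star_algebra, 'n::finite) dqg"
  assumes "haar_biunitary (fund \<Gamma>) h" "haar (comult \<Gamma>) = h"
  shows "char_norm \<Gamma> = lim (\<lambda>k. root (2 * k) (Re (h (biunitary.main_sum (fund \<Gamma>) ^ (2 * k)))))"
proof -
  interpret haar_biunitary "fund \<Gamma>" h by fact
  have "main_char \<Gamma> + star (main_char \<Gamma>) = main_sum"
    by (simp add: main_char_def main_sum_def UNIV_bool star_sum uc_def add.commute)
  then show ?thesis by (simp add: char_norm_def char_moment_def assms(2))
qed

section \<open>Comultiplication and Haar state of the free unitary quantum group\<close>

text \<open>\<open>comult FU\<close> is a definite description, so it has content only after
  existence and uniqueness. The candidate matrix satisfies the defining relators, and two solutions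
  agree on the coefficients of words, which span.\<close>

lemma comult_FU:
  assumes N: "CARD('n::finite) \<ge> 2"
  defines "\<Delta> \<equiv> comult (FU :: ('n gen_U univ_star, 'n) dqg)"
  shows "star_hom \<Delta>" "matrix_comult \<Delta> uuniv"
proof -
  let ?u = "uuniv :: 'n \<Rightarrow> 'n \<Rightarrow> 'n gen_U univ_star"
  interpret biunitary ?u by (rule uuniv_biunitary[OF N])
  define b where "b = (\<lambda>g. \<Sum>k\<in>UNIV. ?u (gen_row g) k \<otimes>\<^sub>C ?u k (gen_col g))"
  have ev: "uc (\<lambda>i j. b (Gen_U i j)) c i j = (\<Sum>k\<in>UNIV. uc ?u c i k \<otimes>\<^sub>C uc ?u c k j)" for c i j
    by (simp add: uc_def b_def star_sum star_tensor_tensor)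
  have ev': "free_eval b (uc ufree c i j) = (\<Sum>k\<in>UNIV. uc ?u c i k \<otimes>\<^sub>C uc ?u c k j)" for c i j
    unfolding ev[symmetric] uc_hom[OF free_eval_star_hom, symmetric] by (simp add: ufree_def free_eval_gen)
  note fe = star_hom_props[OF free_eval_star_hom[of b]]
  have if_fe: "free_eval b (if c then 1 else 0) = (if c then 1 else 0)" for c by (simp add: fe)
  have 1: "(\<Sum>k\<in>UNIV. (\<Sum>e\<in>UNIV. uc ?u c i e \<otimes>\<^sub>C uc ?u c e k) * (\<Sum>f\<in>UNIV. uc ?u (\<not> c) j f \<otimes>\<^sub>C uc ?u (\<not> c) f k)) =
      (if i = j then 1 else 0)" for c i j
  proof -
    have "(\<Sum>k\<in>UNIV. (\<Sum>e\<in>UNIV. uc ?u c i e \<otimes>\<^sub>C uc ?u c e k) * (\<Sum>f\<in>UNIV. uc ?u (\<not> c) j f \<otimes>\<^sub>C uc ?u (\<not> c) f k)) =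
        (\<Sum>e\<in>UNIV. \<Sum>f\<in>UNIV. (uc ?u c i e * uc ?u (\<not> c) j f) \<otimes>\<^sub>C (\<Sum>k\<in>UNIV. uc ?u c e k * uc ?u (\<not> c) f k))"
      unfolding sum_product tensor_times_tensor tensor_sum_right by (rule sum_rot3)
    also have "\<dots> = (\<Sum>e\<in>UNIV. (uc ?u c i e * uc ?u (\<not> c) j e) \<otimes>\<^sub>C 1)"
      unfolding row by (simp add: if_distrib[of "\<lambda>x. _ \<otimes>\<^sub>C x"] cong: if_cong)
    also have "\<dots> = (\<Sum>e\<in>UNIV. uc ?u c i e * uc ?u (\<not> c) j e) \<otimes>\<^sub>C 1"
      by (rule tensor_sum_left[symmetric])
    finally show ?thesis unfolding row by (simp add: one_tensor_def)
  qed
  have 2: "(\<Sum>k\<in>UNIV. (\<Sum>e\<in>UNIV. uc ?u c k e \<otimes>\<^sub>C uc ?u c e i) * (\<Sum>f\<in>UNIV. uc ?u (\<not> c) k f \<otimes>\<^sub>C uc ?u (\<not> c) f j)) =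
      (if i = j then 1 else 0)" for c i j
  proof -
    have "(\<Sum>k\<in>UNIV. (\<Sum>e\<in>UNIV. uc ?u c k e \<otimes>\<^sub>C uc ?u c e i) * (\<Sum>f\<in>UNIV. uc ?u (\<not> c) k f \<otimes>\<^sub>C uc ?u (\<not> c) f j)) =
        (\<Sum>e\<in>UNIV. \<Sum>f\<in>UNIV. (\<Sum>k\<in>UNIV. uc ?u c k e * uc ?u (\<not> c) k f) \<otimes>\<^sub>C (uc ?u c e i * uc ?u (\<not> c) f j))"
      unfolding sum_product tensor_times_tensor tensor_sum_left by (rule sum_rot3)
    also have "\<dots> = (\<Sum>e\<in>UNIV. 1 \<otimes>\<^sub>C (uc ?u c e i * uc ?u (\<not> c) e j))"
      unfolding col by (simp add: if_distrib[of "\<lambda>x. x \<otimes>\<^sub>C _"] cong: if_cong)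
    also have "\<dots> = 1 \<otimes>\<^sub>C (\<Sum>e\<in>UNIV. uc ?u c e i * uc ?u (\<not> c) e j)"
      by (rule tensor_sum_right[symmetric])
    finally show ?thesis unfolding col by (simp add: one_tensor_def)
  qed
  have "free_eval b r = 0" if rel: "r \<in> relators" for r :: "'n gen_U free_star"
  proof -
    consider c i j where "r = (\<Sum>k\<in>UNIV. uc ufree c i k * uc ufree (\<not> c) j k) - (if i = j then 1 else 0)"
      | c i j where "r = (\<Sum>k\<in>UNIV. uc ufree c k i * uc ufree (\<not> c) k j) - (if i = j then 1 else 0)"
      using rel unfolding relators_U by blast
    then show ?thesis
    proof cases
      case r: 1
      show ?thesis unfolding r fe if_fe ev' 1 by simp
    next
      case r: 2
      show ?thesis unfolding r fe if_fe ev' 2 by simp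
    qed
  qed
  then obtain \<psi> where \<psi>: "star_hom \<psi>" "\<And>g. \<psi> (univ_gen g) = b g"
    using univ_star_hom_exists[of b] by blast
  have "matrix_comult \<psi> ?u" by (simp add: matrix_comult_def uuniv_def \<psi>(2) b_def)
  moreover have "D = \<psi>" if D: "star_hom D" "matrix_comult D ?u" for D
  proof
    fix x
    show "D x = \<psi> x"
    proof (induction x rule: uuniv_induct)
      case (1 w i j)
      then show ?case
        using comult_um[OF D] comult_um[OF \<psi>(1) \<open>matrix_comult \<psi> ?u\<close>] by simp
    qed (simp_all add: star_hom_props[OF D(1)] star_hom_props[OF \<psi>(1)])
  qed
  ultimately have ex1: "\<exists>!D. star_hom D \<and> matrix_comult D ?u" using \<psi>(1) by blast
  have "\<Delta> = (THE D. star_hom D \<and> matrix_comult D ?u)"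
    by (simp add: \<Delta>_def FU_def universal_dqg_def Let_def uuniv_def[abs_def])
  then have "star_hom \<Delta> \<and> matrix_comult \<Delta> ?u" using theI'[OF ex1] by simp
  then show "star_hom \<Delta>" "matrix_comult \<Delta> ?u" by auto
qed

lemma fund_FU: "fund FU = uuniv"
  by (simp add: FU_def universal_dqg_def Let_def uuniv_def[abs_def])

lemma irr_span_uuniv:
  assumes N: "CARD('n::finite) \<ge> 2"
  shows "x \<in> biunitary.irr_span (uuniv :: 'n \<Rightarrow> 'n \<Rightarrow> 'n gen_U univ_star)"
proof -
  interpret biunitary "uuniv :: 'n \<Rightarrow> 'n \<Rightarrow> 'n gen_U univ_star" by (rule uuniv_biunitary[OF N])
  show ?thesis
  proof (induction x rule: uuniv_induct)
    case (1 w i j)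
    then show ?case by (rule U_in_irr_span)
  qed (simp_all add: irr_span_def complex_vector.span_add complex_vector.span_scale)
qed

text \<open>Positivity is read off from \<open>h_comb\<close>, every element being a combination of
  irreducible coefficients; invariance extends linearly from the coefficients of words.\<close>

lemma haar_FU:
  assumes N: "CARD('n::finite) \<ge> 2"
  shows "haar_state (comult (FU :: ('n gen_U univ_star, 'n) dqg)) h_U"
proof -
  let ?\<Delta> = "comult (FU :: ('n gen_U univ_star, 'n) dqg)"
  interpret haar_biunitary "uuniv :: 'n \<Rightarrow> 'n \<Rightarrow> 'n gen_U univ_star" h_U
    by (rule h_U_haar_biunitary[OF N])
  note \<Delta> = comult_FU[OF N]
  note D = star_hom_props[OF \<Delta>(1)]
  note b = balanced_functional[OF linear_h]
  have "h_U (star x * x) \<in> \<real>\<^sub>\<ge>\<^sub>0" for x :: "'n gen_U univ_star"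
  proof -
    obtain Z a where "finite Z" "x = comb Z a"
      using irr_span_comb[OF irr_span_uuniv[OF N, of x]] by blast
    then show ?thesis using h_comb_nonneg[OF inv_words_uuniv[OF N]] by simp
  qed
  moreover have "tensor_lift (\<lambda>a b. h_U a *\<^sub>C b) (?\<Delta> x) = h_U x *\<^sub>C 1" for x
  proof (induction x rule: uuniv_induct)
    case (1 w i j)
    then show ?case
      by (simp add: comult_um[OF \<Delta>] tensor_lift_sum[OF b(1)] tensor_lift_tensor[OF b(1)] inv_left)
  next
    case (2 x y)
    then show ?case by (simp add: D tensor_lift_add[OF b(1)] h_add scaleC_add_left)
  next
    case (3 c x)
    have "tensor_lift (\<lambda>a b. h_U a *\<^sub>C b) (c *\<^sub>C t) = c *\<^sub>C tensor_lift (\<lambda>a b. h_U a *\<^sub>C b) t" for t :: "('n gen_U univ_star, 'n gen_U univ_star) tensor"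
      by (rule tensor_additive_ext[where t = t])
        (simp_all add: scaleC_add_right tensor_lift_add[OF b(1)] tensor_lift_tensor[OF b(1)] h_scale flip: tensor_scaleC_left)
    then show ?case using 3 by (simp add: D h_scale)
  qed
  moreover have "tensor_lift (\<lambda>a b. h_U b *\<^sub>C a) (?\<Delta> x) = h_U x *\<^sub>C 1" for x
  proof (induction x rule: uuniv_induct)
    case (1 w i j)
    then show ?case
      by (simp add: comult_um[OF \<Delta>] tensor_lift_sum[OF b(2)] tensor_lift_tensor[OF b(2)] inv_right)
  next
    case (2 x y)
    then show ?case by (simp add: D tensor_lift_add[OF b(2)] h_add scaleC_add_left)
  next
    case (3 c x)
    have "tensor_lift (\<lambda>a b. h_U b *\<^sub>C a) (c *\<^sub>C t) = c *\<^sub>C tensor_lift (\<lambda>a b. h_U b *\<^sub>C a) t" for t :: "('n gen_U univ_star, 'n gen_U univ_star) tensor"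
      by (rule tensor_additive_ext[where t = t])
        (simp_all add: scaleC_add_right tensor_lift_add[OF b(2)] tensor_lift_tensor[OF b(2)] h_scale flip: tensor_scaleC_right)
    then show ?case using 3 by (simp add: D h_scale)
  qed
  ultimately show ?thesis using linear_h h_one by (simp add: haar_state_def)
qed

lemma char_norm_FU_le:
  assumes N: "CARD('n::finite) \<ge> 2"
  shows "char_norm (FU :: ('n gen_U univ_star, 'n) dqg) \<le> 2 * sqrt 2"
proof -
  interpret haar_biunitary "uuniv :: 'n \<Rightarrow> 'n \<Rightarrow> 'n gen_U univ_star" h_U
    by (rule h_U_haar_biunitary[OF N])
  interpret s: state "h_U :: 'n gen_U univ_star \<Rightarrow> complex"
    by (rule haar_state_state[OF haar_FU[OF N]])
  have "Re (h_U (main_sum ^ (2 * k))) \<le> (2 * sqrt 2) ^ (2 * k)" for k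
    using moment_bound_trivial[OF inv_words_uuniv[OF N], of k] by (simp add: power_mult power_mult_distrib)
  from s.moment_norm(1)[OF star_T this] show ?thesis
    using char_norm_eq[of "FU :: ('n gen_U univ_star, 'n) dqg" h_U] h_U_haar_biunitary[OF N] haar_eqI[OF haar_FU[OF N]]
    by (simp add: fund_FU)
qed

section \<open>Comparison of a quotient with the free unitary quantum group\<close>

theorem theorem4p3:
  fixes \<Gamma> :: "('a::complex_star_algebra, 'n::finite) dqg"
  assumes "discrete_quantum_group \<Gamma>"
    and "(CARD('n) \<ge> 4 \<and> FU \<twoheadrightarrow> \<Gamma> \<and> \<Gamma> \<twoheadrightarrow> FS) \<or>
         (CARD('n) \<ge> 2 \<and> FU \<twoheadrightarrow> \<Gamma> \<and> \<Gamma> \<twoheadrightarrow> FO)"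
    and "char_norm \<Gamma> = char_norm (FU :: ('n gen_U univ_star, 'n) dqg)"
  shows "dqg_isomorphic \<Gamma> FU"
proof -
  have N: "CARD('n) \<ge> 2" using assms(2) by auto
  obtain \<phi> where \<phi>: "star_hom \<phi>" "\<And>i j. \<phi> (uuniv i j) = fund \<Gamma> i j"
    using assms(2) by (auto simp: surjects_def fund_FU)
  note hom = star_hom_props[OF \<phi>(1)]
  interpret FU: biunitary "uuniv :: 'n \<Rightarrow> 'n \<Rightarrow> 'n gen_U univ_star" by (rule uuniv_biunitary[OF N])
  have bi: "biunitary (fund \<Gamma>)"
    using biunitary_hom[OF uuniv_biunitary[OF N] \<phi>(1)] by (simp add: \<phi>(2))
  obtain h where h: "haar_state (comult \<Gamma>) h"
    using assms(1) by (auto simp: discrete_quantum_group_def compact_quantum_group_def)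
  have hb: "haar_biunitary (fund \<Gamma>) h"
    using assms(1) by (intro haar_state_biunitary[OF bi _ _ h])
      (auto simp: discrete_quantum_group_def compact_quantum_group_def hopf_star_algebra_def)
  interpret haar_biunitary "fund \<Gamma>" h by (rule hb)
  interpret s: state h by (rule haar_state_state[OF h])
  \<comment> \<open>The limit dominates each moment; equality of the norms then replaces it by
    \<open>2 * sqrt 2\<close>, whose square is 8.\<close>
  have "Re (h (main_sum ^ (2 * k))) \<le> char_norm \<Gamma> ^ (2 * k)" for k
    unfolding char_norm_eq[OF hb haar_eqI[OF h]]
    by (rule s.moment_norm(2)[OF star_T moment_bound]) simp
  moreover have "char_norm \<Gamma> ^ (2 * k) \<le> 8 ^ k" for k
  proof -
    have "char_norm \<Gamma> \<ge> 0"
      unfolding char_norm_eq[OF hb haar_eqI[OF h]]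
      by (rule s.moment_norm(3)[OF star_T moment_bound]) simp
    then have "char_norm \<Gamma> ^ (2 * k) \<le> (2 * sqrt 2) ^ (2 * k)"
      using assms(3) char_norm_FU_le[OF N] by (intro power_mono) auto
    then show ?thesis by (simp add: power_mult power_mult_distrib)
  qed
  ultimately have moments: "Re (h (main_sum ^ (2 * k))) \<le> 8 ^ k" for k using order_trans by blast
  have triv: "inv_words \<subseteq> {[]}"
  proof (rule ccontr)
    assume "\<not> inv_words \<subseteq> {[]}"
    then obtain e where e: "card {x \<in> inv_words. length x = 2 * e} > (2 * e + 2) * 2 ^ e"
      using inv_words_growth by blast
    have "Re (h (sig (2 * e))) \<le> (2 * e + 2) * 2 ^ e"
      by (rule s.chebyshev_bound[OF star_T sig_0 T_sig_0[symmetric] T_sig moments])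
    then have "real (card {x \<in> inv_words. length x = 2 * e}) \<le> real ((2 * e + 2) * 2 ^ e)"
      using h_sig_ge[of "2 * e"] by simp
    then show False using e by linarith
  qed
  have "inj \<phi>"
  proof (rule injI)
    fix x y assume "\<phi> x = \<phi> y"
    then have 0: "\<phi> (x - y) = 0" by (simp add: hom)
    obtain Z a where Z: "finite Z" "x - y = FU.comb Z a"
      using FU.irr_span_comb[OF irr_span_uuniv[OF N, of "x - y"]] by blast
    \<comment> \<open>Both sides involve the same \<open>jw\<close>, so \<open>\<phi>\<close> keeps
      the scalars of a combination. Faithfulness in \<open>\<Gamma>\<close> then annihilates the
      compressed scalars, and with them the combination in \<open>FU\<close>.\<close>
    have "\<phi> (FU.irr z i j) = irr z i j" for z i j
      using um_hom[OF \<phi>(1), of uuniv z] by (simp add: FU.irr_def irr_def hom \<phi>(2))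
    then have "comb Z a = 0"
      using 0 unfolding Z by (simp add: FU.comb_def comb_def hom)
    then have "sandwich z (a z) i j = 0" if "z \<in> Z" "length i = length z" "length j = length z" for z i j
      using h_comb_faithful[OF triv Z(1)] that by simp
    then have "x - y = 0" unfolding Z by (intro FU.comb_zero)
    then show "x = y" by simp
  qed
  moreover have "surj \<phi>"
  proof -
    have "x \<in> range \<phi>" if "x \<in> star_subalgebra {fund \<Gamma> i j |i j. True}" for x
      using that
    proof induction
      case (gen g)
      then obtain i j where "g = fund \<Gamma> i j" by blast
      then show ?case using rangeI[of \<phi> "uuniv i j"] by (simp add: \<phi>(2))
    next
      case one
      show ?case using rangeI[of \<phi> 1] by (simp add: hom)
    next
      case (add x y)
      then show ?case by (auto simp: hom(1)[symmetric])
    next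
      case (scale x c)
      then show ?case by (auto simp: hom(2)[symmetric])
    next
      case (mult x y)
      then show ?case by (auto simp: hom(4)[symmetric])
    next
      case (star x)
      then show ?case by (auto simp: hom(5)[symmetric])
    qed
    then show ?thesis using assms(1) by (auto simp: discrete_quantum_group_def)
  qed
  ultimately have bij: "bij \<phi>" by (simp add: bij_def)
  \<comment> \<open>The isomorphism is required from \<open>\<Gamma>\<close> to \<open>FU\<close>,
    opposite to the direction of \<open>\<phi>\<close>.\<close>
  define \<psi> where "\<psi> = inv \<phi>"
  have \<psi>: "\<phi> (\<psi> x) = x" "\<psi> (\<phi> y) = y" for x y
    using bij by (simp_all add: \<psi>_def bij_is_surj surj_f_inv_f bij_is_inj)
  have "star_hom \<psi>"
    unfolding star_hom_iff
  proof (intro conjI allI)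
    show "\<psi> (x + y) = \<psi> x + \<psi> y" for x y using \<psi>(2)[of "\<psi> x + \<psi> y"] by (simp add: hom \<psi>(1))
    show "\<psi> (c *\<^sub>C x) = c *\<^sub>C \<psi> x" for c x using \<psi>(2)[of "c *\<^sub>C \<psi> x"] by (simp add: hom \<psi>(1))
    show "\<psi> 1 = 1" using \<psi>(2)[of 1] by (simp add: hom)
    show "\<psi> (x * y) = \<psi> x * \<psi> y" for x y using \<psi>(2)[of "\<psi> x * \<psi> y"] by (simp add: hom \<psi>(1))
    show "\<psi> (star x) = star (\<psi> x)" for x using \<psi>(2)[of "star (\<psi> x)"] by (simp add: hom \<psi>(1))
  qed
  moreover have "bij \<psi>" using bij by (simp add: \<psi>_def bij_imp_bij_inv)
  moreover have "\<psi> (fund \<Gamma> i j) = fund FU i j" for i j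
    using \<psi>(2)[of "uuniv i j"] by (simp add: \<phi>(2) fund_FU)
  ultimately show ?thesis unfolding dqg_isomorphic_def by blast
qed

end
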